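(* Let $d\ge2$ and let $(\Omega,D)$ be an admissible pair in $\mathbb{R}^d$ with $D\ne\emptyset$. Then for every $p\in(1,\infty)$ there is a constant $c_p$ such that $$\int_\Omega\left|\frac{f}{\mathrm{d}_D}\right|^p\,dx\le c_p\int_\Omega|\nabla f|^p\,dx$$ holds for all $f\in W^{1,p}_D(\Omega)$, where $\mathrm{d}_D(x)$ denotes the distance from $x$ to $D$.
   Context: Admissible pair: $(\Omega,D)$ is admissible if $\Omega\subseteq\mathbb{R}^d$ ($d\ge2$) is a bounded domain, $D$ is a closed subset of $\partial\Omega$, and (a) for every $x\in\overline{\partial\Omega\setminus D}$ there are an open neighbourhood $U_x$ of $x$ and a bi-Lipschitz map $\phi_x$ from $U_x$ onto the cube $K=(-1,1)^d$ with $\phi_x(x)=0$, $\phi_x(U_x\cap\Omega)=\{y\in K:y_d<0\}$ and $\phi_x(U_x\cap\partial\Omega)=\{y\in K:y_d=0\}$; (b) $D$ is either empty or satisfies the Ahlfors-David condition: there are constants $c_0,c_1,r_{AD}>0$ such that $c_0r^{d-1}\le\mathcal{H}_{d-1}(D\cap B(x,r))\le c_1r^{d-1}$ for all $x\in D$ and $r\in(0,r_{AD}]$, where $\mathcal{H}_{d-1}$ is the $(d-1)$-dimensional Hausdorff measure and $B(x,r)$ the ball around $x$ of radius $r$. For $1\le q<\infty$, $W^{1,q}_D(\Omega)$ is the completion of $C_D^\infty(\Omega)=\{\psi|_\Omega:\psi\in C_0^\infty(\mathbb{R}^d),\ \operatorname{supp}\psi\cap D=\emptyset\}$ with respect to the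 norm $\psi\mapsto(\int_\Omega|\nabla\psi|^q+|\psi|^q\,dx)^{1/q}$. *)

theory Defs
  imports "HOL-Analysis.Analysis"
begin

text \<open>
  The index \<open>l\<close> below marks the coordinate written \<open>y\<^sub>d\<close>; a finite index type has no canonical
  last element, so it is a parameter.
\<close>

definition open_cube :: "(real ^ 'n) set" where
  "open_cube = {y. \<forall>i. - 1 < y $ i \<and> y $ i < 1}"

definition boundary_chart ::
  "'n \<Rightarrow> (real ^ 'n) set \<Rightarrow> real ^ 'n \<Rightarrow> (real ^ 'n) set \<Rightarrow> (real ^ 'n \<Rightarrow> real ^ 'n) \<Rightarrow> bool" where
  "boundary_chart l \<Omega> x U \<phi> \<longleftrightarrow>
     open U \<and> x \<in> U \<and>
     (\<exists>\<phi>'. homeomorphism U open_cube \<phi> \<phi>' \<and>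
        (\<exists>L. L-lipschitz_on U \<phi>) \<and> (\<exists>L. L-lipschitz_on open_cube \<phi>')) \<and>
     \<phi> x = 0 \<and>
     \<phi> ` (U \<inter> \<Omega>) = {y \<in> open_cube. y $ l < 0} \<and>
     \<phi> ` (U \<inter> frontier \<Omega>) = {y \<in> open_cube. y $ l = 0}"

text \<open>
  Hausdorff measure of integer dimension \<open>s\<close>, as an outer measure and without normalising constant
  (rescaling the measure only rescales \<open>c\<^sub>0\<close> and \<open>c\<^sub>1\<close> below).
  Boundedness of the covering sets has to be required because \<^const>\<open>diameter\<close> is not meaningful
  on unbounded sets; empty sets contribute \<open>0\<close> also when \<open>s = 0\<close>.
\<close>

definition hausdorff_premeasure :: "nat \<Rightarrow> real \<Rightarrow> 'a::metric_space set \<Rightarrow> ennreal" where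
  "hausdorff_premeasure s \<delta> A =
     (INF C \<in> {C :: nat \<Rightarrow> 'a set. A \<subseteq> (\<Union>j. C j) \<and> (\<forall>j. bounded (C j) \<and> diameter (C j) \<le> \<delta>)}.
        \<Sum>j. if C j = {} then 0 else ennreal (diameter (C j) ^ s))"

definition hausdorff_measure :: "nat \<Rightarrow> 'a::metric_space set \<Rightarrow> ennreal" where
  "hausdorff_measure s A = (SUP \<delta> \<in> {0<..}. hausdorff_premeasure s \<delta> A)"

definition ahlfors_david :: "(real ^ 'n) set \<Rightarrow> bool" where
  "ahlfors_david D \<longleftrightarrow>
     (\<exists>c0 c1 rAD :: real. c0 > 0 \<and> c1 > 0 \<and> rAD > 0 \<and>
        (\<forall>x\<in>D. \<forall>r\<in>{0<..rAD}.
           ennreal (c0 * r ^ (CARD('n) - 1)) \<le> hausdorff_measure (CARD('n) - 1) (D \<inter> ball x r) \<and>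
           hausdorff_measure (CARD('n) - 1) (D \<inter> ball x r) \<le> ennreal (c1 * r ^ (CARD('n) - 1))))"

definition admissible :: "'n \<Rightarrow> (real ^ 'n) set \<Rightarrow> (real ^ 'n) set \<Rightarrow> bool" where
  "admissible l \<Omega> D \<longleftrightarrow>
     open \<Omega> \<and> connected \<Omega> \<and> \<Omega> \<noteq> {} \<and> bounded \<Omega> \<and>
     closed D \<and> D \<subseteq> frontier \<Omega> \<and>
     (\<forall>x \<in> closure (frontier \<Omega> - D). \<exists>U \<phi>. boundary_chart l \<Omega> x U \<phi>) \<and>
     (D = {} \<or> ahlfors_david D)"

definition partial_deriv :: "'n::finite \<Rightarrow> (real ^ 'n \<Rightarrow> 'b::real_normed_vector) \<Rightarrow> real ^ 'n \<Rightarrow> 'b" where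
  "partial_deriv i f x = frechet_derivative f (at x) (axis i 1)"

definition grad :: "(real ^ 'n \<Rightarrow> 'b::real_normed_vector) \<Rightarrow> real ^ 'n \<Rightarrow> 'b ^ 'n" where
  "grad f x = (\<chi> i. partial_deriv i f x)"

primrec continuously_differentiable :: "nat \<Rightarrow> (real ^ 'n \<Rightarrow> 'b::real_normed_vector) \<Rightarrow> bool" where
  "continuously_differentiable 0 f \<longleftrightarrow> continuous_on UNIV f"
| "continuously_differentiable (Suc k) f \<longleftrightarrow>
     (\<forall>x. f differentiable at x) \<and> (\<forall>i. continuously_differentiable k (partial_deriv i f))"

definition support :: "(real ^ 'n \<Rightarrow> 'b::real_normed_vector) \<Rightarrow> (real ^ 'n) set" where
  "support f = closure {x. f x \<noteq> 0}"

text \<open>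
  The functions on the whole space whose restrictions to \<open>\<Omega>\<close> form \<open>C\<^sub>D\<^sup>\<infinity>(\<Omega>)\<close>.
\<close>

definition test_functions :: "(real ^ 'n) set \<Rightarrow> (real ^ 'n \<Rightarrow> 'b::real_normed_vector) set" where
  "test_functions D =
     {\<psi>. (\<forall>k. continuously_differentiable k \<psi>) \<and> compact (support \<psi>) \<and> support \<psi> \<inter> D = {}}"

text \<open>
  The map \<open>\<psi> \<mapsto> (\<psi>, \<nabla>\<psi>)\<close> is isometric into \<open>L\<^sup>q(\<Omega>) \<times> L\<^sup>q(\<Omega>)\<close>, so the completion
  is the closure of its image: an element is a function \<open>f\<close> together with its gradient \<open>df\<close>,
  both limits in \<open>L\<^sup>q\<close> along one sequence of test functions. Almost-everywhere equal
  representatives are all included. \<open>df\<close> is the weak gradient of \<open>f\<close>, hence determined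
  by \<open>f\<close> almost everywhere on \<open>\<Omega>\<close>. The values off \<open>\<Omega>\<close> are irrelevant.
\<close>

definition W1_D :: "real \<Rightarrow> (real ^ 'n) set \<Rightarrow> (real ^ 'n) set \<Rightarrow>
    ((real ^ 'n \<Rightarrow> 'b::euclidean_space) \<times> (real ^ 'n \<Rightarrow> 'b ^ 'n)) set" where
  "W1_D q \<Omega> D =
     {(f, df). f \<in> borel_measurable (lebesgue_on \<Omega>) \<and> df \<in> borel_measurable (lebesgue_on \<Omega>) \<and>
        (\<exists>\<psi> :: nat \<Rightarrow> real ^ 'n \<Rightarrow> 'b. (\<forall>j. \<psi> j \<in> test_functions D) \<and>
           (\<lambda>j. \<integral>\<^sup>+x. ennreal (norm (grad (\<psi> j) x - df x) powr q + norm (\<psi> j x - f x) powr q)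
                 \<partial>lebesgue_on \<Omega>) \<longlonglongrightarrow> 0)}"

end

theory Submission imports Defs begin

text \<open>
  The inequality is reduced to the weighted \<open>L\<^sup>1\<close> estimate
  \<open>\<integral>\<^sub>\<Omega> v d\<^sub>D\<^bsup>-p\<^esup> \<le> K \<integral>\<^sub>\<Omega> |\<nabla>v| d\<^sub>D\<^bsup>1-p\<^esup>\<close>: applied to \<open>v = |u|\<^sup>p\<close> for a test
  function \<open>u\<close>, its right-hand side is absorbed by Young's inequality.

  Being linear in \<open>v\<close>, this estimate can be localised without cut-off functions. Near a point of \<open>D\<close>
  it follows by averaging \<open>|v(x)| \<le> \<integral> |\<nabla>v|\<close> over the segments from \<open>x\<close> to the points of \<open>D\<close> at distance
  comparable to \<open>d\<^sub>D(x)\<close>; Tonelli's theorem and \<open>\<integral>\<^sub>D |y - z|\<^bsup>-(d + p - 2)\<^esup> dH(z) \<le> C d\<^sub>D(y)\<^bsup>1 - p\<^esup>\<close> give the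
  claim. In a Lipschitz chart the segments stay in the half cube, and away from the charts they can
  leave \<open>\<Omega>\<close> only through \<open>D\<close>, where \<open>v\<close> vanishes, so neither an extension operator nor a maximal
  function is needed. The surface measure is replaced by counting the points of fine nets in \<open>D\<close>.
  The estimate spreads from there to all of the closure of \<open>\<Omega>\<close> by connectedness and the Poincare
  inequality on convex sets.
\<close>


section \<open>Slopes along curves\<close>

text \<open>The constant must not depend on the test function, although each test function has its
  own zone around D where it vanishes. Nets are therefore chosen at the scale \<eta> of that zone:
  their counts are comparable to (r / \<eta>)^(d-1) with constants independent of \<eta>, averaging
  contributes \<eta>^(d-1), the potential contributes its inverse, and the two cancel. The vanishing
  zone serves again when the left-hand side has to be finite before half of it is absorbed. The
  condition p > 1 enters twice: the dyadic series for the potential has ratio 2^(1-p), and Tonelli's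
  theorem leaves the integral of s^(p-2) over the unit interval. Upper gradients replace derivatives
  because the charts are merely bi-Lipschitz: a slope bound survives composition with them up to the
  Lipschitz constant. For the same reason volumes are compared by one-sided covering bounds instead
  of a Jacobian. The spreading argument runs in the closure of \<Omega> because it starts at points
  of D, and these lie on the boundary.\<close>

lemma abs_increment_le_integral:
  fixes f h :: "real \<Rightarrow> real"
  assumes ab: "a \<le> b" and h: "continuous_on {a..b} h"
    and slope: "\<And>t e. t \<in> {a..b} \<Longrightarrow> e > 0 \<Longrightarrow>
       \<exists>d>0. \<forall>s\<in>{a..b}. \<bar>s - t\<bar> < d \<longrightarrow> \<bar>f s - f t\<bar> \<le> (h t + e) * \<bar>s - t\<bar>"
  shows "\<bar>f b - f a\<bar> \<le> integral {a..b} h"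
proof (rule field_le_epsilon)
  fix e' :: real assume "e' > 0"
  define e where "e = e' / (b - a + 1)"
  have e: "e > 0" using \<open>e' > 0\<close> ab by (simp add: e_def)
  have int: "h integrable_on {s..t}" if "a \<le> s" "t \<le> b" for s t
    by (rule integrable_continuous_interval, rule continuous_on_subset[OF h]) (use that in auto)
  \<comment> \<open>The error e times length is additive under concatenation, so Bolzano's bisection
    principle applies: adjacent intervals and short intervals around each point suffice. The two
    premises, trivial for the whole interval, keep the subintervals inside it.\<close>
  have "a \<le> a \<longrightarrow> b \<le> b \<longrightarrow> \<bar>f b - f a\<bar> \<le> integral {a..b} h + e * (b - a)"
    using ab
  proof (induction rule: Bolzano[where P = "\<lambda>s t. a \<le> s \<longrightarrow> t \<le> b \<longrightarrow> \<bar>f t - f s\<bar> \<le> integral {s..t} h + e * (t - s)"])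
    case (trans s t u)
    show ?case
    proof (intro impI)
      assume "a \<le> s" "u \<le> b"
      then have "integral {s..t} h + integral {t..u} h = integral {s..u} h"
        using trans int by (intro Henstock_Kurzweil_Integration.integral_combine) auto
      with trans \<open>a \<le> s\<close> \<open>u \<le> b\<close> show "\<bar>f u - f s\<bar> \<le> integral {s..u} h + e * (u - s)"
        by (simp add: algebra_simps)
    qed
  next
    case (local x)
    then have x: "x \<in> {a..b}" by simp
    obtain d1 where d1: "d1 > 0" "\<And>s. s \<in> {a..b} \<Longrightarrow> \<bar>s - x\<bar> < d1 \<Longrightarrow> \<bar>f s - f x\<bar> \<le> (h x + e/2) * \<bar>s - x\<bar>"
      using slope[OF x, of "e/2"] e by auto
    obtain d2 where d2: "d2 > 0" "\<And>s. s \<in> {a..b} \<Longrightarrow> \<bar>s - x\<bar> < d2 \<Longrightarrow> \<bar>h s - h x\<bar> < e/2"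
      using h[unfolded continuous_on_iff, rule_format, OF x, of "e/2"] e by (auto simp: dist_real_def)
    show ?case
    proof (rule exI[of _ "min d1 d2"], intro conjI allI impI)
      show "0 < min d1 d2" using d1 d2 by simp
      fix s t assume st: "s \<le> x \<and> x \<le> t \<and> t - s < min d1 d2" and "a \<le> s" "t \<le> b"
      have "\<bar>f s - f x\<bar> \<le> (h x + e/2) * (x - s)" "\<bar>f t - f x\<bar> \<le> (h x + e/2) * (t - x)"
        using d1(2)[of s] d1(2)[of t] st \<open>a \<le> s\<close> \<open>t \<le> b\<close> by auto
      moreover have "(h x + e/2) * (t - s) = (h x + e/2) * (x - s) + (h x + e/2) * (t - x)"
        by (simp flip: distrib_left)
      ultimately have "\<bar>f t - f s\<bar> \<le> (h x + e/2) * (t - s)" by linarith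
      also have "\<dots> = (h x - e/2) * (t - s) + e * (t - s)" by (simp add: algebra_simps)
      also have "(h x - e/2) * (t - s) = integral {s..t} (\<lambda>_. h x - e/2)"
        using st by simp
      also have "\<dots> \<le> integral {s..t} h"
      proof (rule integral_le)
        fix r assume "r \<in> {s..t}"
        then have "\<bar>h r - h x\<bar> < e / 2"
          using st \<open>a \<le> s\<close> \<open>t \<le> b\<close> by (intro d2(2)) auto
        then show "h x - e / 2 \<le> h r" by linarith
      qed (use int \<open>a \<le> s\<close> \<open>t \<le> b\<close> in auto)
      finally show "\<bar>f t - f s\<bar> \<le> integral {s..t} h + e * (t - s)" by simp
    qed
  qed
  then have "\<bar>f b - f a\<bar> \<le> integral {a..b} h + e * (b - a)" by simp
  also have "e * (b - a) \<le> e'"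
    unfolding e_def using ab \<open>e' > 0\<close> by (simp add: field_simps)
  finally show "\<bar>f b - f a\<bar> \<le> integral {a..b} h + e'" by simp
qed

text \<open>\<open>g\<close> is an upper gradient of \<open>v\<close>: it dominates the pointwise slope of \<open>v\<close>.\<close>

definition slope_bound :: "('a::metric_space \<Rightarrow> real) \<Rightarrow> ('a \<Rightarrow> real) \<Rightarrow> bool" where
  "slope_bound v g \<longleftrightarrow> continuous_on UNIV g \<and> (\<forall>x. 0 \<le> v x) \<and> (\<forall>x. 0 \<le> g x) \<and>
     (\<forall>x. \<forall>e>0. \<forall>\<^sub>F y in nhds x. \<bar>v y - v x\<bar> \<le> (g x + e) * dist y x)"

text \<open>Composition with a Lipschitz curve multiplies slopes by at most L, so the increment
  bound applies to v along \<gamma> with the majorant L times g along \<gamma>.\<close>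

lemma slope_bound_along_curve:
  fixes \<gamma> :: "real \<Rightarrow> 'a::metric_space"
  assumes vg: "slope_bound v g" and \<gamma>: "L-lipschitz_on {a..b} \<gamma>" and ab: "a \<le> b"
  shows "ennreal \<bar>v (\<gamma> b) - v (\<gamma> a)\<bar> \<le> ennreal L * (\<integral>\<^sup>+t\<in>{a..b}. ennreal (g (\<gamma> t)) \<partial>lborel)"
proof -
  have L: "L \<ge> 0" using \<gamma> by (rule lipschitz_on_nonneg)
  have g0: "g x \<ge> 0" for x using vg by (simp add: slope_bound_def)
  have c\<gamma>: "continuous_on {a..b} \<gamma>" using \<gamma> by (rule lipschitz_on_continuous_on)
  have cg: "continuous_on {a..b} (\<lambda>t. g (\<gamma> t))"
    by (rule continuous_on_compose2[OF _ c\<gamma>, of UNIV g]) (use vg in \<open>auto simp: slope_bound_def\<close>)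
  have "\<bar>v (\<gamma> b) - v (\<gamma> a)\<bar> \<le> integral {a..b} (\<lambda>t. L * g (\<gamma> t))"
  proof (rule abs_increment_le_integral[OF ab])
    show "continuous_on {a..b} (\<lambda>t. L * g (\<gamma> t))" by (intro continuous_intros cg)
    fix t e :: real assume t: "t \<in> {a..b}" and e: "e > 0"
    \<comment> \<open>L + 1 instead of L because L may be 0.\<close>
    define e1 where "e1 = e / (L + 1)"
    have e1: "e1 > 0" "L * e1 \<le> e" using e L by (auto simp: e1_def field_simps)
    obtain d where d: "d > 0" "\<And>y. dist y (\<gamma> t) < d \<Longrightarrow> \<bar>v y - v (\<gamma> t)\<bar> \<le> (g (\<gamma> t) + e1) * dist y (\<gamma> t)"
      using vg e1(1) unfolding slope_bound_def eventually_nhds_metric by meson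
    show "\<exists>d>0. \<forall>s\<in>{a..b}. \<bar>s - t\<bar> < d \<longrightarrow> \<bar>v (\<gamma> s) - v (\<gamma> t)\<bar> \<le> (L * g (\<gamma> t) + e) * \<bar>s - t\<bar>"
    proof (rule exI[of _ "d / (L + 1)"], intro conjI ballI impI)
      show "d / (L + 1) > 0" using d L by simp
      fix s assume s: "s \<in> {a..b}" "\<bar>s - t\<bar> < d / (L + 1)"
      have dst: "dist (\<gamma> s) (\<gamma> t) \<le> L * \<bar>s - t\<bar>"
        using lipschitz_onD[OF \<gamma> s(1) t] by (simp add: dist_real_def)
      also have "\<dots> \<le> (L + 1) * \<bar>s - t\<bar>" by (simp add: mult_right_mono)
      also have "\<dots> < d" using s(2) L by (simp add: field_simps)
      finally have "\<bar>v (\<gamma> s) - v (\<gamma> t)\<bar> \<le> (g (\<gamma> t) + e1) * dist (\<gamma> s) (\<gamma> t)" by (rule d(2))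
      also have "\<dots> \<le> (g (\<gamma> t) + e1) * (L * \<bar>s - t\<bar>)"
        using dst g0[of "\<gamma> t"] e1 by (intro mult_left_mono) auto
      also have "\<dots> = (L * g (\<gamma> t) + L * e1) * \<bar>s - t\<bar>" by (simp add: algebra_simps)
      also have "\<dots> \<le> (L * g (\<gamma> t) + e) * \<bar>s - t\<bar>"
        using e1 by (intro mult_right_mono) auto
      finally show "\<bar>v (\<gamma> s) - v (\<gamma> t)\<bar> \<le> (L * g (\<gamma> t) + e) * \<bar>s - t\<bar>" .
    qed
  qed
  also have "\<dots> = L * integral {a..b} (\<lambda>t. g (\<gamma> t))" by simp
  finally have le: "\<bar>v (\<gamma> b) - v (\<gamma> a)\<bar> \<le> L * integral {a..b} (\<lambda>t. g (\<gamma> t))" .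
  have hi: "((\<lambda>t. g (\<gamma> t)) has_integral integral {a..b} (\<lambda>t. g (\<gamma> t))) {a..b}"
    using cg by (intro integrable_integral integrable_continuous_interval)
  have "(\<integral>\<^sup>+t\<in>{a..b}. ennreal (g (\<gamma> t)) \<partial>lborel) = ennreal (integral {a..b} (\<lambda>t. g (\<gamma> t)))"
    by (rule nn_integral_has_integral_lebesgue'[OF _ hi]) (use g0 in auto)
  then show ?thesis
    using le L by (simp add: ennreal_mult'[symmetric] ennreal_leI)
qed

section \<open>Dilations about a point\<close>

lemma nn_integral_homothety:
  fixes h :: "'a::euclidean_space \<Rightarrow> ennreal"
  assumes h[measurable]: "h \<in> borel_measurable borel" and s: "s > 0"
  shows "(\<integral>\<^sup>+x. h (z + s *\<^sub>R (x - z)) \<partial>lborel) = ennreal (1 / s ^ DIM('a)) * (\<integral>\<^sup>+x. h x \<partial>lborel)"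
proof -
  have "(\<integral>\<^sup>+x. h x \<partial>lborel) = (\<integral>\<^sup>+x. h x \<partial>density (distr lborel borel (\<lambda>x. (z - s *\<^sub>R z) + s *\<^sub>R x)) (\<lambda>_. \<bar>s\<bar>^DIM('a)))"
    using lborel_affine[of s "z - s *\<^sub>R z"] s by simp
  also have "\<dots> = ennreal (s ^ DIM('a)) * (\<integral>\<^sup>+x. h (z + s *\<^sub>R (x - z)) \<partial>lborel)"
    using s by (simp add: nn_integral_density nn_integral_distr nn_integral_cmult algebra_simps)
  finally show ?thesis
    using s by (simp add: mult.assoc[symmetric] ennreal_mult[symmetric])
qed

lemma homothety_expand_le:
  fixes h :: "'a::euclidean_space \<Rightarrow> ennreal"
  assumes h[measurable]: "h \<in> borel_measurable borel" and s: "s > 0"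
    and V[measurable]: "V \<in> sets borel" 
    and star: "\<And>x. x \<in> W \<Longrightarrow> z + s *\<^sub>R (x - z) \<in> V"
  shows "(\<integral>\<^sup>+x\<in>W. h (z + s *\<^sub>R (x - z)) \<partial>lborel) \<le> ennreal (1 / s ^ DIM('a)) * (\<integral>\<^sup>+x\<in>V. h x \<partial>lborel)"
proof -
  have "(\<integral>\<^sup>+x\<in>W. h (z + s *\<^sub>R (x - z)) \<partial>lborel)
      \<le> (\<integral>\<^sup>+x. h (z + s *\<^sub>R (x - z)) * indicator V (z + s *\<^sub>R (x - z)) \<partial>lborel)"
    using star by (intro nn_integral_mono) (auto simp: indicator_def)
  also have "\<dots> = ennreal (1 / s ^ DIM('a)) * (\<integral>\<^sup>+x\<in>V. h x \<partial>lborel)"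
    by (rule nn_integral_homothety[OF _ s, of "\<lambda>x. h x * indicator V x"]) measurable
  finally show ?thesis .
qed


section \<open>Change of variables\<close>

text \<open>A one-sided change of variables by covering: the preimage of a cube of side w has
  diameter at most L d w, hence lies in a cube of side 2 L d w around any of its points. Covering E
  by dyadic cubes of nearly the same total volume then costs the factor (2 L d)^d.\<close>

lemma expanding_preimage_emeasure_le:
  fixes T :: "'a::euclidean_space \<Rightarrow> 'a"
  assumes T: "continuous_on S T" and S: "S \<in> sets borel" and bdd: "bounded (T ` S)"
    and E: "E \<in> sets borel" and L: "L > 0"
    and exp: "\<And>x y. x \<in> S \<Longrightarrow> y \<in> S \<Longrightarrow> dist x y \<le> L * dist (T x) (T y)"
  shows "emeasure lborel {x\<in>S. T x \<in> E} \<le> ennreal ((2 * L * DIM('a)) ^ DIM('a)) * emeasure lborel E"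
proof (cases "emeasure lborel E < \<infinity>")
  case False
  then have "emeasure lborel E = top" by (simp add: less_top[symmetric])
  moreover have "ennreal ((2 * L * DIM('a)) ^ DIM('a)) \<noteq> 0"
    using L DIM_positive[where 'a='a] by (simp add: ennreal_eq_0_iff not_le zero_less_power)
  ultimately have "ennreal ((2 * L * DIM('a)) ^ DIM('a)) * emeasure lborel E = top"
    by (metis ennreal_top_mult_left)
  then show ?thesis by (simp only: top_greatest)
next
  case True
  \<comment> \<open>The outer covering below works in a bounded box; taking a cube as that box makes
    all its dyadic pieces cubes.\<close>
  obtain c where c: "T ` S \<subseteq> cbox (-(c *\<^sub>R One)) (c *\<^sub>R One)" "c > 0"
  proof -
    obtain B where B: "\<And>x. x \<in> T ` S \<Longrightarrow> norm x \<le> B" using bdd unfolding bounded_iff by metis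
    have "T ` S \<subseteq> cbox (-((\<bar>B\<bar> + 1) *\<^sub>R One)) ((\<bar>B\<bar> + 1) *\<^sub>R One)"
    proof
      fix y assume "y \<in> T ` S"
      then have "norm y \<le> B" by (rule B)
      then have "\<bar>y \<bullet> i\<bar> \<le> \<bar>B\<bar> + 1" if "i \<in> Basis" for i using Basis_le_norm[OF that, of y] by linarith
      then show "y \<in> cbox (-((\<bar>B\<bar> + 1) *\<^sub>R One)) ((\<bar>B\<bar> + 1) *\<^sub>R One)"
        by (fastforce simp: mem_box abs_le_iff)
    qed
    then show ?thesis by (intro that[of "\<bar>B\<bar> + 1"]) auto
  qed
  define a b where "a = -(c *\<^sub>R One :: 'a)" and "b = (c *\<^sub>R One :: 'a)"
  define E' where "E' = E \<inter> cbox a b"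
  have E'm: "E' \<in> sets borel" using E by (simp add: E'_def)
  have E'l: "E' \<in> lmeasurable"
    by (rule bounded_set_imp_lmeasurable) (use E'm in \<open>auto simp: E'_def sets_completionI_sets intro: bounded_subset[OF bounded_cbox]\<close>)
  have pre: "{x\<in>S. T x \<in> E} = {x\<in>S. T x \<in> E'}" using c by (auto simp: E'_def a_def b_def)
  define K where "K = (2 * L * DIM('a)) ^ DIM('a)"
  have K: "K \<ge> 0" using L by (simp add: K_def)
  have main: "emeasure lborel {x\<in>S. T x \<in> E} \<le> ennreal K * ennreal (measure lebesgue E' + e)" if e: "e > 0" for e
  proof -
    have "E' \<subseteq> cbox a b" by (auto simp: E'_def)
    from measurable_outer_intervals_bounded[OF E'l this e] obtain \<D> where \<D>: "countable \<D>"
        "\<And>K. K \<in> \<D> \<Longrightarrow> K \<subseteq> cbox a b \<and> K \<noteq> {} \<and> (\<exists>c d. K = cbox c d)"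
        "pairwise (\<lambda>A B. interior A \<inter> interior B = {}) \<D>"
        "\<And>u v. cbox u v \<in> \<D> \<Longrightarrow> \<exists>n. \<forall>i \<in> Basis. v \<bullet> i - u \<bullet> i = (b \<bullet> i - a \<bullet> i)/2^n"
        "E' \<subseteq> \<Union>\<D>" "\<Union>\<D> \<in> lmeasurable" "measure lebesgue (\<Union>\<D>) \<le> measure lebesgue E' + e"
      by (metis (no_types, lifting))
    have piece: "\<exists>B\<in>sets borel. {x\<in>S. T x \<in> Q} \<subseteq> B \<and> emeasure lborel B \<le> ennreal K * emeasure lborel Q" if Q: "Q \<in> \<D>" for Q
    proof (cases "{x\<in>S. T x \<in> Q} = {}")
      case True then show ?thesis by (intro bexI[of _ "{}"]) auto
    next
      case False
      then obtain x0 where x0: "x0 \<in> S" "T x0 \<in> Q" by auto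
      obtain u v where uv: "Q = cbox u v" "cbox u v \<noteq> {}" using \<D>(2)[OF Q] by auto
      obtain n where n: "\<And>i. i \<in> Basis \<Longrightarrow> v \<bullet> i - u \<bullet> i = (2 * c)/2^n"
        using \<D>(4)[of u v] Q uv by (auto simp: a_def b_def inner_diff_left)
      define w where "w = 2 * c / 2 ^ n"
      have w: "w > 0" using c by (simp add: w_def)
      have mQ: "emeasure lborel Q = ennreal (w ^ DIM('a))"
      proof -
        have "u \<bullet> i \<le> v \<bullet> i" if "i \<in> Basis" for i using n[OF that] w by (simp add: w_def)
        then have "emeasure lborel Q = (\<Prod>i\<in>Basis. ennreal ((v - u) \<bullet> i))"
          by (simp add: uv emeasure_lborel_cbox_eq inner_diff_left prod_ennreal)
        also have "\<dots> = (\<Prod>i\<in>(Basis::'a set). ennreal w)"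
          by (rule prod.cong) (use n in \<open>auto simp: inner_diff_left w_def\<close>)
        finally show ?thesis using w by (simp add: ennreal_power)
      qed
      define \<rho> where "\<rho> = L * (DIM('a) * w)"
      have \<rho>: "\<rho> \<ge> 0" using L w by (simp add: \<rho>_def)
      define B where "B = cbox (x0 - \<rho> *\<^sub>R One) (x0 + \<rho> *\<^sub>R One)"
      have "{x\<in>S. T x \<in> Q} \<subseteq> B"
      proof
        fix x assume x: "x \<in> {x\<in>S. T x \<in> Q}"
        have "norm (T x - T x0) \<le> (\<Sum>i\<in>Basis. \<bar>(T x - T x0) \<bullet> i\<bar>)" by (rule norm_le_l1)
        also have "\<dots> \<le> (\<Sum>i\<in>(Basis::'a set). w)"
        proof (rule sum_mono)
          fix i :: 'a assume i: "i \<in> Basis"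
          have "u \<bullet> i \<le> T x \<bullet> i" "T x \<bullet> i \<le> v \<bullet> i" "u \<bullet> i \<le> T x0 \<bullet> i" "T x0 \<bullet> i \<le> v \<bullet> i"
            using x x0 uv i by (auto simp: mem_box)
          then show "\<bar>(T x - T x0) \<bullet> i\<bar> \<le> w" using n[OF i] by (simp add: w_def inner_diff_left)
        qed
        finally have "dist (T x) (T x0) \<le> DIM('a) * w" by (simp add: dist_norm)
        with exp[of x x0] x x0 L have "dist x x0 \<le> \<rho>"
          by (auto simp: \<rho>_def intro: order_trans mult_left_mono)
        then have "\<bar>(x - x0) \<bullet> i\<bar> \<le> \<rho>" if "i \<in> Basis" for i
          using Basis_le_norm[OF that, of "x - x0"] by (simp add: dist_norm)
        then show "x \<in> B" by (fastforce simp: B_def mem_box inner_diff_left inner_add_left abs_le_iff)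
      qed
      moreover have "emeasure lborel B = ennreal K * emeasure lborel Q"
      proof -
        have "emeasure lborel B = ennreal ((2 * \<rho>) ^ DIM('a))"
          using \<rho> by (simp add: B_def emeasure_lborel_cbox_eq inner_diff_left inner_add_left)
        also have "(2 * \<rho>) ^ DIM('a) = K * w ^ DIM('a)"
          by (simp add: \<rho>_def K_def power_mult_distrib[symmetric] mult_ac)
        finally show ?thesis using K w by (simp add: mQ ennreal_mult)
      qed
      ultimately show ?thesis by (intro bexI[of _ B]) (auto simp: B_def)
    qed
    then obtain B where B: "\<And>Q. Q \<in> \<D> \<Longrightarrow> B Q \<in> sets borel" "\<And>Q. Q \<in> \<D> \<Longrightarrow> {x\<in>S. T x \<in> Q} \<subseteq> B Q"
       "\<And>Q. Q \<in> \<D> \<Longrightarrow> emeasure lborel (B Q) \<le> ennreal K * emeasure lborel Q" by metis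
    have Qb: "Q \<in> sets borel" if "Q \<in> \<D>" for Q using \<D>(2)[OF that] by auto
    have "emeasure lborel {x\<in>S. T x \<in> E} \<le> emeasure lborel (\<Union>Q\<in>\<D>. B Q)"
    proof (rule emeasure_mono)
      show "{x \<in> S. T x \<in> E} \<subseteq> (\<Union>Q\<in>\<D>. B Q)" using B(2) \<D>(5) unfolding pre by blast
    qed (use B(1) \<D>(1) in auto)
    also have "\<dots> \<le> (\<integral>\<^sup>+Q. emeasure lborel (B Q) \<partial>count_space \<D>)"
    proof -
      have "emeasure lborel (\<Union>Q\<in>\<D>. B Q) = (\<integral>\<^sup>+x. indicator (\<Union>Q\<in>\<D>. B Q) x \<partial>lborel)"
        using B(1) \<D>(1) by (subst nn_integral_indicator) auto
      also have "\<dots> \<le> (\<integral>\<^sup>+x. (\<integral>\<^sup>+Q. indicator (B Q) x \<partial>count_space \<D>) \<partial>lborel)"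
      proof (rule nn_integral_mono)
        fix x
        show "indicator (\<Union>Q\<in>\<D>. B Q) x \<le> (\<integral>\<^sup>+Q. indicator (B Q) x \<partial>count_space \<D>)"
        proof (cases "x \<in> (\<Union>Q\<in>\<D>. B Q)")
          case True
          then obtain Q where "Q \<in> \<D>" "x \<in> B Q" by auto
          then have "1 \<le> (\<integral>\<^sup>+Q. indicator (B Q) x \<partial>count_space \<D>)"
            using nn_integral_ge_point[of Q \<D> "\<lambda>Q. indicator (B Q) x"] by simp
          then show ?thesis using True by simp
        qed simp
      qed
      also have "\<dots> = (\<integral>\<^sup>+Q. (\<integral>\<^sup>+x. indicator (B Q) x \<partial>lborel) \<partial>count_space \<D>)"
        by (rule nn_integral_count_space_nn_integral) (use B(1) \<D>(1) in auto)
      also have "\<dots> = (\<integral>\<^sup>+Q. emeasure lborel (B Q) \<partial>count_space \<D>)"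
        using B(1) by (intro nn_integral_cong) auto
      finally show ?thesis .
    qed
    also have "\<dots> \<le> (\<integral>\<^sup>+Q. ennreal K * emeasure lborel Q \<partial>count_space \<D>)"
      by (rule nn_integral_mono) (use B in auto)
    \<comment> \<open>The boxes overlap at most in their boundaries, which are null; passing to
      interiors turns the sum of volumes into the volume of a disjoint union.\<close>
    also have "\<dots> = ennreal K * (\<integral>\<^sup>+Q. emeasure lborel (interior Q) \<partial>count_space \<D>)"
    proof -
      have "emeasure lborel Q = emeasure lborel (interior Q)" if "Q \<in> \<D>" for Q
        using \<D>(2)[OF that] by (auto simp: interior_cbox emeasure_lborel_cbox_eq emeasure_lborel_box_eq)
      then show ?thesis by (simp add: nn_integral_cmult cong: nn_integral_cong_simp)
    qed
    also have "(\<integral>\<^sup>+Q. emeasure lborel (interior Q) \<partial>count_space \<D>) = emeasure lborel (\<Union>Q\<in>\<D>. interior Q)"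
      by (rule emeasure_UN_countable[symmetric])
         (use \<D>(1,3) in \<open>auto simp: disjoint_family_on_def pairwise_def\<close>)
    also have "\<dots> = emeasure lebesgue (\<Union>Q\<in>\<D>. interior Q)"
    proof -
      have "(\<Union>Q\<in>\<D>. interior Q) \<in> sets lborel" using \<D>(1) by auto
      then show ?thesis by simp
    qed
    also have "\<dots> \<le> emeasure lebesgue (\<Union>\<D>)"
      by (rule emeasure_mono) (use \<D>(6) interior_subset in \<open>auto simp: fmeasurable_def\<close>)
    also have "\<dots> = ennreal (measure lebesgue (\<Union>\<D>))"
      using \<D>(6) by (simp add: emeasure_eq_measure2)
    also have "\<dots> \<le> ennreal (measure lebesgue E' + e)" using \<D>(7) by (rule ennreal_leI)
    finally show ?thesis by (simp add: mult_left_mono)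
  qed
  have "emeasure lborel {x\<in>S. T x \<in> E} \<le> ennreal (K * measure lebesgue E')"
  proof (rule ennreal_le_epsilon)
    fix e :: real assume e: "e > 0"
    define e1 where "e1 = e / (K + 1)"
    have e1: "e1 > 0" "K * e1 \<le> e" using e K by (auto simp: e1_def field_simps)
    have "emeasure lborel {x\<in>S. T x \<in> E} \<le> ennreal K * ennreal (measure lebesgue E' + e1)" by (rule main[OF e1(1)])
    also have "\<dots> = ennreal (K * measure lebesgue E' + K * e1)"
      using K e1 by (simp add: ennreal_mult'[symmetric] distrib_left)
    also have "\<dots> \<le> ennreal (K * measure lebesgue E' + e)" using e1 by (intro ennreal_leI) simp
    also have "\<dots> = ennreal (K * measure lebesgue E') + ennreal e" using K e by simp
    finally show "emeasure lborel {x\<in>S. T x \<in> E} \<le> ennreal (K * measure lebesgue E') + ennreal e" .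
  qed
  also have "\<dots> = ennreal K * emeasure lborel E'"
  proof -
    have "emeasure lborel E' = emeasure lebesgue E'" using E'm by simp
    also have "\<dots> = ennreal (measure lebesgue E')" using E'l by (rule emeasure_eq_measure2)
    finally show ?thesis using K by (simp add: ennreal_mult)
  qed
  also have "\<dots> \<le> ennreal K * emeasure lborel E"
    by (intro mult_left_mono emeasure_mono) (use E in \<open>auto simp: E'_def\<close>)
  finally show ?thesis by (simp add: K_def)
qed

text \<open>Induction over nonnegative Borel functions, starting from the case of sets. Continuity
  of T is known on S alone, so for measurability T is extended by 0 off S.\<close>

lemma nn_integral_expanding_le:
  fixes T :: "'a::euclidean_space \<Rightarrow> 'a"
  assumes T: "continuous_on S T" and S: "S \<in> sets borel" and bdd: "bounded (T ` S)"
    and L: "L > 0"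
    and exp: "\<And>x y. x \<in> S \<Longrightarrow> y \<in> S \<Longrightarrow> dist x y \<le> L * dist (T x) (T y)"
    and h: "h \<in> borel_measurable borel" and V: "V \<in> sets borel" "T ` S \<subseteq> V"
  shows "(\<integral>\<^sup>+x\<in>S. h (T x) \<partial>lborel) \<le> ennreal ((2 * L * DIM('a)) ^ DIM('a)) * (\<integral>\<^sup>+x\<in>V. h x \<partial>lborel)"
proof -
  define C where "C = ennreal ((2 * L * DIM('a)) ^ DIM('a))"
  have Tm: "(\<lambda>x. if x \<in> S then T x else 0) \<in> borel_measurable borel"
    using borel_measurable_continuous_on_if[OF S T, of "\<lambda>_. 0"] S by (simp add: continuous_on_const)
  have meas: "(\<lambda>x. w (T x) * indicator S x) \<in> borel_measurable borel" if "w \<in> borel_measurable borel" for w :: "'a \<Rightarrow> ennreal"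
  proof -
    have "(\<lambda>x. w (if x \<in> S then T x else 0) * indicator S x) \<in> borel_measurable borel"
      using Tm that S by measurable
    also have "(\<lambda>x. w (if x \<in> S then T x else 0) * indicator S x) = (\<lambda>x. w (T x) * indicator S x)"
      by (auto simp: indicator_def)
    finally show ?thesis .
  qed
  have main: "(\<integral>\<^sup>+x\<in>S. k (T x) \<partial>lborel) \<le> C * (\<integral>\<^sup>+x. k x \<partial>lborel)"
    if "k \<in> borel_measurable borel" for k
    using that
  proof (induction rule: borel_measurable_induct)
    case (cong f g) then show ?case by simp
  next
    case (set A)
    have "(\<integral>\<^sup>+x\<in>S. indicator A (T x) \<partial>lborel) = (\<integral>\<^sup>+x. indicator {x\<in>S. T x \<in> A} x \<partial>lborel)"
      by (intro nn_integral_cong) (auto simp: indicator_def)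
    also have "\<dots> = emeasure lborel {x\<in>S. T x \<in> A}"
    proof (rule nn_integral_indicator)
      have "{x\<in>S. T x \<in> A} = S \<inter> ((\<lambda>x. if x \<in> S then T x else 0) -` A \<inter> space borel)" by auto
      also have "\<dots> \<in> sets borel" using measurable_sets[OF Tm set] S by (intro sets.Int) auto
      finally show "{x\<in>S. T x \<in> A} \<in> sets lborel" by simp
    qed
    also have "\<dots> \<le> C * emeasure lborel A"
      unfolding C_def by (rule expanding_preimage_emeasure_le[OF T S bdd set L exp])
    finally show ?case using set by simp
  next
    case (mult u c)
    have "(\<integral>\<^sup>+x\<in>S. (c * u (T x)) \<partial>lborel) = c * (\<integral>\<^sup>+x\<in>S. u (T x) \<partial>lborel)"
      using meas[OF mult(2)] by (simp add: nn_integral_cmult[symmetric] mult.assoc)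
    also have "\<dots> \<le> c * (C * (\<integral>\<^sup>+x. u x \<partial>lborel))" by (rule mult_left_mono[OF mult(4)]) simp
    also have "\<dots> = C * (\<integral>\<^sup>+x. c * u x \<partial>lborel)"
      using mult(2) by (subst nn_integral_cmult) (simp_all add: mult_ac)
    finally show ?case .
  next
    case (add u v)
    have "(\<integral>\<^sup>+x\<in>S. (v (T x) + u (T x)) \<partial>lborel) = (\<integral>\<^sup>+x\<in>S. v (T x) \<partial>lborel) + (\<integral>\<^sup>+x\<in>S. u (T x) \<partial>lborel)"
      using meas[OF add(1)] meas[OF add(3)] by (simp add: distrib_right nn_integral_add)
    also have "\<dots> \<le> C * (\<integral>\<^sup>+x. v x \<partial>lborel) + C * (\<integral>\<^sup>+x. u x \<partial>lborel)"
      using add by (intro add_mono)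
    also have "\<dots> = C * (\<integral>\<^sup>+x. v x + u x \<partial>lborel)"
      using add by (simp add: nn_integral_add distrib_left)
    finally show ?case .
  next
    case (seq U)
    have "(\<integral>\<^sup>+x\<in>S. (Sup (range U)) (T x) \<partial>lborel) = (\<integral>\<^sup>+x. (SUP i. U i (T x) * indicator S x) \<partial>lborel)"
      by (intro nn_integral_cong) (auto simp: SUP_mult_right_ennreal[symmetric] SUP_apply image_comp)
    also have "\<dots> = (SUP i. \<integral>\<^sup>+x\<in>S. U i (T x) \<partial>lborel)"
      by (rule nn_integral_monotone_convergence_SUP)
         (use seq meas in \<open>auto simp: incseq_def le_fun_def intro: mult_right_mono\<close>)
    also have "\<dots> \<le> C * (\<integral>\<^sup>+x. (Sup (range U)) x \<partial>lborel)"
    proof (rule SUP_least)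
      fix i
      have "(\<integral>\<^sup>+x\<in>S. U i (T x) \<partial>lborel) \<le> C * (\<integral>\<^sup>+x. U i x \<partial>lborel)" by (rule seq)
      also have "\<dots> \<le> C * (\<integral>\<^sup>+x. (Sup (range U)) x \<partial>lborel)"
        by (intro mult_left_mono nn_integral_mono) (auto intro: Sup_upper simp: le_funD SUP_apply image_comp intro!: SUP_upper2[of i])
      finally show "(\<integral>\<^sup>+x\<in>S. U i (T x) \<partial>lborel) \<le> C * (\<integral>\<^sup>+x. (Sup (range U)) x \<partial>lborel)" .
    qed
    finally show ?case .
  qed
  have "(\<integral>\<^sup>+x\<in>S. h (T x) \<partial>lborel) = (\<integral>\<^sup>+x\<in>S. (h (T x) * indicator V (T x)) \<partial>lborel)"
    using V(2) by (intro nn_integral_cong) (auto simp: indicator_def)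
  also have "\<dots> \<le> C * (\<integral>\<^sup>+x\<in>V. h x \<partial>lborel)"
    using main[of "\<lambda>x. h x * indicator V x"] h V(1) by simp
  finally show ?thesis by (simp add: C_def)
qed


section \<open>Averaging over segments\<close>

abbreviation weighted_int :: "'a::euclidean_space set \<Rightarrow> real \<Rightarrow> ('a \<Rightarrow> real) \<Rightarrow> 'a set \<Rightarrow> ennreal" where
  "weighted_int D q v W \<equiv> (\<integral>\<^sup>+x\<in>W. ennreal (v x * infdist x D powr q) \<partial>lborel)"

lemmas borel_indicator_intros = borel_measurable_times_ennreal borel_measurable_indicator

section \<open>Potentials of finite point sets\<close>

lemma dyadic_bracket:
  fixes t \<rho> :: real
  assumes "\<rho> > 0" "\<rho> \<le> t"
  obtains k :: nat where "2 ^ k * \<rho> \<le> t" "t < 2 ^ Suc k * \<rho>"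
proof -
  define n where "n = (LEAST n. t < 2 ^ n * \<rho>)"
  have ex: "\<exists>n. t < 2 ^ n * \<rho>"
    using real_arch_pow[of 2 "t / \<rho>"] assms by (auto simp: field_simps)
  have n: "t < 2 ^ n * \<rho>" unfolding n_def using ex by (rule LeastI_ex)
  have "n \<noteq> 0" using n assms by (intro notI) simp
  then obtain k where k: "n = Suc k" by (cases n) auto
  have "\<not> t < 2 ^ k * \<rho>" using not_less_Least[of k "\<lambda>n. t < 2 ^ n * \<rho>"] k by (simp add: n_def)
  with n k show ?thesis by (intro that[of k]) auto
qed

text \<open>Sort Z into dyadic shells around y: the k-th shell holds at most C (2^(k+1) \<rho> /
  \<eta>)^m points, each contributing at most (2^k \<rho>) powr -(m + p - 1), so the shells add up
  to a geometric series of ratio 2 powr (1 - p). With m = d - 1 this is the discrete form of the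
  surface potential.\<close>

lemma sum_dist_powr_le:
  fixes Z :: "'a::metric_space set"
  assumes Z: "finite Z" and \<rho>: "\<rho> > 0" and \<eta>: "\<eta> > 0" and C: "C \<ge> 0" and p: "p > 1"
    and far: "\<And>z. z \<in> Z \<Longrightarrow> \<rho> \<le> dist y z"
    and count: "\<And>r. r \<ge> \<rho> \<Longrightarrow> real (card {z\<in>Z. dist y z \<le> r}) \<le> C * (r / \<eta>) ^ m"
  shows "(\<Sum>z\<in>Z. dist y z powr (- (real m + p - 1)))
    \<le> C * 2 ^ m / (1 - 2 powr (1 - p)) * (1 / \<eta> ^ m) * \<rho> powr (1 - p)"
proof -
  define q where "q = real m + p - 1"
  have q: "q > 0" using p by (simp add: q_def)
  obtain K where K: "\<And>z. z \<in> Z \<Longrightarrow> 2 ^ K z * \<rho> \<le> dist y z \<and> dist y z < 2 ^ Suc (K z) * \<rho>"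
  proof -
    have "\<exists>k::nat. 2 ^ k * \<rho> \<le> dist y z \<and> dist y z < 2 ^ Suc k * \<rho>" if "z \<in> Z" for z
      using dyadic_bracket[OF \<rho> far[OF that]] by blast
    then show ?thesis using that by metis
  qed
  obtain N where N: "\<And>z. z \<in> Z \<Longrightarrow> K z < N"
    using finite_nat_set_iff_bounded[of "K ` Z"] Z by auto
  define x :: real where "x = 2 powr (1 - p)"
  have x: "0 < x" "x < 1" using p by (auto simp: x_def powr_less_one)
  have "(\<Sum>z\<in>Z. dist y z powr (- q)) \<le>
     (\<Sum>z\<in>Z. \<Sum>k<N. (if dist y z \<le> 2 ^ Suc k * \<rho> then (2 ^ k * \<rho>) powr (- q) else 0))"
  proof (rule sum_mono)
    fix z assume z: "z \<in> Z"
    have "dist y z powr (- q) \<le> (2 ^ K z * \<rho>) powr (- q)"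
      using K[OF z] q \<rho> by (intro powr_mono2') auto
    also have "\<dots> = (if dist y z \<le> 2 ^ Suc (K z) * \<rho> then (2 ^ K z * \<rho>) powr (- q) else 0)"
      using K[OF z] by simp
    also have "\<dots> \<le> (\<Sum>k<N. (if dist y z \<le> 2 ^ Suc k * \<rho> then (2 ^ k * \<rho>) powr (- q) else 0))"
      using N[OF z] by (intro member_le_sum) auto
    finally show "dist y z powr (- q) \<le> (\<Sum>k<N. (if dist y z \<le> 2 ^ Suc k * \<rho> then (2 ^ k * \<rho>) powr (- q) else 0))" .
  qed
  also have "\<dots> = (\<Sum>k<N. real (card {z\<in>Z. dist y z \<le> 2 ^ Suc k * \<rho>}) * (2 ^ k * \<rho>) powr (- q))"
    using Z by (subst sum.swap) (simp add: sum.If_cases Int_def)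
  also have "\<dots> \<le> (\<Sum>k<N. C * (2 ^ m / \<eta> ^ m) * \<rho> powr (1 - p) * x ^ k)"
  proof (rule sum_mono)
    fix k
    have "real (card {z\<in>Z. dist y z \<le> 2 ^ Suc k * \<rho>}) \<le> C * (2 ^ Suc k * \<rho> / \<eta>) ^ m"
    proof (rule count)
      have "1 * \<rho> \<le> 2 ^ Suc k * \<rho>" using \<rho> by (intro mult_right_mono one_le_power) auto
      then show "\<rho> \<le> 2 ^ Suc k * \<rho>" by simp
    qed
    then have "real (card {z\<in>Z. dist y z \<le> 2 ^ Suc k * \<rho>}) * (2 ^ k * \<rho>) powr (- q)
        \<le> C * (2 ^ Suc k * \<rho> / \<eta>) ^ m * (2 ^ k * \<rho>) powr (- q)"
      by (rule mult_right_mono) simp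
    also have "(2 ^ Suc k * \<rho> / \<eta>) ^ m = 2 ^ m / \<eta> ^ m * (2 ^ k * \<rho>) powr m"
      using \<rho> by (simp add: powr_realpow power_mult_distrib power_divide mult_ac)
    also have "C * (2 ^ m / \<eta> ^ m * (2 ^ k * \<rho>) powr m) * (2 ^ k * \<rho>) powr (- q)
       = C * (2 ^ m / \<eta> ^ m) * (2 ^ k * \<rho>) powr (m - q)"
      using \<rho> by (simp add: powr_diff powr_minus divide_inverse mult_ac)
    also have "(2 ^ k * \<rho>) powr (m - q) = x ^ k * \<rho> powr (1 - p)"
      using \<rho> by (simp add: q_def powr_mult x_def powr_powr powr_realpow[symmetric] mult.commute)
    finally show "real (card {z\<in>Z. dist y z \<le> 2 ^ Suc k * \<rho>}) * (2 ^ k * \<rho>) powr (- q)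
        \<le> C * (2 ^ m / \<eta> ^ m) * \<rho> powr (1 - p) * x ^ k" by (simp add: mult_ac)
  qed
  also have "\<dots> = C * (2 ^ m / \<eta> ^ m) * \<rho> powr (1 - p) * (\<Sum>k<N. x ^ k)"
    by (simp add: sum_distrib_left)
  also have "\<dots> \<le> C * (2 ^ m / \<eta> ^ m) * \<rho> powr (1 - p) * (1 / (1 - x))"
  proof (rule mult_left_mono)
    have "(\<Sum>k<N. x ^ k) = (1 - x ^ N) / (1 - x)" using x by (simp add: sum_gp_strict)
    also have "\<dots> \<le> 1 / (1 - x)" using x by (intro divide_right_mono) auto
    finally show "(\<Sum>k<N. x ^ k) \<le> 1 / (1 - x)" .
  qed (use C \<eta> in auto)
  finally show ?thesis by (simp add: q_def x_def mult_ac divide_inverse)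
qed

text \<open>The factors record the proof of \<open>hardy_core\<close>: averaging over at least c
  (\<delta> / \<eta>)^m points within distance A \<delta> gives L A powr (m + p) / c, the integral
  of s powr (p - 2) over the unit interval gives 1 / (p - 1), and the potential gives the last
  factor. The net scale \<eta> has cancelled.\<close>

definition hardy_const :: "nat \<Rightarrow> real \<Rightarrow> real \<Rightarrow> real \<Rightarrow> real \<Rightarrow> real \<Rightarrow> real" where
  "hardy_const m p c C A L =
     L * A powr (real m + p) / c * (1 / (p - 1)) * (C * 2 ^ m / (1 - 2 powr (1 - p)))"

lemma hardy_const_nonneg:
  assumes "p > 1" "c > 0" "C \<ge> 0" "L \<ge> 0"
  shows "hardy_const m p c C A L \<ge> 0"
proof -
  have "2 powr (1 - p) \<le> (1::real)" using assms powr_less_one[of 2 "1 - p"] by simp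
  then show ?thesis using assms by (simp add: hardy_const_def)
qed

lemma nn_integral_powr_unit:
  assumes "p > (1::real)"
  shows "(\<integral>\<^sup>+s\<in>{0..1}. ennreal (s powr (p - 2)) \<partial>lborel) = ennreal (1 / (p - 1))"
proof -
  have "((\<lambda>s. s powr (p - 2)) has_integral (1 powr (p - 2 + 1) / (p - 2 + 1))) {0..1::real}"
    by (rule has_integral_powr_from_0) (use assms in auto)
  from nn_integral_has_integral_lebesgue'[OF _ this] show ?thesis by simp
qed

text \<open>
  The finite set \<open>Z\<close> plays the role of the surface measure on \<open>D\<close> at scale \<open>\<eta>\<close>: the value at \<open>x\<close> is
  averaged over the segments from \<open>x\<close> to those points of \<open>Z\<close> whose distance is comparable to that
  of \<open>D\<close>, and Tonelli's theorem turns this into the potential \<open>\<Sum>z\<in>Z. |y - z| powr - (d + p - 2)\<close>.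
\<close>

lemma hardy_core:
  fixes D V W Z :: "'a::euclidean_space set" and G :: "'a \<Rightarrow> ennreal" and v :: "'a \<Rightarrow> real"
  defines "m \<equiv> DIM('a) - 1"
  assumes p: "p > 1" and c: "c > 0" and C: "C \<ge> 0" and A: "A > 0" and L: "L \<ge> 0" and \<eta>: "\<eta> > 0"
    and V[measurable]: "V \<in> sets borel" and W[measurable]: "W \<in> sets borel" and WV: "W \<subseteq> V"
    and G[measurable]: "G \<in> borel_measurable borel"
    and Z: "finite Z" "Z \<subseteq> D"
    and v0: "\<And>x. x \<in> W \<Longrightarrow> 0 \<le> v x"
    and v_near: "\<And>x. x \<in> W \<Longrightarrow> infdist x D < \<eta> \<Longrightarrow> v x = 0"
    and G_near: "\<And>y. y \<in> V \<Longrightarrow> infdist y D < \<eta> \<Longrightarrow> G y = 0"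
    and lower: "\<And>x. x \<in> W \<Longrightarrow> \<eta> \<le> infdist x D \<Longrightarrow>
        c * (infdist x D / \<eta>) ^ m \<le> real (card {z\<in>Z. dist x z \<le> A * infdist x D})"
    and upper: "\<And>y r. y \<in> V \<Longrightarrow> \<eta> \<le> infdist y D \<Longrightarrow> infdist y D \<le> r \<Longrightarrow>
        real (card {z\<in>Z. dist y z \<le> r}) \<le> C * (r / \<eta>) ^ m"
    and star: "\<And>x z s. x \<in> W \<Longrightarrow> z \<in> Z \<Longrightarrow> 0 < s \<Longrightarrow> s \<le> 1 \<Longrightarrow> z + s *\<^sub>R (x - z) \<in> V"
    and segment: "\<And>x z. x \<in> W \<Longrightarrow> z \<in> Z \<Longrightarrow>
        ennreal (v x) \<le> ennreal (L * dist x z) * (\<integral>\<^sup>+s\<in>{0..1}. G (z + s *\<^sub>R (x - z)) \<partial>lborel)"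
  shows "weighted_int D (- p) v W
    \<le> ennreal (hardy_const m p c C A L) * (\<integral>\<^sup>+y\<in>V. (G y * ennreal (infdist y D powr (1 - p))) \<partial>lborel)"
proof -
  define q where "q = real m + p - 1"
  have q: "q > 0" using p by (simp add: q_def)
  have dm: "real DIM('a) = real m + 1" using DIM_positive[where 'a='a] by (simp add: m_def of_nat_diff)
  \<comment> \<open>With \<delta> the distance of x to D, averaging costs the inverse count, at most
    \<eta>^m / (c \<delta>^m), and the length of a segment is at most A \<delta>. This leaves L A
    \<eta>^m / c times \<delta> powr -q, and \<delta> >= dist x z / A turns the power into dist x z
    powr -q at the price A powr q.\<close>
  define B where "B = L * A powr (q + 1) / c * \<eta> ^ m"
  have B: "B \<ge> 0" using L c \<eta> by (simp add: B_def)
  define I where "I x z = (\<integral>\<^sup>+s\<in>{0..1}. G (z + s *\<^sub>R (x - z)) \<partial>lborel)" for x z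
  have I_meas: "(\<lambda>x. I x z) \<in> borel_measurable borel" for z
    unfolding I_def by measurable
  have pointwise: "ennreal (v x * infdist x D powr (- p)) \<le> (\<Sum>z\<in>Z. ennreal (B * dist x z powr (- q)) * I x z)"
    if x: "x \<in> W" for x
  proof (cases "infdist x D < \<eta>")
    case True
    then show ?thesis using v_near[OF x] by simp
  next
    case False
    define \<delta> where "\<delta> = infdist x D"
    define N where "N = {z\<in>Z. dist x z \<le> A * \<delta>}"
    have \<delta>: "\<eta> \<le> \<delta>" "\<delta> > 0" using False \<eta> by (auto simp: \<delta>_def)
    have cN: "c * (\<delta> / \<eta>) ^ m \<le> real (card N)"
      using lower[OF x] \<delta> by (simp add: \<delta>_def N_def)
    have pos: "c * (\<delta> / \<eta>) ^ m > 0" using c \<delta> \<eta> by simp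
    have N: "finite N" "N \<subseteq> Z" using Z by (auto simp: N_def)
    have N0: "real (card N) > 0" using cN pos by linarith
    have "ennreal (v x * \<delta> powr (- p)) = (\<Sum>z\<in>N. ennreal (v x * \<delta> powr (- p) / card N))"
      using N0 v0[OF x] by (simp add: ennreal_of_nat_eq_real_of_nat ennreal_mult'[symmetric])
    also have "\<dots> \<le> (\<Sum>z\<in>N. ennreal (B * dist x z powr (- q)) * I x z)"
    proof (rule sum_mono)
      fix z assume z: "z \<in> N"
      have zD: "z \<in> D" "z \<in> Z" "dist x z \<le> A * \<delta>" using z Z by (auto simp: N_def)
      have dz: "dist x z > 0" using infdist_le[OF zD(1), of x] \<delta> unfolding \<delta>_def by linarith
      have "\<delta> powr (- p) / card N * (L * dist x z) \<le> B * dist x z powr (- q)"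
      proof -
        have "\<delta> powr (- p) / card N * (L * dist x z) \<le> \<delta> powr (- p) / (c * (\<delta> / \<eta>) ^ m) * (L * (A * \<delta>))"
          using cN pos L zD N0 c \<delta> \<eta> by (intro mult_mono divide_left_mono mult_left_mono mult_pos_pos) auto
        also have "\<dots> = L * A / c * \<eta> ^ m * (\<delta> powr (- p) * (\<delta> / \<delta> powr m))"
          using \<delta> by (simp add: powr_realpow power_divide)
        also have "\<delta> powr (- p) * (\<delta> / \<delta> powr m) = \<delta> powr (- q)"
        proof -
          have "\<delta> powr (- q) = \<delta> powr (- p + 1 - m)" by (simp add: q_def algebra_simps)
          also have "\<dots> = \<delta> powr (- p) * \<delta> powr 1 / \<delta> powr m" by (simp only: powr_diff powr_add)
          finally show ?thesis using \<delta> by simp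
        qed
        also have "L * A / c * \<eta> ^ m * \<delta> powr (- q) \<le> L * A / c * \<eta> ^ m * (dist x z / A) powr (- q)"
          using dz A zD q L c \<eta> by (intro mult_left_mono powr_mono2') (auto simp: field_simps)
        also have "(dist x z / A) powr (- q) = dist x z powr (- q) * A powr q"
          using dz A by (simp add: powr_divide powr_minus field_simps)
        finally show ?thesis
          using A by (simp add: B_def powr_add mult_ac)
      qed
      then have coeff: "ennreal (\<delta> powr (- p) / card N * (L * dist x z)) \<le> ennreal (B * dist x z powr (- q))"
        by (rule ennreal_leI)
      have "ennreal (v x * \<delta> powr (- p) / card N) = ennreal (\<delta> powr (- p) / card N) * ennreal (v x)"
        using v0[OF x] by (simp add: ennreal_mult[symmetric])
      also have "\<dots> \<le> ennreal (\<delta> powr (- p) / card N) * (ennreal (L * dist x z) * I x z)"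
        using segment[OF x zD(2)] by (intro mult_left_mono) (auto simp: I_def)
      also have "\<dots> = ennreal (\<delta> powr (- p) / card N * (L * dist x z)) * I x z"
        by (subst ennreal_mult[of "\<delta> powr (- p) / card N" "L * dist x z"]) (use L in \<open>simp_all add: mult.assoc\<close>)
      also have "\<dots> \<le> ennreal (B * dist x z powr (- q)) * I x z"
        by (rule mult_right_mono[OF coeff]) simp
      finally show "ennreal (v x * \<delta> powr (- p) / card N) \<le> ennreal (B * dist x z powr (- q)) * I x z" .
    qed
    also have "\<dots> \<le> (\<Sum>z\<in>Z. ennreal (B * dist x z powr (- q)) * I x z)"
      using Z N by (intro sum_mono2) auto
    finally show ?thesis by (simp add: \<delta>_def)
  qed
  have [measurable]: "(\<lambda>y. infdist y D) \<in> borel_measurable borel"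
    by (intro borel_measurable_continuous_onI continuous_intros)
  define h where "h z y = ennreal (dist y z powr (- q)) * G y" for z y
  have h_meas[measurable]: "h z \<in> borel_measurable borel" for z unfolding h_def by measurable
  let ?F = "\<lambda>z x s. ennreal (B * dist x z powr (- q)) * G (z + s *\<^sub>R (x - z)) * indicator {0..1} s * indicator W x"
  have per_z: "(\<integral>\<^sup>+x\<in>W. (ennreal (B * dist x z powr (- q)) * I x z) \<partial>lborel)
       \<le> ennreal (B / (p - 1)) * (\<integral>\<^sup>+y\<in>V. h z y \<partial>lborel)" if z: "z \<in> Z" for z
  proof -
    have "(\<integral>\<^sup>+x\<in>W. (ennreal (B * dist x z powr (- q)) * I x z) \<partial>lborel)
      = (\<integral>\<^sup>+x. (\<integral>\<^sup>+s. ?F z x s \<partial>lborel) \<partial>lborel)"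
    proof (rule nn_integral_cong)
      fix x
      have "(\<integral>\<^sup>+s. ?F z x s \<partial>lborel)
        = (\<integral>\<^sup>+s. (ennreal (B * dist x z powr (- q)) * indicator W x) * (G (z + s *\<^sub>R (x - z)) * indicator {0..1} s) \<partial>lborel)"
        by (simp add: mult_ac)
      also have "\<dots> = (ennreal (B * dist x z powr (- q)) * indicator W x) * I x z"
        unfolding I_def by (rule nn_integral_cmult) measurable
      finally show "ennreal (B * dist x z powr (- q)) * I x z * indicator W x =
        (\<integral>\<^sup>+s. ?F z x s \<partial>lborel)"
        by (simp add: mult_ac)
    qed
    also have "\<dots> = (\<integral>\<^sup>+s. (\<integral>\<^sup>+x. ?F z x s \<partial>lborel) \<partial>lborel)"
      by (rule lborel_pair.Fubini') measurable
    also have "\<dots> \<le> (\<integral>\<^sup>+s. (ennreal B * (\<integral>\<^sup>+y\<in>V. h z y \<partial>lborel)) * (ennreal (s powr (p - 2)) * indicator {0..1} s) \<partial>lborel)"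
    proof (rule nn_integral_mono_AE)
      \<comment> \<open>The dilation with s = 0 collapses everything to z; a single value of s is
        negligible.\<close>
      have "AE s in lborel. s \<noteq> (0::real)" by (rule AE_lborel_singleton)
      then show "AE s in lborel. (\<integral>\<^sup>+x. ?F z x s \<partial>lborel)
        \<le> (ennreal B * (\<integral>\<^sup>+y\<in>V. h z y \<partial>lborel)) * (ennreal (s powr (p - 2)) * indicator {0..1} s)"
      proof eventually_elim
        case (elim s)
        show ?case
        proof (cases "s \<in> {0..1}")
          case True
          then have s: "0 < s" "s \<le> 1" using elim by auto
          \<comment> \<open>With y = z + s (x - z) the kernel releases the factor s powr q, and the
            dilation contributes s^-d. Since q - d = p - 2, what remains is integrable over the unit
            interval.\<close>
          have eq: "ennreal (B * dist x z powr (- q)) * G (z + s *\<^sub>R (x - z)) = ennreal (B * s powr q) * h z (z + s *\<^sub>R (x - z))" for x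
          proof -
            have "dist (z + s *\<^sub>R (x - z)) z = s * dist x z" using s by (simp add: dist_norm)
            then have "s powr q * dist (z + s *\<^sub>R (x - z)) z powr (- q) = dist x z powr (- q)"
              using s by (simp add: powr_mult powr_minus)
            then have "B * dist x z powr (- q) = (B * s powr q) * dist (z + s *\<^sub>R (x - z)) z powr (- q)"
              by (simp add: mult.assoc)
            then have "ennreal (B * dist x z powr (- q)) = ennreal (B * s powr q) * ennreal (dist (z + s *\<^sub>R (x - z)) z powr (- q))"
              by (simp only: ennreal_mult'' powr_ge_zero)
            then show ?thesis by (simp add: h_def mult.assoc)
          qed
          have "(\<integral>\<^sup>+x. ?F z x s \<partial>lborel)
             = ennreal (B * s powr q) * (\<integral>\<^sup>+x\<in>W. h z (z + s *\<^sub>R (x - z)) \<partial>lborel)"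
            using True by (simp add: eq nn_integral_cmult mult.assoc)
          also have "\<dots> \<le> ennreal (B * s powr q) * (ennreal (1 / s ^ DIM('a)) * (\<integral>\<^sup>+y\<in>V. h z y \<partial>lborel))"
            by (intro mult_left_mono homothety_expand_le h_meas V s star z) auto
          also have "\<dots> = ennreal (B * (s powr q / s ^ DIM('a))) * (\<integral>\<^sup>+y\<in>V. h z y \<partial>lborel)"
            using s B by (simp add: ennreal_mult''[symmetric] mult.assoc[symmetric])
          also have "s powr q / s ^ DIM('a) = s powr (p - 2)"
          proof -
            have "p - 2 = q - real DIM('a)" by (simp add: q_def dm)
            then show ?thesis using s by (simp add: powr_diff powr_realpow)
          qed
          finally show ?thesis using True B by (simp add: ennreal_mult mult_ac)
        qed simp
      qed
    qed
    also have "\<dots> = (ennreal B * (\<integral>\<^sup>+y\<in>V. h z y \<partial>lborel)) * (\<integral>\<^sup>+s\<in>{0..1}. ennreal (s powr (p - 2)) \<partial>lborel)"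
      by (rule nn_integral_cmult) measurable
    also have "\<dots> = ennreal (B / (p - 1)) * (\<integral>\<^sup>+y\<in>V. h z y \<partial>lborel)"
      by (subst nn_integral_powr_unit[OF p]) (use B p in \<open>simp add: mult_ac divide_inverse ennreal_mult\<close>)
    finally show ?thesis .
  qed
  define S where "S = C * 2 ^ m / (1 - 2 powr (1 - p))"
  have S0: "S \<ge> 0"
    using p C powr_less_one[of 2 "1 - p"] by (simp add: S_def)
  \<comment> \<open>The upper count is available only at distances of at least \<eta> from D; closer
    to D the density G vanishes.\<close>
  have potential: "(\<Sum>z\<in>Z. h z y) \<le> ennreal (S / \<eta> ^ m) * (G y * ennreal (infdist y D powr (1 - p)))" if y: "y \<in> V" for y
  proof (cases "infdist y D < \<eta>")
    case True
    then show ?thesis using G_near[OF y] by (simp add: h_def)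
  next
    case False
    have "(\<Sum>z\<in>Z. dist y z powr (- q)) \<le> S * (1 / \<eta> ^ m) * infdist y D powr (1 - p)"
      unfolding q_def S_def
      by (rule sum_dist_powr_le) (use Z False \<eta> C p upper[OF y] in \<open>auto intro: infdist_le\<close>)
    then have "ennreal (\<Sum>z\<in>Z. dist y z powr (- q)) \<le> ennreal (S / \<eta> ^ m * infdist y D powr (1 - p))"
      by (intro ennreal_leI) simp
    then have "ennreal (\<Sum>z\<in>Z. dist y z powr (- q)) * G y \<le> ennreal (S / \<eta> ^ m * infdist y D powr (1 - p)) * G y"
      by (rule mult_right_mono) simp
    moreover have "(\<Sum>z\<in>Z. h z y) = ennreal (\<Sum>z\<in>Z. dist y z powr (- q)) * G y"
      by (simp add: h_def sum_distrib_right[symmetric] sum_ennreal)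
    moreover have "ennreal (S / \<eta> ^ m * infdist y D powr (1 - p)) = ennreal (S / \<eta> ^ m) * ennreal (infdist y D powr (1 - p))"
      by (rule ennreal_mult) (use S0 \<eta> in auto)
    ultimately show ?thesis by (simp only: mult_ac)
  qed
  have "weighted_int D (- p) v W
      \<le> (\<integral>\<^sup>+x. (\<Sum>z\<in>Z. ennreal (B * dist x z powr (- q)) * I x z * indicator W x) \<partial>lborel)"
    using pointwise by (intro nn_integral_mono) (auto simp: indicator_def)
  also have "\<dots> = (\<Sum>z\<in>Z. \<integral>\<^sup>+x\<in>W. (ennreal (B * dist x z powr (- q)) * I x z) \<partial>lborel)"
    by (rule nn_integral_sum) (use I_meas in measurable)
  also have "\<dots> \<le> (\<Sum>z\<in>Z. ennreal (B / (p - 1)) * (\<integral>\<^sup>+y\<in>V. h z y \<partial>lborel))"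
    by (rule sum_mono) (rule per_z)
  also have "\<dots> = ennreal (B / (p - 1)) * (\<integral>\<^sup>+y. (\<Sum>z\<in>Z. h z y * indicator V y) \<partial>lborel)"
    by (subst nn_integral_sum) (auto simp: sum_distrib_left)
  also have "\<dots> \<le> ennreal (B / (p - 1)) * (\<integral>\<^sup>+y. ennreal (S / \<eta> ^ m) * (G y * ennreal (infdist y D powr (1 - p)) * indicator V y) \<partial>lborel)"
    using potential by (intro mult_left_mono nn_integral_mono) (auto simp: indicator_def)
  also have "\<dots> = ennreal (B / (p - 1)) * (ennreal (S / \<eta> ^ m) * (\<integral>\<^sup>+y\<in>V. (G y * ennreal (infdist y D powr (1 - p))) \<partial>lborel))"
    by (subst nn_integral_cmult) auto
  also have "\<dots> = ennreal (B / (p - 1) * (S / \<eta> ^ m)) * (\<integral>\<^sup>+y\<in>V. (G y * ennreal (infdist y D powr (1 - p))) \<partial>lborel)"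
    by (subst ennreal_mult[of "B / (p - 1)" "S / \<eta> ^ m"]) (use B p S0 \<eta> in \<open>simp_all add: mult.assoc\<close>)
  also have "B / (p - 1) * (S / \<eta> ^ m) = hardy_const m p c C A L"
  proof -
    define X where "X = L * A powr (real m + p) / c"
    have "B = X * \<eta> ^ m" by (simp add: B_def X_def q_def)
    moreover have "hardy_const m p c C A L = X * (1 / (p - 1)) * S"
      by (simp only: hardy_const_def X_def S_def)
    moreover have "X * k / a * (b / k) = X * (1 / a) * b" if "k \<noteq> 0" for k a b :: real
      using that by simp
    moreover have "\<eta> ^ m \<noteq> 0" using \<eta> by simp
    ultimately show ?thesis by (simp only:)
  qed
  finally show ?thesis .
qed


section \<open>Hausdorff measure and regular nets\<close>

lemma le_INF_add_INF_ennreal: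
  fixes f :: "'i \<Rightarrow> ennreal" and g :: "'j \<Rightarrow> ennreal"
  assumes "\<And>i j. i \<in> I \<Longrightarrow> j \<in> J \<Longrightarrow> x \<le> f i + g j"
  shows "x \<le> (INF i\<in>I. f i) + (INF j\<in>J. g j)"
proof (cases "(INF i\<in>I. f i) = \<infinity> \<or> (INF j\<in>J. g j) = \<infinity>")
  case True
  then show ?thesis by auto
next
  case False
  show ?thesis
  proof (rule ennreal_le_epsilon)
    fix e :: real assume "e > 0"
    then have e2: "e / 2 > 0" by simp
    obtain i where i: "i \<in> I" "f i < (INF i\<in>I. f i) + ennreal (e / 2)"
      using INF_approx_ennreal[OF e2 refl, of f I] False by auto
    obtain j where j: "j \<in> J" "g j < (INF j\<in>J. g j) + ennreal (e / 2)"
      using INF_approx_ennreal[OF e2 refl, of g J] False by auto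
    have "x \<le> f i + g j" using assms i j by auto
    also have "\<dots> \<le> ((INF i\<in>I. f i) + ennreal (e / 2)) + ((INF j\<in>J. g j) + ennreal (e / 2))"
      using i j by (intro add_mono) auto
    also have "\<dots> = (INF i\<in>I. f i) + (INF j\<in>J. g j) + (ennreal (e / 2) + ennreal (e / 2))"
      by (simp only: add_ac)
    also have "ennreal (e / 2) + ennreal (e / 2) = ennreal e"
      using \<open>e > 0\<close> by (simp add: ennreal_plus[symmetric] del: ennreal_plus)
    finally show "x \<le> (INF i\<in>I. f i) + (INF j\<in>J. g j) + ennreal e" .
  qed
qed

lemma suminf_interleave_le:
  fixes f g :: "nat \<Rightarrow> ennreal"
  shows "(\<Sum>j. if even j then f (j div 2) else g (j div 2)) \<le> (\<Sum>j. f j) + (\<Sum>j. g j)"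
proof (rule suminf_le_const)
  show "summable (\<lambda>j. if even j then f (j div 2) else g (j div 2))" by simp
  fix n
  let ?h = "\<lambda>j. if even j then f (j div 2) else g (j div 2)"
  have eq: "(\<Sum>j<2 * n. ?h j) = (\<Sum>j<n. f j) + (\<Sum>j<n. g j)" for n
    by (induction n) (simp_all add: add_ac)
  have "(\<Sum>j<n. ?h j) \<le> (\<Sum>j<2 * n. ?h j)"
    by (rule sum_mono2) auto
  also have "\<dots> \<le> (\<Sum>j. f j) + (\<Sum>j. g j)"
    unfolding eq by (intro add_mono sum_le_suminf) auto
  finally show "(\<Sum>j<n. ?h j) \<le> (\<Sum>j. f j) + (\<Sum>j. g j)" .
qed

lemma hausdorff_premeasure_mono:
  "A \<subseteq> B \<Longrightarrow> hausdorff_premeasure s \<delta> A \<le> hausdorff_premeasure s \<delta> B"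
  unfolding hausdorff_premeasure_def by (rule INF_superset_mono) auto

lemma hausdorff_premeasure_antimono:
  "\<delta> \<le> \<delta>' \<Longrightarrow> hausdorff_premeasure s \<delta>' A \<le> hausdorff_premeasure s \<delta> A"
  unfolding hausdorff_premeasure_def by (rule INF_superset_mono) (auto intro: order_trans)

abbreviation cover_cost :: "nat \<Rightarrow> (nat \<Rightarrow> 'a::metric_space set) \<Rightarrow> ennreal" where
  "cover_cost s C \<equiv> (\<Sum>j. if C j = {} then 0 else ennreal (diameter (C j) ^ s))"

lemma hausdorff_premeasure_Un:
  "hausdorff_premeasure s \<delta> (A \<union> B) \<le> hausdorff_premeasure s \<delta> A + hausdorff_premeasure s \<delta> B"
  unfolding hausdorff_premeasure_def[of s \<delta> A] hausdorff_premeasure_def[of s \<delta> B]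
proof (rule le_INF_add_INF_ennreal)
  fix C C' :: "nat \<Rightarrow> 'a set"
  assume C: "C \<in> {C. A \<subseteq> (\<Union>j. C j) \<and> (\<forall>j. bounded (C j) \<and> diameter (C j) \<le> \<delta>)}"
    and C': "C' \<in> {C. B \<subseteq> (\<Union>j. C j) \<and> (\<forall>j. bounded (C j) \<and> diameter (C j) \<le> \<delta>)}"
  \<comment> \<open>Alternating the members of the two covers keeps the merged cover indexed by the
    naturals.\<close>
  define E where "E j = (if even j then C (j div 2) else C' (j div 2))" for j
  have "A \<union> B \<subseteq> (\<Union>j. E j)"
  proof
    fix x assume "x \<in> A \<union> B"
    then consider k where "x \<in> C k" | k where "x \<in> C' k" using C C' by blast
    then show "x \<in> (\<Union>j. E j)"
    proof cases
      case 1 then show ?thesis by (intro UN_I[of "2 * k"]) (auto simp: E_def)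
    next
      case 2 then show ?thesis by (intro UN_I[of "2 * k + 1"]) (auto simp: E_def)
    qed
  qed
  then have "hausdorff_premeasure s \<delta> (A \<union> B) \<le> cover_cost s E"
    unfolding hausdorff_premeasure_def using C C' by (intro INF_lower) (auto simp: E_def)
  also have "\<dots> = (\<Sum>j. if even j then (if C (j div 2) = {} then 0 else ennreal (diameter (C (j div 2)) ^ s))
      else (if C' (j div 2) = {} then 0 else ennreal (diameter (C' (j div 2)) ^ s)))"
    by (intro suminf_cong) (auto simp: E_def)
  also have "\<dots> \<le> cover_cost s C + cover_cost s C'"
    by (rule suminf_interleave_le)
  finally show "hausdorff_premeasure s \<delta> (A \<union> B) \<le> cover_cost s C + cover_cost s C'" .
qed

text \<open>A covering set of diameter at most \<delta> < g cannot meet both A and B, so every cover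
  of the union splits into a cover of A and a cover of B whose costs add up to no more than
  before.\<close>

lemma hausdorff_premeasure_separated:
  fixes A B :: "'a::metric_space set"
  assumes sep: "\<And>a b. a \<in> A \<Longrightarrow> b \<in> B \<Longrightarrow> g \<le> dist a b" and \<delta>: "\<delta> < g"
  shows "hausdorff_premeasure s \<delta> A + hausdorff_premeasure s \<delta> B \<le> hausdorff_premeasure s \<delta> (A \<union> B)"
  unfolding hausdorff_premeasure_def[of s \<delta> "A \<union> B"]
proof (rule INF_greatest)
  fix C :: "nat \<Rightarrow> 'a set"
  assume C: "C \<in> {C. A \<union> B \<subseteq> (\<Union>j. C j) \<and> (\<forall>j. bounded (C j) \<and> diameter (C j) \<le> \<delta>)}"
  define cost where "cost X = (if X = {} then 0 else ennreal (diameter X ^ s))" for X :: "'a set"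
  \<comment> \<open>Sets that miss S are replaced by the empty set, whose cost is 0 even when s =
    0.\<close>
  define pick where "pick S j = (if C j \<inter> S = {} then {} else C j)" for S j
  have \<delta>0: "\<delta> \<ge> 0"
    using C diameter_ge_0[of "C 0"] by (auto intro: order_trans)
  have le: "hausdorff_premeasure s \<delta> S \<le> (\<Sum>j. cost (pick S j))" if "S \<subseteq> A \<union> B" for S
    unfolding hausdorff_premeasure_def cost_def
  proof (rule INF_lower)
    have "S \<subseteq> (\<Union>j. pick S j)"
    proof
      fix x assume "x \<in> S"
      moreover from this obtain j where "x \<in> C j" using C \<open>S \<subseteq> A \<union> B\<close> by blast
      ultimately show "x \<in> (\<Union>j. pick S j)" by (intro UN_I[of j]) (auto simp: pick_def)
    qed
    then show "pick S \<in> {C. S \<subseteq> (\<Union>j. C j) \<and> (\<forall>j. bounded (C j) \<and> diameter (C j) \<le> \<delta>)}"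
      using C \<delta>0 by (auto simp: pick_def)
  qed
  have "hausdorff_premeasure s \<delta> A + hausdorff_premeasure s \<delta> B \<le> (\<Sum>j. cost (pick A j)) + (\<Sum>j. cost (pick B j))"
    by (intro add_mono le) auto
  also have "\<dots> = (\<Sum>j. cost (pick A j) + cost (pick B j))"
    by (intro suminf_add) auto
  also have "\<dots> \<le> (\<Sum>j. cost (C j))"
  proof (rule suminf_le)
    fix j
    have "pick A j = {} \<or> pick B j = {}"
    proof (rule ccontr)
      assume "\<not> ?thesis"
      then obtain a b where "a \<in> A" "a \<in> C j" "b \<in> B" "b \<in> C j"
        by (auto simp: pick_def split: if_splits)
      then have "g \<le> diameter (C j)"
        using sep[of a b] diameter_bounded_bound[of "C j" a b] C by (auto intro: order_trans)
      with C \<delta> show False by (auto simp: not_le[symmetric] intro: order_trans)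
    qed
    moreover have "cost (pick S j) \<le> cost (C j)" for S
      by (simp add: pick_def cost_def)
    moreover have "cost {} = 0" by (simp add: cost_def)
    ultimately show "cost (pick A j) + cost (pick B j) \<le> cost (C j)" by auto
  qed auto
  finally show "hausdorff_premeasure s \<delta> A + hausdorff_premeasure s \<delta> B
      \<le> cover_cost s C"
    by (simp add: cost_def)
qed

lemma hausdorff_premeasure_le_measure:
  "\<delta> > 0 \<Longrightarrow> hausdorff_premeasure s \<delta> A \<le> hausdorff_measure s A"
  unfolding hausdorff_measure_def by (rule SUP_upper) auto

lemma hausdorff_measure_mono: "A \<subseteq> B \<Longrightarrow> hausdorff_measure s A \<le> hausdorff_measure s B"
  unfolding hausdorff_measure_def by (intro SUP_mono) (auto intro: hausdorff_premeasure_mono)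

lemma hausdorff_measure_Un:
  "hausdorff_measure s (A \<union> B) \<le> hausdorff_measure s A + hausdorff_measure s B"
  unfolding hausdorff_measure_def[of s "A \<union> B"]
proof (rule SUP_least)
  fix \<delta> :: real assume "\<delta> \<in> {0<..}"
  then have "hausdorff_premeasure s \<delta> A + hausdorff_premeasure s \<delta> B \<le> hausdorff_measure s A + hausdorff_measure s B"
    by (intro add_mono hausdorff_premeasure_le_measure) auto
  with hausdorff_premeasure_Un show "hausdorff_premeasure s \<delta> (A \<union> B) \<le> hausdorff_measure s A + hausdorff_measure s B"
    by (rule order_trans)
qed

lemma hausdorff_measure_empty [simp]: "hausdorff_measure s {} = 0"
proof -
  have "hausdorff_premeasure s \<delta> ({} :: 'a set) \<le> 0" if "\<delta> > 0" for \<delta>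
    unfolding hausdorff_premeasure_def using that by (intro INF_lower2[of "\<lambda>_. {}"]) auto
  then have "hausdorff_measure s ({}::'a set) \<le> 0"
    unfolding hausdorff_measure_def by (intro SUP_least) auto
  then show ?thesis by simp
qed

lemma hausdorff_measure_UN:
  "finite I \<Longrightarrow> hausdorff_measure s (\<Union>i\<in>I. A i) \<le> (\<Sum>i\<in>I. hausdorff_measure s (A i))"
proof (induction I rule: finite_induct)
  case (insert i I)
  then show ?case
    using hausdorff_measure_Un[of s "A i" "\<Union>i\<in>I. A i"] by (auto intro: order_trans add_left_mono)
qed simp

text \<open>The metric outer measure property. It supplies the additivity needed to pack small balls
  around separated net points into a larger one.\<close>

lemma hausdorff_measure_separated:
  fixes A B :: "'a::metric_space set"
  assumes sep: "\<And>a b. a \<in> A \<Longrightarrow> b \<in> B \<Longrightarrow> g \<le> dist a b" and g: "g > 0"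
  shows "hausdorff_measure s A + hausdorff_measure s B \<le> hausdorff_measure s (A \<union> B)"
proof -
  have "hausdorff_measure s A + hausdorff_measure s B
      = (SUP \<delta>\<in>{0<..}. hausdorff_premeasure s \<delta> A + hausdorff_premeasure s \<delta> B)"
    unfolding hausdorff_measure_def
  proof (rule SUP_add_directed_ennreal[symmetric])
    fix i j :: real assume "i \<in> {0<..}" "j \<in> {0<..}"
    then show "\<exists>k\<in>{0<..}. hausdorff_premeasure s i A + hausdorff_premeasure s j B
        \<le> hausdorff_premeasure s k A + hausdorff_premeasure s k B"
      by (intro bexI[of _ "min i j"] add_mono hausdorff_premeasure_antimono) auto
  qed
  also have "\<dots> \<le> hausdorff_measure s (A \<union> B)"
  proof (rule SUP_least)
    fix \<delta> :: real assume "\<delta> \<in> {0<..}"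
    \<comment> \<open>Premeasures grow as the mesh shrinks, so the mesh may be taken below the gap
      g.\<close>
    define \<epsilon> where "\<epsilon> = min \<delta> (g / 2)"
    have \<epsilon>: "\<epsilon> \<le> \<delta>" "\<epsilon> < g" "\<epsilon> > 0" using g \<open>\<delta> \<in> {0<..}\<close> by (auto simp: \<epsilon>_def min_def)
    have "hausdorff_premeasure s \<delta> A + hausdorff_premeasure s \<delta> B
        \<le> hausdorff_premeasure s \<epsilon> A + hausdorff_premeasure s \<epsilon> B"
      using \<epsilon> by (intro add_mono hausdorff_premeasure_antimono)
    also have "\<dots> \<le> hausdorff_premeasure s \<epsilon> (A \<union> B)"
      using \<epsilon> sep by (intro hausdorff_premeasure_separated)
    also have "\<dots> \<le> hausdorff_measure s (A \<union> B)"
      using \<epsilon> by (intro hausdorff_premeasure_le_measure)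
    finally show "hausdorff_premeasure s \<delta> A + hausdorff_premeasure s \<delta> B \<le> hausdorff_measure s (A \<union> B)" .
  qed
  finally show ?thesis .
qed

lemma hausdorff_measure_UN_separated:
  fixes A :: "'i \<Rightarrow> 'a::metric_space set"
  assumes "finite I" "g > 0"
    and "\<And>i j a b. i \<in> I \<Longrightarrow> j \<in> I \<Longrightarrow> i \<noteq> j \<Longrightarrow> a \<in> A i \<Longrightarrow> b \<in> A j \<Longrightarrow> g \<le> dist a b"
  shows "(\<Sum>i\<in>I. hausdorff_measure s (A i)) \<le> hausdorff_measure s (\<Union>i\<in>I. A i)"
  using assms
proof (induction I rule: finite_induct)
  case (insert i I)
  have "(\<Sum>i\<in>insert i I. hausdorff_measure s (A i)) = hausdorff_measure s (A i) + (\<Sum>i\<in>I. hausdorff_measure s (A i))"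
    using insert by simp
  also have "\<dots> \<le> hausdorff_measure s (A i) + hausdorff_measure s (\<Union>i\<in>I. A i)"
    using insert by (intro add_left_mono insert.IH) auto
  also have "\<dots> \<le> hausdorff_measure s (A i \<union> (\<Union>i\<in>I. A i))"
  proof (rule hausdorff_measure_separated[OF _ \<open>g > 0\<close>])
    fix a b assume "a \<in> A i" "b \<in> (\<Union>i\<in>I. A i)"
    then obtain j where "j \<in> I" "b \<in> A j" by auto
    with \<open>i \<notin> I\<close> have "i \<noteq> j" by auto
    then show "g \<le> dist a b" using \<open>j \<in> I\<close> \<open>b \<in> A j\<close> \<open>a \<in> A i\<close> insert.prems(2)[of i j a b] by simp
  qed
  finally show ?case by simp
qed simp

section \<open>Nets in Ahlfors-David sets\<close>

lemma compact_separated_net: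
  fixes D :: "'a::metric_space set"
  assumes "compact D" "\<eta> > 0"
  shows "\<exists>Z. finite Z \<and> Z \<subseteq> D \<and> (\<forall>x\<in>Z. \<forall>y\<in>Z. x \<noteq> y \<longrightarrow> \<eta> \<le> dist x y) \<and>
    (\<forall>x\<in>D. \<exists>z\<in>Z. dist z x < \<eta>)"
proof -
  obtain F where F: "finite F" "D \<subseteq> (\<Union>x\<in>F. ball x (\<eta> / 2))"
    using assms unfolding compact_eq_totally_bounded by (meson half_gt_zero)
  define sep where "sep Z \<longleftrightarrow> finite Z \<and> Z \<subseteq> D \<and> (\<forall>x\<in>Z. \<forall>y\<in>Z. x \<noteq> y \<longrightarrow> \<eta> \<le> dist x y)" for Z
  \<comment> \<open>A ball of radius \<eta> / 2 holds at most one point of an \<eta>-separated set,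
    so cardinalities are bounded and a largest separated set exists. Being largest it cannot be
    enlarged, which makes it \<eta>-dense in D.\<close>
  have bound: "card Z \<le> card F" if Z: "sep Z" for Z
  proof -
    have "\<exists>x\<in>F. dist x z < \<eta> / 2" if "z \<in> Z" for z
      using that Z F by (force simp: sep_def)
    then obtain f where f: "\<And>z. z \<in> Z \<Longrightarrow> f z \<in> F \<and> dist (f z) z < \<eta> / 2" by metis
    have "inj_on f Z"
    proof (rule inj_onI, rule ccontr)
      fix x y assume xy: "x \<in> Z" "y \<in> Z" "f x = f y" "x \<noteq> y"
      then have "dist x y < \<eta>"
        using f[of x] f[of y] dist_triangle2[of x y "f x"] by (simp add: dist_commute)
      with xy Z show False by (force simp: sep_def)
    qed
    then show ?thesis using f F by (intro card_inj_on_le[of f]) auto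
  qed
  have "sep {}" by (simp add: sep_def)
  then obtain Z where Z: "sep Z" "\<And>Y. sep Y \<Longrightarrow> card Y \<le> card Z"
    using ex_has_greatest_nat[of sep "{}" card "Suc (card F)"] bound by (auto simp: less_Suc_eq_le)
  have "\<exists>z\<in>Z. dist z x < \<eta>" if x: "x \<in> D" for x
  proof (rule ccontr)
    assume no: "\<not> ?thesis"
    then have "x \<notin> Z" using assms(2) by auto
    have "sep (insert x Z)"
      using Z(1) x no by (auto simp: sep_def not_less dist_commute)
    from Z(2)[OF this] \<open>x \<notin> Z\<close> Z(1) show False by (simp add: sep_def)
  qed
  with Z(1) show ?thesis by (intro exI[of _ Z]) (auto simp: sep_def)
qed

text \<open>Counting in place of surface measure, with the mesh \<eta> as unit of length. The lower
  count is local, with centres in D and radii up to r1; the upper count is global, with arbitrary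
  centres and all radii from \<eta> on. The radius 2 r makes room for net points just outside the
  ball of radius r.\<close>

definition regular_net :: "(real ^ 'n) set \<Rightarrow> real \<Rightarrow> real \<Rightarrow> real \<Rightarrow> real \<Rightarrow> (real ^ 'n) set \<Rightarrow> bool" where
  "regular_net D c C r1 \<eta> Z \<longleftrightarrow> finite Z \<and> Z \<subseteq> D \<and>
     (\<forall>x\<in>D. \<forall>r. \<eta> \<le> r \<and> r \<le> r1 \<longrightarrow> c * (r / \<eta>) ^ (CARD('n) - 1) \<le> real (card {z\<in>Z. dist x z < 2 * r})) \<and>
     (\<forall>y. \<forall>r\<ge>\<eta>. real (card {z\<in>Z. dist y z \<le> r}) \<le> C * (r / \<eta>) ^ (CARD('n) - 1))"

text \<open>Lower count: the \<eta>-balls around the net points near x cover the part of D in the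
  r-ball, so their number is at least a quotient of measures. Upper count: the parts of D in balls
  of radius \<eta> / 3 around net points are \<eta> / 3 apart, so their measures add up to at most
  that of one ball of radius 3 r. Neither constant depends on \<eta>.\<close>

lemma ahlfors_david_net:
  fixes D :: "(real ^ 'n) set"
  assumes AD: "ahlfors_david D" and D: "compact D"
  obtains c C r1 where "c > 0" "C \<ge> 0" "r1 > 0"
    "\<And>\<eta>. 0 < \<eta> \<Longrightarrow> \<eta> \<le> r1 \<Longrightarrow> \<exists>Z. regular_net D c C r1 \<eta> Z"
proof -
  define m where "m = CARD('n) - 1"
  define H where "H = (hausdorff_measure m :: (real ^ 'n) set \<Rightarrow> ennreal)"
  obtain c0 c1 r0 where c: "c0 > 0" "c1 > 0" "r0 > 0"
    and lo: "\<And>x r. x \<in> D \<Longrightarrow> 0 < r \<Longrightarrow> r \<le> r0 \<Longrightarrow> ennreal (c0 * r ^ m) \<le> H (D \<inter> ball x r)"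
    and hi: "\<And>x r. x \<in> D \<Longrightarrow> 0 < r \<Longrightarrow> r \<le> r0 \<Longrightarrow> H (D \<inter> ball x r) \<le> ennreal (c1 * r ^ m)"
    using AD unfolding ahlfors_david_def m_def H_def by auto
  \<comment> \<open>Leaves room for the radius 3 r of the packing argument.\<close>
  define r1 where "r1 = r0 / 4"
  have r1: "r1 > 0" using c by (simp add: r1_def)
  obtain F where F: "finite F" "D \<subseteq> (\<Union>x\<in>F. ball x r1)"
    using D r1 unfolding compact_eq_totally_bounded by meson
  \<comment> \<open>The factor 9^m arises from the quotient of (3 r)^m by (\<eta> / 3)^m.\<close>
  define C1 where "C1 = c1 / c0 * 9 ^ m"
  have C1: "C1 \<ge> 0" using c by (simp add: C1_def)
  \<comment> \<open>For r > r1 all of D is covered by \<open>card F\<close> balls of radius r1, to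
    each of which the count at radius r1 applies; the summand 1 handles r <= r1.\<close>
  define C where "C = (card F + 1) * C1"
  show ?thesis
  proof (rule that[of "c0 / c1" C r1])
    show "c0 / c1 > 0" "C \<ge> 0" "r1 > 0" using c r1 C1 by (auto simp: C_def)
    fix \<eta> :: real assume \<eta>: "0 < \<eta>" "\<eta> \<le> r1"
    obtain Z where "finite Z \<and> Z \<subseteq> D \<and> (\<forall>x\<in>Z. \<forall>y\<in>Z. x \<noteq> y \<longrightarrow> \<eta> \<le> dist x y) \<and> (\<forall>x\<in>D. \<exists>z\<in>Z. dist z x < \<eta>)"
      using compact_separated_net[OF D \<eta>(1)] ..
    then have Z: "finite Z" "Z \<subseteq> D" "\<And>x y. x \<in> Z \<Longrightarrow> y \<in> Z \<Longrightarrow> x \<noteq> y \<Longrightarrow> \<eta> \<le> dist x y"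
      "\<And>x. x \<in> D \<Longrightarrow> \<exists>z\<in>Z. dist z x < \<eta>" by auto
    have lower: "c0 / c1 * (r / \<eta>) ^ m \<le> real (card {z\<in>Z. dist x z < 2 * r})"
      if x: "x \<in> D" and r: "\<eta> \<le> r" "r \<le> r1" for x r
    proof -
      define N where "N = {z\<in>Z. dist x z < 2 * r}"
      have N: "finite N" "N \<subseteq> Z" using Z by (auto simp: N_def)
      have sub: "D \<inter> ball x r \<subseteq> (\<Union>z\<in>N. D \<inter> ball z \<eta>)"
      proof
        fix y assume y: "y \<in> D \<inter> ball x r"
        then obtain z where z: "z \<in> Z" "dist z y < \<eta>" using Z(4) by auto
        then have "dist x z < 2 * r"
          using y r dist_triangle2[of x z y] by auto
        with z y show "y \<in> (\<Union>z\<in>N. D \<inter> ball z \<eta>)" by (auto simp: N_def)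
      qed
      have "ennreal (c0 * r ^ m) \<le> H (D \<inter> ball x r)"
        using x r \<eta> c by (intro lo) (auto simp: r1_def)
      also have "\<dots> \<le> H (\<Union>z\<in>N. D \<inter> ball z \<eta>)"
        unfolding H_def by (rule hausdorff_measure_mono[OF sub])
      also have "\<dots> \<le> (\<Sum>z\<in>N. H (D \<inter> ball z \<eta>))"
        unfolding H_def by (rule hausdorff_measure_UN[OF N(1)])
      also have "\<dots> \<le> (\<Sum>z\<in>N. ennreal (c1 * \<eta> ^ m))"
        using N Z(2) \<eta> c by (intro sum_mono hi) (auto simp: r1_def)
      also have "\<dots> = ennreal (card N * (c1 * \<eta> ^ m))"
        using c \<eta> by (simp add: ennreal_of_nat_eq_real_of_nat ennreal_mult'[symmetric])
      finally have "c0 * r ^ m \<le> card N * (c1 * \<eta> ^ m)"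
        using c \<eta> by (simp add: ennreal_le_iff)
      then show ?thesis
        using c \<eta> by (simp add: N_def field_simps power_divide)
    qed
    have upper1: "real (card {z\<in>Z. dist y z \<le> r}) \<le> C1 * (r / \<eta>) ^ m"
      if r: "\<eta> \<le> r" "r \<le> r1" for y r
    proof -
      define N where "N = {z\<in>Z. dist y z \<le> r}"
      have N: "finite N" "N \<subseteq> Z" using Z by (auto simp: N_def)
      show ?thesis
      proof (cases "N = {}")
        case True
        then have "card N = 0" by simp
        then show ?thesis using C1 r \<eta> by (simp add: N_def)
      next
        case False
        then obtain z0 where z0: "z0 \<in> N" by auto
        have sub: "(\<Union>z\<in>N. D \<inter> ball z (\<eta> / 3)) \<subseteq> D \<inter> ball z0 (3 * r)"
        proof
          fix w assume "w \<in> (\<Union>z\<in>N. D \<inter> ball z (\<eta> / 3))"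
          then obtain z where z: "z \<in> N" "w \<in> D" "dist z w < \<eta> / 3" by auto
          have "dist z0 w \<le> dist z0 y + dist y z + dist z w"
            using dist_triangle[of z0 w z] dist_triangle[of z0 z y] by linarith
          also have "\<dots> < 3 * r"
          proof -
            have "dist y z \<le> r" "dist y z0 \<le> r" using z z0 by (auto simp: N_def)
            then show ?thesis using z(3) r \<eta> by (simp add: dist_commute[of z0 y])
          qed
          finally show "w \<in> D \<inter> ball z0 (3 * r)" using z by simp
        qed
        have "ennreal (card N * (c0 * (\<eta> / 3) ^ m)) = (\<Sum>z\<in>N. ennreal (c0 * (\<eta> / 3) ^ m))"
          using c \<eta> by (simp add: ennreal_of_nat_eq_real_of_nat ennreal_mult'[symmetric])
        also have "\<dots> \<le> (\<Sum>z\<in>N. H (D \<inter> ball z (\<eta> / 3)))"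
          using N Z(2) \<eta> c by (intro sum_mono lo) (auto simp: r1_def)
        also have "\<dots> \<le> H (\<Union>z\<in>N. D \<inter> ball z (\<eta> / 3))"
          unfolding H_def
        proof (rule hausdorff_measure_UN_separated[OF N(1), of "\<eta> / 3"])
          fix i j a b assume ij: "i \<in> N" "j \<in> N" "i \<noteq> j" and ab: "a \<in> D \<inter> ball i (\<eta> / 3)" "b \<in> D \<inter> ball j (\<eta> / 3)"
          have "\<eta> \<le> dist i j" using Z(3) N ij by auto
          moreover have "dist i j \<le> dist i a + dist a b + dist j b"
            using dist_triangle[of i j a] dist_triangle2[of a j b] by linarith
          ultimately show "\<eta> / 3 \<le> dist a b" using ab by auto
        qed (use \<eta> in auto)
        also have "\<dots> \<le> H (D \<inter> ball z0 (3 * r))"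
          unfolding H_def by (rule hausdorff_measure_mono[OF sub])
        also have "\<dots> \<le> ennreal (c1 * (3 * r) ^ m)"
          using z0 N Z(2) r \<eta> c by (intro hi) (auto simp: r1_def)
        finally have "card N * (c0 * (\<eta> / 3) ^ m) \<le> c1 * (3 * r) ^ m"
          using c \<eta> r by (simp add: ennreal_le_iff)
        then have "card N * c0 * \<eta> ^ m \<le> c1 * 9 ^ m * r ^ m"
          using power_mult_distrib[of "3::real" 3 m] by (simp add: field_simps power_divide power_mult_distrib)
        then show ?thesis
          using c \<eta> by (simp add: N_def C1_def field_simps power_divide)
      qed
    qed
    have upper: "real (card {z\<in>Z. dist y z \<le> r}) \<le> C * (r / \<eta>) ^ m" if r: "\<eta> \<le> r" for y r
    proof (cases "r \<le> r1")
      case True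
      have "C1 * (r / \<eta>) ^ m \<le> C * (r / \<eta>) ^ m"
        using C1 r \<eta> by (intro mult_right_mono) (auto simp: C_def algebra_simps)
      then show ?thesis using upper1[OF r True, of y] by linarith
    next
      case False
      have "card {z\<in>Z. dist y z \<le> r} \<le> card (\<Union>x\<in>F. {z\<in>Z. dist x z \<le> r1})"
      proof (rule card_mono)
        show "{z \<in> Z. dist y z \<le> r} \<subseteq> (\<Union>x\<in>F. {z \<in> Z. dist x z \<le> r1})"
        proof
          fix z assume z: "z \<in> {z \<in> Z. dist y z \<le> r}"
          then obtain x where "x \<in> F" "z \<in> ball x r1" using F(2) Z(2) by blast
          with z show "z \<in> (\<Union>x\<in>F. {z \<in> Z. dist x z \<le> r1})" by (auto intro!: bexI[of _ x])
        qed
      qed (use F Z in auto)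
      also have "\<dots> \<le> (\<Sum>x\<in>F. card {z\<in>Z. dist x z \<le> r1})"
        by (rule card_UN_le[OF F(1)])
      finally have "real (card {z\<in>Z. dist y z \<le> r}) \<le> real (\<Sum>x\<in>F. card {z\<in>Z. dist x z \<le> r1})"
        by (simp only: of_nat_le_iff)
      also have "\<dots> = (\<Sum>x\<in>F. real (card {z\<in>Z. dist x z \<le> r1}))" by simp
      also have "\<dots> \<le> (\<Sum>x\<in>F. C1 * (r1 / \<eta>) ^ m)"
        by (intro sum_mono upper1) (use \<eta> in auto)
      also have "\<dots> = card F * C1 * (r1 / \<eta>) ^ m" by simp
      also have "\<dots> \<le> C * (r / \<eta>) ^ m"
        using False C1 \<eta> r1 by (intro mult_mono power_mono divide_right_mono) (auto simp: C_def algebra_simps)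
      finally show ?thesis .
    qed
    show "\<exists>Z. regular_net D (c0 / c1) C r1 \<eta> Z"
      unfolding regular_net_def m_def[symmetric]
    proof (intro exI[of _ Z] conjI ballI allI impI)
      fix x r assume "x \<in> D" "\<eta> \<le> r \<and> r \<le> r1"
      then show "c0 / c1 * (r / \<eta>) ^ m \<le> real (card {z\<in>Z. dist x z < 2 * r})" by (intro lower) auto
    qed (fact Z(1) Z(2) upper)+
  qed
qed


section \<open>The weighted inequality\<close>

text \<open>The width \<eta> of the vanishing zone may vary with the pair, whereas the constant in
  \<open>hardy_on\<close> may not. The intended instances are powers of norms of test
  functions.\<close>

definition hardy_pair :: "'a::euclidean_space set \<Rightarrow> ('a \<Rightarrow> real) \<Rightarrow> ('a \<Rightarrow> real) \<Rightarrow> bool" where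
  "hardy_pair D v g \<longleftrightarrow> slope_bound v g \<and> (\<exists>\<eta>>0. \<forall>x. infdist x D < \<eta> \<longrightarrow> v x = 0 \<and> g x = 0)"

text \<open>The right-hand side runs over \<Omega> whatever W is, so bounds on finitely many sets
  add up to a bound on their union.\<close>

definition hardy_on :: "real \<Rightarrow> 'a::euclidean_space set \<Rightarrow> 'a set \<Rightarrow> 'a set \<Rightarrow> bool" where
  "hardy_on p \<Omega> D W \<longleftrightarrow> (\<exists>K\<ge>0. \<forall>v g. hardy_pair D v g \<longrightarrow>
     weighted_int D (- p) v W
       \<le> ennreal K * weighted_int D (1 - p) g \<Omega>)"

lemma slope_bound_continuous:
  assumes "slope_bound v g"
  shows "continuous_on UNIV v"
proof (rule continuous_at_imp_continuous_on, intro ballI)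
  fix x
  have "\<forall>\<^sub>F y in nhds x. \<bar>v y - v x\<bar> \<le> (g x + 1) * dist y x"
    using assms by (auto simp: slope_bound_def)
  then have "\<forall>\<^sub>F y in at x. norm (v y - v x) \<le> (g x + 1) * dist y x"
    by (simp add: eventually_at_filter eventually_mono)
  moreover have "((\<lambda>y. (g x + 1) * dist y x) \<longlongrightarrow> 0) (at x)"
    by (auto intro!: tendsto_eq_intros)
  ultimately have "((\<lambda>y. v y - v x) \<longlongrightarrow> 0) (at x)"
    by (rule Lim_null_comparison)
  then show "isCont v x" by (simp add: isCont_def LIM_zero_iff)
qed

lemma measurable_on_if:
  fixes \<psi> :: "'a::euclidean_space \<Rightarrow> 'a" and k :: "'a \<Rightarrow> ennreal"
  assumes "continuous_on V \<psi>" "V \<in> sets borel" "k \<in> borel_measurable borel"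
  shows "(\<lambda>y. if y \<in> V then k (\<psi> y) else 0) \<in> borel_measurable borel"
proof -
  have "(\<lambda>y. if y \<in> V then \<psi> y else 0) \<in> borel_measurable borel"
    by (rule borel_measurable_continuous_on_if) (use assms in auto)
  then have "(\<lambda>y. if y \<in> V then k (if y \<in> V then \<psi> y else 0) else 0) \<in> borel_measurable borel"
    using assms(2,3) by measurable
  also have "(\<lambda>y. if y \<in> V then k (if y \<in> V then \<psi> y else 0) else 0) = (\<lambda>y. if y \<in> V then k (\<psi> y) else 0)"
    by auto
  finally show ?thesis .
qed

lemma borel_preimage_on:
  assumes "continuous_on V \<psi>" "V \<in> sets borel" "open O'"
  shows "{y\<in>V. \<psi> y \<in> O'} \<in> sets borel"
proof -
  obtain T where "open T" "T \<inter> V = \<psi> -` O' \<inter> V"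
    using assms(1,3) unfolding continuous_on_open_invariant by blast
  then have "{y\<in>V. \<psi> y \<in> O'} = T \<inter> V" by auto
  with \<open>open T\<close> assms(2) show ?thesis by (simp only: sets.Int borel_open)
qed

lemma infdist_lipschitz_le:
  assumes "L \<ge> 0" "D' \<noteq> {}"
    and "\<And>z'. z' \<in> D' \<Longrightarrow> \<exists>z\<in>D. dist x z \<le> L * dist y z'"
  shows "infdist x D \<le> L * infdist y D'"
proof (cases "L = 0")
  case True
  obtain z' where "z' \<in> D'" using assms(2) by auto
  with assms(3) obtain z where "z \<in> D" "dist x z \<le> L * dist y z'" by blast
  with infdist_le[of z D x] True show ?thesis by simp
next
  case False
  then have L: "L > 0" using assms(1) by simp
  have "infdist x D / L \<le> infdist y D'"
    unfolding infdist_notempty[OF assms(2)]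
  proof (rule cINF_greatest[OF assms(2)])
    fix z' assume "z' \<in> D'"
    with assms(3) obtain z where "z \<in> D" "dist x z \<le> L * dist y z'" by blast
    with infdist_le[of z D x] L show "infdist x D / L \<le> dist y z'" by (simp add: field_simps)
  qed
  with L show ?thesis by (simp add: field_simps)
qed

text \<open>
  The curve is followed backwards from its end point to the last point outside \<open>\<Omega>\<close>, where \<open>v\<close> vanishes.
\<close>

lemma hardy_pair_exit:
  fixes \<gamma> :: "real \<Rightarrow> 'a::euclidean_space"
  assumes vg: "hardy_pair D v g" and \<gamma>: "L-lipschitz_on {0..1} \<gamma>" and \<Omega>: "open \<Omega>"
    and end_in: "\<gamma> 1 \<in> \<Omega>" and start_in: "\<gamma> 0 \<in> D - \<Omega>"
    and hit: "\<And>t. 0 < t \<Longrightarrow> t \<le> 1 \<Longrightarrow> \<gamma> t \<in> frontier \<Omega> \<Longrightarrow> \<gamma> t \<in> D"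
  shows "ennreal (v (\<gamma> 1)) \<le> ennreal L * (\<integral>\<^sup>+t\<in>{0..1}. (if 0 < t \<and> \<gamma> t \<in> \<Omega> then ennreal (g (\<gamma> t)) else 0) \<partial>lborel)"
proof -
  have cont: "continuous_on {0..1} \<gamma>" using \<gamma> by (rule lipschitz_on_continuous_on)
  define S where "S = {t\<in>{0..1}. \<gamma> t \<in> - \<Omega>}"
  have "S = {0..1} \<inter> \<gamma> -` (- \<Omega>)" by (auto simp: S_def)
  then have "closed S"
    using continuous_closed_preimage[OF cont closed_real_atLeastAtMost, of "- \<Omega>"] \<Omega> by (simp add: closed_Compl)
  moreover have "bounded S"
    by (rule bounded_subset[OF bounded_closed_interval[of 0 1]]) (auto simp: S_def)
  ultimately have "compact S" by (simp add: compact_eq_bounded_closed)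
  moreover have "0 \<in> S" using start_in by (simp add: S_def)
  ultimately obtain a where a: "a \<in> S" "\<And>t. t \<in> S \<Longrightarrow> t \<le> a"
    using compact_attains_sup[of S] by (metis empty_iff)
  have a01: "0 \<le> a" "a < 1" using a(1) end_in by (auto simp: S_def less_le)
  have inside: "\<gamma> t \<in> \<Omega>" if "a < t" "t \<le> 1" for t
    using a(2)[of t] that a01 by (force simp: S_def)
  have "\<gamma> a \<in> D"
  proof (cases "a = 0")
    case True then show ?thesis using start_in by simp
  next
    case False
    \<comment> \<open>After time a the curve stays in \<Omega>, while at time a it is outside. So it
      sits on the boundary then, and \<open>hit\<close> places it in D.\<close>
    have "\<gamma> a \<in> closure \<Omega>"
    proof -
      have "((\<lambda>t. \<gamma> t) \<longlongrightarrow> \<gamma> a) (at a within {a..1})"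
        using continuous_on_subset[OF cont, of "{a..1}"] a01 by (auto simp: continuous_on)
      then have lim: "(\<gamma> \<longlongrightarrow> \<gamma> a) (at a within {a<..1})"
        by (rule tendsto_within_subset) auto
      moreover have "at a within {a<..1} \<noteq> bot"
        using a01 by (auto simp: trivial_limit_within islimpt_greaterThanLessThan1 intro: islimpt_subset[of a "{a<..<1}"])
      moreover have "\<forall>\<^sub>F t in at a within {a<..1}. \<gamma> t \<in> closure \<Omega>"
        unfolding eventually_at_filter using inside closure_subset[of \<Omega>] by (auto intro!: always_eventually)
      ultimately show ?thesis using Lim_in_closed_set[of "closure \<Omega>"] by blast
    qed
    moreover have "\<gamma> a \<notin> \<Omega>" using a(1) by (simp add: S_def)
    ultimately have "\<gamma> a \<in> frontier \<Omega>" using \<Omega> by (simp add: frontier_def interior_open)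
    then show ?thesis using hit[of a] a01 False by simp
  qed
  then have v0: "v (\<gamma> a) = 0"
    using vg by (auto simp: hardy_pair_def)
  have sb: "slope_bound v g" using vg by (simp add: hardy_pair_def)
  have vn: "v x \<ge> 0" for x using sb by (simp add: slope_bound_def)
  have "ennreal \<bar>v (\<gamma> 1) - v (\<gamma> a)\<bar> \<le> ennreal L * (\<integral>\<^sup>+t\<in>{a..1}. ennreal (g (\<gamma> t)) \<partial>lborel)"
    by (rule slope_bound_along_curve[OF sb]) (use a01 \<gamma> in \<open>auto intro: lipschitz_on_subset\<close>)
  also have "\<dots> \<le> ennreal L * (\<integral>\<^sup>+t\<in>{0..1}. (if 0 < t \<and> \<gamma> t \<in> \<Omega> then ennreal (g (\<gamma> t)) else 0) \<partial>lborel)"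
  proof (intro mult_left_mono nn_integral_mono_AE)
    \<comment> \<open>At t = a the curve is outside \<Omega>, so the right-hand integrand is 0
      there; a single time is negligible.\<close>
    have "AE t in lborel. t \<noteq> a" by (rule AE_lborel_singleton)
    then show "AE t in lborel. ennreal (g (\<gamma> t)) * indicator {a..1} t
        \<le> (if 0 < t \<and> \<gamma> t \<in> \<Omega> then ennreal (g (\<gamma> t)) else 0) * indicator {0..1} t"
      by eventually_elim (use inside a01 in \<open>auto simp: indicator_def\<close>)
  qed simp
  finally show ?thesis using v0 vn[of "\<gamma> 1"] by simp
qed

lemma hardy_onE:
  assumes "hardy_on p \<Omega> D W"
  obtains K where "K \<ge> 0" "\<forall>v g. hardy_pair D v g \<longrightarrow>
     weighted_int D (- p) v W
       \<le> ennreal K * weighted_int D (1 - p) g \<Omega>"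
  using assms unfolding hardy_on_def by (elim exE conjE) (rule that)

lemma hardy_on_Un:
  assumes "hardy_on p \<Omega> D W1" "hardy_on p \<Omega> D W2" and W: "W1 \<in> sets borel" "W2 \<in> sets borel"
  shows "hardy_on p \<Omega> D (W1 \<union> W2)"
proof -
  from hardy_onE[OF assms(1)] obtain K1 where K1: "K1 \<ge> 0" "\<forall>v g. hardy_pair D v g \<longrightarrow> weighted_int D (- p) v W1
       \<le> ennreal K1 * weighted_int D (1 - p) g \<Omega>" .
  from hardy_onE[OF assms(2)] obtain K2 where K2: "K2 \<ge> 0" "\<forall>v g. hardy_pair D v g \<longrightarrow> weighted_int D (- p) v W2
       \<le> ennreal K2 * weighted_int D (1 - p) g \<Omega>" .
  show ?thesis
    unfolding hardy_on_def
  proof (intro exI[of _ "K1 + K2"] conjI allI impI)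
    fix v g assume vg: "hardy_pair D v g"
    let ?f = "\<lambda>x. ennreal (v x * infdist x D powr (- p))"
    note W[measurable]
    have [measurable]: "v \<in> borel_measurable borel" "(\<lambda>x. infdist x D) \<in> borel_measurable borel"
      using vg by (auto simp: hardy_pair_def intro!: borel_measurable_continuous_onI slope_bound_continuous continuous_intros)
    have "(\<integral>\<^sup>+x\<in>W1 \<union> W2. ?f x \<partial>lborel) \<le> (\<integral>\<^sup>+x. ?f x * indicator W1 x + ?f x * indicator W2 x \<partial>lborel)"
      by (intro nn_integral_mono) (auto simp: indicator_def)
    also have "\<dots> = (\<integral>\<^sup>+x\<in>W1. ?f x \<partial>lborel) + (\<integral>\<^sup>+x\<in>W2. ?f x \<partial>lborel)"
      by (rule nn_integral_add) measurable
    also have "\<dots> \<le> ennreal K1 * weighted_int D (1 - p) g \<Omega>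
        + ennreal K2 * weighted_int D (1 - p) g \<Omega>"
      by (intro add_mono K1(2)[rule_format, OF vg] K2(2)[rule_format, OF vg])
    also have "\<dots> = ennreal (K1 + K2) * weighted_int D (1 - p) g \<Omega>"
      using K1 K2 by (simp add: distrib_right)
    finally show "(\<integral>\<^sup>+x\<in>W1 \<union> W2. ?f x \<partial>lborel)
      \<le> ennreal (K1 + K2) * weighted_int D (1 - p) g \<Omega>" .
  qed (use K1 K2 in auto)
qed

text \<open>The values of w on V are compared with those on B by averaging over all x in V and y in
  B. The factor 2^d comes from integrating first over the end point for which the dilation ratio is
  at least 1/2: x when s >= 1/2, and y, with ratio 1 - s, otherwise. For B of positive volume this
  carries a bound from B to V.\<close>

lemma convex_poincare:
  fixes V B :: "'a::euclidean_space set" and w G :: "'a \<Rightarrow> ennreal"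
  assumes V: "convex V" "V \<in> sets borel" and B[measurable]: "B \<in> sets borel" and BV: "B \<subseteq> V"
    and w[measurable]: "w \<in> borel_measurable borel" and G[measurable]: "G \<in> borel_measurable borel"
    and le: "\<And>x y. x \<in> V \<Longrightarrow> y \<in> V \<Longrightarrow> w x \<le> w y + M * (\<integral>\<^sup>+s\<in>{0..1}. G (y + s *\<^sub>R (x - y)) \<partial>lborel)"
  shows "emeasure lborel B * (\<integral>\<^sup>+x\<in>V. w x \<partial>lborel)
    \<le> emeasure lborel V * ((\<integral>\<^sup>+y\<in>B. w y \<partial>lborel) + M * 2 ^ DIM('a) * (\<integral>\<^sup>+y\<in>V. G y \<partial>lborel))"
proof -
  have [measurable]: "V \<in> sets borel" by (rule V)
  define F where "F x y s = G (y + s *\<^sub>R (x - y)) * indicator {0..1} s * indicator V y * indicator V x" for x y and s :: real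
  define I where "I = (\<integral>\<^sup>+y\<in>V. G y \<partial>lborel)"
  have slice: "(\<integral>\<^sup>+x. (\<integral>\<^sup>+y. F x y s \<partial>lborel) \<partial>lborel) \<le> (2 ^ DIM('a) * I * emeasure lborel V) * indicator {0..1} s" for s
  proof (cases "s \<in> {0..1}")
    case False
    then show ?thesis by (simp add: F_def)
  next
    case True
    have contr: "(\<integral>\<^sup>+x\<in>V. G (z + t *\<^sub>R (x - z)) \<partial>lborel) \<le> 2 ^ DIM('a) * I"
      if t: "1 / 2 \<le> t" "t \<le> 1" and z: "z \<in> V" for t :: real and z
    proof -
      have "(\<integral>\<^sup>+x\<in>V. G (z + t *\<^sub>R (x - z)) \<partial>lborel) \<le> ennreal (1 / t ^ DIM('a)) * I"
        unfolding I_def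
      proof (rule homothety_expand_le)
        fix x assume x: "x \<in> V"
        have "z + t *\<^sub>R (x - z) = (1 - t) *\<^sub>R z + t *\<^sub>R x" by (simp add: algebra_simps)
        also have "\<dots> \<in> V" using V(1) x z t by (intro convexD) auto
        finally show "z + t *\<^sub>R (x - z) \<in> V" .
      qed (use t V in auto)
      also have "1 / t ^ DIM('a) \<le> 2 ^ DIM('a)"
      proof -
        have "(1 / t) ^ DIM('a) \<le> 2 ^ DIM('a)" using t by (intro power_mono) (auto simp: field_simps)
        then show ?thesis by (simp add: power_one_over)
      qed
      then have "ennreal (1 / t ^ DIM('a)) * I \<le> ennreal (2 ^ DIM('a)) * I"
        by (intro mult_right_mono ennreal_leI) auto
      also have "ennreal (2 ^ DIM('a)) = 2 ^ DIM('a)" by (simp add: ennreal_power[symmetric])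
      finally show ?thesis .
    qed
    show ?thesis
    proof (cases "s \<ge> 1 / 2")
      case big: True
      have "(\<integral>\<^sup>+x. (\<integral>\<^sup>+y. F x y s \<partial>lborel) \<partial>lborel) = (\<integral>\<^sup>+y. (\<integral>\<^sup>+x. F x y s \<partial>lborel) \<partial>lborel)"
        unfolding F_def by (rule lborel_pair.Fubini') measurable
      also have "\<dots> \<le> (\<integral>\<^sup>+y. 2 ^ DIM('a) * I * indicator V y \<partial>lborel)"
      proof (rule nn_integral_mono)
        fix y
        show "(\<integral>\<^sup>+x. F x y s \<partial>lborel) \<le> 2 ^ DIM('a) * I * indicator V y"
        proof (cases "y \<in> V")
          case True
          with contr[of s y] big \<open>s \<in> {0..1}\<close> show ?thesis by (simp add: F_def)
        qed (simp add: F_def)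
      qed
      also have "\<dots> = 2 ^ DIM('a) * I * emeasure lborel V"
        by (simp add: nn_integral_cmult)
      finally show ?thesis using True by simp
    next
      case False
      have "(\<integral>\<^sup>+x. (\<integral>\<^sup>+y. F x y s \<partial>lborel) \<partial>lborel) \<le> (\<integral>\<^sup>+x. 2 ^ DIM('a) * I * indicator V x \<partial>lborel)"
      proof (rule nn_integral_mono)
        fix x :: 'a
        have eq: "y + s *\<^sub>R (x - y) = x + (1 - s) *\<^sub>R (y - x)" for y :: 'a by (simp add: algebra_simps)
        show "(\<integral>\<^sup>+y. F x y s \<partial>lborel) \<le> 2 ^ DIM('a) * I * indicator V x"
        proof (cases "x \<in> V")
          case True
          with contr[of "1 - s" x] False \<open>s \<in> {0..1}\<close> show ?thesis by (simp add: F_def eq)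
        qed (simp add: F_def)
      qed
      also have "\<dots> = 2 ^ DIM('a) * I * emeasure lborel V"
        by (simp add: nn_integral_cmult)
      finally show ?thesis using True by simp
    qed
  qed
  have triple: "(\<integral>\<^sup>+x. (\<integral>\<^sup>+y. (\<integral>\<^sup>+s. F x y s \<partial>lborel) \<partial>lborel) \<partial>lborel) \<le> 2 ^ DIM('a) * I * emeasure lborel V"
  proof -
    have "(\<integral>\<^sup>+x. (\<integral>\<^sup>+y. (\<integral>\<^sup>+s. F x y s \<partial>lborel) \<partial>lborel) \<partial>lborel)
        = (\<integral>\<^sup>+x. (\<integral>\<^sup>+s. (\<integral>\<^sup>+y. F x y s \<partial>lborel) \<partial>lborel) \<partial>lborel)"
      unfolding F_def by (intro nn_integral_cong lborel_pair.Fubini') measurable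
    also have "\<dots> = (\<integral>\<^sup>+s. (\<integral>\<^sup>+x. (\<integral>\<^sup>+y. F x y s \<partial>lborel) \<partial>lborel) \<partial>lborel)"
      unfolding F_def by (rule lborel_pair.Fubini') measurable
    also have "\<dots> \<le> (\<integral>\<^sup>+(s::real). (2 ^ DIM('a) * I * emeasure lborel V) * indicator {0..1} s \<partial>lborel)"
      by (rule nn_integral_mono) (rule slice)
    also have "\<dots> = 2 ^ DIM('a) * I * emeasure lborel V"
      by (simp add: nn_integral_cmult)
    finally show ?thesis .
  qed
  have "emeasure lborel B * (\<integral>\<^sup>+x\<in>V. w x \<partial>lborel) = (\<integral>\<^sup>+x. emeasure lborel B * (w x * indicator V x) \<partial>lborel)"
    by (rule nn_integral_cmult[symmetric]) measurable
  also have "\<dots> = (\<integral>\<^sup>+x. (\<integral>\<^sup>+y. w x * indicator V x * indicator B y \<partial>lborel) \<partial>lborel)"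
    by (intro nn_integral_cong, subst nn_integral_cmult_indicator) (simp_all add: mult_ac)
  also have "\<dots> \<le> (\<integral>\<^sup>+x. (\<integral>\<^sup>+y. (w y * indicator B y) * indicator V x + M * (\<integral>\<^sup>+s. F x y s \<partial>lborel) \<partial>lborel) \<partial>lborel)"
  proof (intro nn_integral_mono)
    fix x y
    show "w x * indicator V x * indicator B y \<le> (w y * indicator B y) * indicator V x + M * (\<integral>\<^sup>+s. F x y s \<partial>lborel)"
    proof (cases "x \<in> V \<and> y \<in> B")
      case True
      then have "x \<in> V" "y \<in> V" using BV by auto
      from le[OF this] True \<open>y \<in> V\<close> show ?thesis by (simp add: F_def)
    qed auto
  qed
  also have "\<dots> = (\<integral>\<^sup>+x. (\<integral>\<^sup>+y. (w y * indicator B y) \<partial>lborel) * indicator V x + M * (\<integral>\<^sup>+y. (\<integral>\<^sup>+s. F x y s \<partial>lborel) \<partial>lborel) \<partial>lborel)"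
  proof (rule nn_integral_cong)
    fix x
    show "(\<integral>\<^sup>+y. (w y * indicator B y) * indicator V x + M * (\<integral>\<^sup>+s. F x y s \<partial>lborel) \<partial>lborel)
      = (\<integral>\<^sup>+y. (w y * indicator B y) \<partial>lborel) * indicator V x + M * (\<integral>\<^sup>+y. (\<integral>\<^sup>+s. F x y s \<partial>lborel) \<partial>lborel)"
      unfolding F_def by (subst nn_integral_add) (auto simp: nn_integral_cmult nn_integral_multc)
  qed
  also have "\<dots> = (\<integral>\<^sup>+y\<in>B. w y \<partial>lborel) * emeasure lborel V + M * (\<integral>\<^sup>+x. (\<integral>\<^sup>+y. (\<integral>\<^sup>+s. F x y s \<partial>lborel) \<partial>lborel) \<partial>lborel)"
    unfolding F_def by (subst nn_integral_add) (auto simp: nn_integral_cmult nn_integral_multc)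
  also have "\<dots> \<le> (\<integral>\<^sup>+y\<in>B. w y \<partial>lborel) * emeasure lborel V + M * (2 ^ DIM('a) * I * emeasure lborel V)"
    by (intro add_left_mono mult_left_mono triple) auto
  also have "\<dots> = emeasure lborel V * ((\<integral>\<^sup>+y\<in>B. w y \<partial>lborel) + M * 2 ^ DIM('a) * I)"
    by (simp add: algebra_simps)
  finally show ?thesis by (simp add: I_def)
qed

section \<open>The estimate near the Dirichlet part\<close>

lemma powr_lipschitz_swap:
  fixes a b L q :: real
  assumes "b > 0" "L > 0" "b \<le> L * a" "q \<ge> 0"
  shows "a powr (- q) \<le> L powr q * b powr (- q)"
proof -
  have "a powr (- q) \<le> (b / L) powr (- q)"
    using assms by (intro powr_mono2') (auto simp: field_simps)
  also have "\<dots> = L powr q * b powr (- q)"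
    using assms by (simp add: powr_divide powr_minus field_simps)
  finally show ?thesis .
qed

text \<open>The hypotheses describe a chart abstractly, so that they fit the identity on a ball as
  well as a boundary chart: segments from V to the image of D stay in V except possibly at their end
  in that image, and \<open>front\<close> says that boundary points met along them belong to D. The
  averaging takes place in the chart, with nets transported from D; both integrals are then carried
  back by the one-sided change of variables, which gives the two factors M.\<close>

lemma local_hardy:
  fixes \<Omega> D U V :: "(real ^ 'n) set" and \<phi> \<psi> :: "real ^ 'n \<Rightarrow> real ^ 'n"
  assumes p: "p > 1" and AD: "ahlfors_david D" and D: "compact D" and \<Omega>: "open \<Omega>" "bounded \<Omega>" "D \<inter> \<Omega> = {}"
    and U: "open U" and z0: "z0 \<in> D" "z0 \<in> U" and V: "V \<in> sets borel" "bounded V" and L: "L \<ge> 1"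
    and \<phi>: "L-lipschitz_on U \<phi>" and \<psi>: "L-lipschitz_on (V \<union> \<phi> ` (D \<inter> U)) \<psi>"
    and \<psi>\<phi>: "\<And>x. x \<in> U \<Longrightarrow> \<psi> (\<phi> x) = x" and \<phi>\<psi>: "\<And>y. y \<in> V \<Longrightarrow> \<psi> y \<in> U \<and> \<phi> (\<psi> y) = y"
    and sub: "\<And>x. x \<in> U \<Longrightarrow> x \<in> \<Omega> \<Longrightarrow> \<phi> x \<in> V"
    and star: "\<And>x z s. x \<in> V \<Longrightarrow> z \<in> \<phi> ` (D \<inter> U) \<Longrightarrow> 0 < s \<Longrightarrow> s \<le> 1 \<Longrightarrow> z + s *\<^sub>R (x - z) \<in> V"
    and front: "\<And>y. y \<in> V \<Longrightarrow> \<psi> y \<in> frontier \<Omega> \<Longrightarrow> \<psi> y \<in> D"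
  shows "\<exists>\<epsilon>>0. hardy_on p \<Omega> D (\<Omega> \<inter> ball z0 \<epsilon>)"
proof -
  define m where "m = CARD('n) - 1"
  have Dne: "D \<noteq> {}" and Dcl: "closed D" using z0 D compact_imp_closed by auto
  obtain c C r1 where net: "c > 0" "C \<ge> 0" "r1 > 0"
    "\<And>\<eta>. 0 < \<eta> \<Longrightarrow> \<eta> \<le> r1 \<Longrightarrow> \<exists>Z. regular_net D c C r1 \<eta> Z"
    using ahlfors_david_net[OF AD D] by blast
  obtain \<epsilon>0 where \<epsilon>0: "\<epsilon>0 > 0" "ball z0 \<epsilon>0 \<subseteq> U" using U z0(2) open_contains_ball by metis
  \<comment> \<open>A point of D nearest to a point of W is within 2 \<epsilon> of z0, and the net
    points counted around it are within 4 \<epsilon>, hence in U. The bound r1 keeps the lower count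
    available.\<close>
  define \<epsilon> where "\<epsilon> = min (\<epsilon>0 / 4) r1"
  have \<epsilon>: "\<epsilon> > 0" "\<epsilon> \<le> r1" "4 * \<epsilon> \<le> \<epsilon>0" using \<epsilon>0 net by (auto simp: \<epsilon>_def)
  define W where "W = \<Omega> \<inter> ball z0 \<epsilon>"
  have inU: "x \<in> U" if "dist z0 x < 4 * \<epsilon>" for x using that \<epsilon>0(2) \<epsilon>(3) by auto
  have WU: "W \<subseteq> U" using inU \<epsilon> by (auto simp: W_def)
  define D' where "D' = \<phi> ` (D \<inter> U)"
  have D'ne: "D' \<noteq> {}" using z0 by (auto simp: D'_def)
  have L0: "L > 0" using L by simp
  have \<psi>V: "continuous_on V \<psi>"
    using lipschitz_on_continuous_on[OF \<psi>] by (rule continuous_on_subset) auto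
  have \<psi>d: "dist (\<psi> y) (\<psi> y') \<le> L * dist y y'" if "y \<in> V \<union> D'" "y' \<in> V \<union> D'" for y y'
    using lipschitz_onD[OF \<psi>] that by (simp add: D'_def)
  have \<phi>d: "dist (\<phi> x) (\<phi> x') \<le> L * dist x x'" if "x \<in> U" "x' \<in> U" for x x'
    using lipschitz_onD[OF \<phi>] that by simp
  have near1: "infdist (\<psi> y) D \<le> L * infdist y D'" if y: "y \<in> V" for y
  proof (rule infdist_lipschitz_le[OF _ D'ne])
    fix z' assume z': "z' \<in> D'"
    then obtain z where "z \<in> D" "z \<in> U" "z' = \<phi> z" by (auto simp: D'_def)
    then show "\<exists>z\<in>D. dist (\<psi> y) z \<le> L * dist y z'"
      using \<psi>d[of y z'] y z' \<psi>\<phi> by (intro bexI[of _ z]) auto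
  qed (use L in auto)
  have dpos: "infdist x D > 0" if "x \<in> \<Omega>" for x
    using that \<Omega>(3) infdist_pos_not_in_closed[OF Dcl Dne, of x] by auto
  have closest: "\<exists>x0\<in>D. x0 \<in> U \<and> dist x x0 = infdist x D \<and> infdist x D < \<epsilon> \<and> dist z0 x0 < 2 * \<epsilon>" if x: "x \<in> W" for x
  proof -
    obtain x0 where x0: "x0 \<in> D" "infdist x D = dist x x0" using infdist_attains_inf[OF Dcl Dne] by metis
    have "infdist x D < \<epsilon>" using infdist_le[OF z0(1), of x] x by (simp add: W_def dist_commute)
    moreover from this have "dist z0 x0 < 2 * \<epsilon>"
      using dist_triangle[of z0 x0 x] x x0 by (simp add: W_def)
    ultimately show ?thesis using x0 inU[of x0] \<epsilon> by (intro bexI[of _ x0]) auto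
  qed
  \<comment> \<open>Unlike \<open>near1\<close>, this is restricted to W: the nearest point of D has
    to lie in U for its image to be in D'.\<close>
  have near2: "infdist (\<phi> x) D' \<le> L * infdist x D" if x: "x \<in> W" for x
  proof -
    obtain x0 where x0: "x0 \<in> D" "x0 \<in> U" "dist x x0 = infdist x D" using closest[OF x] by auto
    have "infdist (\<phi> x) D' \<le> dist (\<phi> x) (\<phi> x0)" using x0 by (intro infdist_le) (auto simp: D'_def)
    also have "\<dots> \<le> L * infdist x D" using \<phi>d[of x x0] x0 WU x by auto
    finally show ?thesis .
  qed
  define W' where "W' = {y\<in>V. \<psi> y \<in> W}"
  define V' where "V' = {y\<in>V. \<psi> y \<in> \<Omega>}"
  have W'm: "W' \<in> sets borel" and V'm: "V' \<in> sets borel"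
    unfolding W'_def V'_def W_def by (intro borel_preimage_on \<psi>V V(1) \<Omega>(1) open_Int open_ball)+
  have bWm: "W \<in> sets borel" using \<Omega>(1) by (auto simp: W_def)
  \<comment> \<open>The net points counted are within twice the distance from x to D of the nearest
    point, so within three times that distance of x. One factor L comes from \<phi>, the other from
    returning to the distance in the chart.\<close>
  define A where "A = 3 * L\<^sup>2"
  \<comment> \<open>A ball of radius r in the chart pulls back into one of radius L r, and the scale
    e of the chart is served by a net of mesh e / L.\<close>
  define C' where "C' = C * (L\<^sup>2) ^ m"
  define K where "K = hardy_const m p c C' A L"
  have K0: "K \<ge> 0" unfolding K_def using p net L by (intro hardy_const_nonneg) (auto simp: C'_def)
  define M where "M = (2 * L * CARD('n)) ^ CARD('n)"
  have M0: "M \<ge> 0" using L by (simp add: M_def)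
  have D'm: "(\<lambda>y. infdist y D') \<in> borel_measurable borel" and Dm: "(\<lambda>y. infdist y D) \<in> borel_measurable borel"
    by (auto intro!: borel_measurable_continuous_onI continuous_intros)
  have main: "weighted_int D (- p) v W
      \<le> ennreal (L powr p * M * K * L powr (p - 1) * M) * weighted_int D (1 - p) g \<Omega>"
    if vg: "hardy_pair D v g" for v g
  proof -
    have sb: "slope_bound v g" using vg by (simp add: hardy_pair_def)
    have v0: "v x \<ge> 0" and g0: "g x \<ge> 0" for x using sb by (auto simp: slope_bound_def)
    have vm: "v \<in> borel_measurable borel" and gm: "g \<in> borel_measurable borel"
      using sb slope_bound_continuous[OF sb] by (auto simp: slope_bound_def intro!: borel_measurable_continuous_onI)
    obtain \<eta>0 where \<eta>0: "\<eta>0 > 0" "\<And>x. infdist x D < \<eta>0 \<Longrightarrow> v x = 0 \<and> g x = 0"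
      using vg by (auto simp: hardy_pair_def)
    \<comment> \<open>The comparison \<open>near1\<close> loses a factor L, so both functions
      composed with \<psi> vanish at distances below e from D'.\<close>
    define e where "e = min (\<eta>0 / L) r1"
    have e: "e > 0" "e \<le> r1" "L * e \<le> \<eta>0" using \<eta>0 net L by (auto simp: e_def min_def field_simps)
    \<comment> \<open>Distance e to D' may correspond to a distance as small as e / L to D, and the
      lower count applies only from the mesh of the net upwards.\<close>
    define h where "h = e / L"
    have h: "h > 0" "h \<le> r1" "L * h = e"
      using e L by (auto simp: h_def field_simps intro: order_trans[of _ "1 * r1"] mult_mono)
    obtain Z0 where Z0: "regular_net D c C r1 h Z0" using net(4)[OF h(1,2)] by auto
    then have Z0f: "finite Z0" "Z0 \<subseteq> D"
      and lowerZ: "\<And>x r. x \<in> D \<Longrightarrow> h \<le> r \<Longrightarrow> r \<le> r1 \<Longrightarrow> c * (r / h) ^ m \<le> real (card {z\<in>Z0. dist x z < 2 * r})"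
      and upperZ: "\<And>y r. h \<le> r \<Longrightarrow> real (card {z\<in>Z0. dist y z \<le> r}) \<le> C * (r / h) ^ m"
      by (auto simp: regular_net_def m_def)
    define Z where "Z = \<phi> ` (Z0 \<inter> U)"
    have Z: "finite Z" "Z \<subseteq> D'" using Z0f by (auto simp: Z_def D'_def)
    \<comment> \<open>Only the parts of segments inside \<Omega> are charged: \<psi> may map points
      of V outside \<Omega>, where the right-hand side gives no control of g.\<close>
    define G where "G y = (if y \<in> V then (ennreal (g (\<psi> y)) * indicator \<Omega> (\<psi> y)) else 0)" for y
    have Gm: "G \<in> borel_measurable borel"
      unfolding G_def
      by (rule measurable_on_if[OF \<psi>V V(1), of "\<lambda>x. ennreal (g x) * indicator \<Omega> x"]) (use gm borel_open[OF \<Omega>(1)] in measurable)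
    let ?I = "(\<integral>\<^sup>+y\<in>W'. ennreal (v (\<psi> y) * infdist y D' powr (- p)) \<partial>lborel)" and ?J = "(\<integral>\<^sup>+y\<in>V. (G y * ennreal (infdist y D' powr (1 - p))) \<partial>lborel)"
    have small: "infdist (\<psi> y) D < \<eta>0" if "y \<in> V" "infdist y D' < e" for y
    proof -
      have "infdist (\<psi> y) D \<le> L * infdist y D'" by (rule near1[OF that(1)])
      also have "\<dots> < L * e" using that L0 by simp
      finally show ?thesis using e by simp
    qed
    have core: "?I
      \<le> ennreal (hardy_const (DIM(real^'n) - 1) p c C' A L) * ?J"
    proof (rule hardy_core[where Z = Z and \<eta> = e])
      show "p > 1" "c > 0" "L \<ge> 0" "e > 0" using p net L e by auto
      show "C' \<ge> 0" using net by (simp add: C'_def)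
      show "A > 0" using L by (simp add: A_def)
      show "V \<in> sets borel" "W' \<in> sets borel" "W' \<subseteq> V" "G \<in> borel_measurable borel" "finite Z" "Z \<subseteq> D'"
        using V W'm Gm Z by (auto simp: W'_def)
      show "0 \<le> v (\<psi> y)" for y by (rule v0)
      show "v (\<psi> y) = 0" if "y \<in> W'" "infdist y D' < e" for y
        using small[of y] that \<eta>0(2) by (auto simp: W'_def)
      show "G y = 0" if "y \<in> V" "infdist y D' < e" for y
        using small[of y] that \<eta>0(2) by (auto simp: G_def)
    next
      fix y assume y: "y \<in> W'" and ey: "e \<le> infdist y D'"
      define x where "x = \<psi> y"
      have x: "x \<in> W" "x \<in> U" "\<phi> x = y" using y WU \<phi>\<psi> by (auto simp: W'_def x_def)
      obtain x0 where x0: "x0 \<in> D" "dist x x0 = infdist x D" "infdist x D < \<epsilon>" "dist z0 x0 < 2 * \<epsilon>"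
        using closest[OF x(1)] by auto
      have dy: "infdist y D' \<le> L * infdist x D" using near2[OF x(1)] x by simp
      have dx: "infdist x D \<le> L * infdist y D'" using near1[of y] y by (simp add: W'_def x_def)
      have hx: "h \<le> infdist x D"
      proof -
        have "L * h \<le> L * infdist x D" using ey dy h by linarith
        then show ?thesis using L0 by simp
      qed
      have "c * (infdist y D' / e) ^ m \<le> c * (infdist x D / h) ^ m"
      proof -
        have "infdist y D' / e \<le> L * infdist x D / (L * h)" using dy e h(3) by (auto intro: divide_right_mono)
        also have "\<dots> = infdist x D / h" using L0 by simp
        finally show ?thesis
          using net e by (intro mult_left_mono power_mono) (auto simp: infdist_nonneg)
      qed
      also have "\<dots> \<le> real (card {z\<in>Z0. dist x0 z < 2 * infdist x D})"
        using x0 hx \<epsilon> by (intro lowerZ) auto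
      also have "\<dots> \<le> real (card {z\<in>Z. dist y z \<le> A * infdist y D'})"
      proof -
        have "card {z\<in>Z0. dist x0 z < 2 * infdist x D} \<le> card {z\<in>Z. dist y z \<le> A * infdist y D'}"
        proof (rule card_inj_on_le[of \<phi>])
          have zU: "z \<in> U" if "dist x0 z < 2 * infdist x D" for z
            using dist_triangle[of z0 z x0] that x0 by (intro inU) linarith
          show "inj_on \<phi> {z \<in> Z0. dist x0 z < 2 * infdist x D}"
            by (rule inj_on_inverseI[of _ \<psi>]) (use zU \<psi>\<phi> in auto)
          show "\<phi> ` {z \<in> Z0. dist x0 z < 2 * infdist x D} \<subseteq> {z \<in> Z. dist y z \<le> A * infdist y D'}"
          proof (rule image_subsetI)
            fix z assume z: "z \<in> {z \<in> Z0. dist x0 z < 2 * infdist x D}"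
            have "dist y (\<phi> z) \<le> L * dist x z" using \<phi>d[of x z] x zU z by auto
            also have "\<dots> \<le> L * (3 * infdist x D)"
              using dist_triangle[of x z x0] z x0 L0 by (intro mult_left_mono) auto
            also have "\<dots> \<le> L * (3 * (L * infdist y D'))" using dx L0 by (intro mult_left_mono) auto
            also have "\<dots> = A * infdist y D'" by (simp add: A_def power2_eq_square)
            finally show "\<phi> z \<in> {z \<in> Z. dist y z \<le> A * infdist y D'}" using z zU by (auto simp: Z_def)
          qed
        qed (use Z in auto)
        then show ?thesis by simp
      qed
      finally show "c * (infdist y D' / e) ^ (DIM(real^'n) - 1) \<le> real (card {z\<in>Z. dist y z \<le> A * infdist y D'})"
        by (simp add: m_def)
    next
      fix y r assume y: "y \<in> V" "e \<le> infdist y D'" "infdist y D' \<le> r"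
      have "card {z\<in>Z. dist y z \<le> r} \<le> card (\<phi> ` {z\<in>Z0 \<inter> U. dist (\<psi> y) z \<le> L * r})"
      proof (rule card_mono)
        show "{z\<in>Z. dist y z \<le> r} \<subseteq> \<phi> ` {z\<in>Z0 \<inter> U. dist (\<psi> y) z \<le> L * r}"
        proof
          fix z' assume z': "z' \<in> {z\<in>Z. dist y z \<le> r}"
          then obtain z where z: "z \<in> Z0" "z \<in> U" "z' = \<phi> z" by (auto simp: Z_def)
          have "dist (\<psi> y) z \<le> L * dist y z'"
            using \<psi>d[of y z'] y z' z \<psi>\<phi> Z by auto
          also have "\<dots> \<le> L * r" using z' L0 by auto
          finally show "z' \<in> \<phi> ` {z\<in>Z0 \<inter> U. dist (\<psi> y) z \<le> L * r}" using z by auto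
        qed
      qed (use Z0f in auto)
      also have "\<dots> \<le> card {z\<in>Z0 \<inter> U. dist (\<psi> y) z \<le> L * r}"
        by (rule card_image_le) (use Z0f in auto)
      also have "\<dots> \<le> card {z\<in>Z0. dist (\<psi> y) z \<le> L * r}"
        by (rule card_mono) (use Z0f in auto)
      finally have "real (card {z\<in>Z. dist y z \<le> r}) \<le> real (card {z\<in>Z0. dist (\<psi> y) z \<le> L * r})" by simp
      also have "\<dots> \<le> C * (L * r / h) ^ m"
      proof (rule upperZ)
        have "h \<le> L * h" using mult_right_mono[of 1 L h] L h(1) by simp
        also have "\<dots> \<le> 1 * r" using h y by simp
        also have "\<dots> \<le> L * r" using L y e by (intro mult_right_mono) auto
        finally show "h \<le> L * r" .
      qed
      also have "L * r / h = L\<^sup>2 * (r / e)"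
        using L0 h(1) by (simp add: h(3)[symmetric] power2_eq_square field_simps)
      also have "(L\<^sup>2 * (r / e)) ^ m = (L\<^sup>2) ^ m * (r / e) ^ m" by (rule power_mult_distrib)
      finally have "real (card {z\<in>Z. dist y z \<le> r}) \<le> C' * (r / e) ^ m"
        by (simp only: C'_def mult.assoc)
      then show "real (card {z\<in>Z. dist y z \<le> r}) \<le> C' * (r / e) ^ (DIM(real^'n) - 1)"
        by (simp add: m_def)
    next
      fix x z :: "real^'n" and s :: real assume "x \<in> W'" "z \<in> Z" "0 < s" "s \<le> 1"
      then show "z + s *\<^sub>R (x - z) \<in> V" using star[of x z s] Z by (auto simp: W'_def D'_def)
    next
      fix x z assume x: "x \<in> W'" and z: "z \<in> Z"
      have xV: "x \<in> V" "\<psi> x \<in> \<Omega>" using x by (auto simp: W'_def W_def)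
      have zD: "z \<in> D'" using z Z by auto
      then obtain z1 where z1: "z1 \<in> D" "z1 \<in> U" "z = \<phi> z1" by (auto simp: D'_def)
      define \<gamma> where "\<gamma> t = \<psi> (z + t *\<^sub>R (x - z))" for t
      have inV: "z + t *\<^sub>R (x - z) \<in> V" if "0 < t" "t \<le> 1" for t
        using star[of x z t] xV zD that by (auto simp: D'_def)
      have "ennreal (v (\<gamma> 1)) \<le> ennreal (L * dist x z) * (\<integral>\<^sup>+t\<in>{0..1}. (if 0 < t \<and> \<gamma> t \<in> \<Omega> then ennreal (g (\<gamma> t)) else 0) \<partial>lborel)"
      proof (rule hardy_pair_exit[OF vg _ \<Omega>(1)])
        show "(L * dist x z)-lipschitz_on {0..1} \<gamma>"
        proof (rule lipschitz_onI)
          fix s t :: real assume st: "s \<in> {0..1}" "t \<in> {0..1}"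
          \<comment> \<open>At t = 0 the segment is at z, which lies in D' but possibly outside
            V.\<close>
          have mem: "z + t *\<^sub>R (x - z) \<in> V \<union> D'" if "t \<in> {0..1}" for t
            using inV[of t] that zD by (cases "t = 0") auto
          have "dist (\<gamma> s) (\<gamma> t) \<le> L * dist (z + s *\<^sub>R (x - z)) (z + t *\<^sub>R (x - z))"
            unfolding \<gamma>_def by (intro \<psi>d mem st)
          also have "dist (z + s *\<^sub>R (x - z)) (z + t *\<^sub>R (x - z)) = dist s t * dist x z"
            by (simp add: dist_norm scaleR_diff_left[symmetric])
          finally show "dist (\<gamma> s) (\<gamma> t) \<le> L * dist x z * dist s t" by (simp add: mult_ac)
        qed (use L0 in auto)
        show "\<gamma> 1 \<in> \<Omega>" using xV by (simp add: \<gamma>_def)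
        show "\<gamma> 0 \<in> D - \<Omega>" using z1 \<psi>\<phi> \<Omega>(3) by (auto simp: \<gamma>_def)
        show "\<gamma> t \<in> D" if "0 < t" "t \<le> 1" "\<gamma> t \<in> frontier \<Omega>" for t
          using front[OF inV[OF that(1,2)]] that(3) by (simp add: \<gamma>_def)
      qed
      also have "\<dots> \<le> ennreal (L * dist x z) * (\<integral>\<^sup>+s\<in>{0..1}. G (z + s *\<^sub>R (x - z)) \<partial>lborel)"
        using inV by (intro mult_left_mono nn_integral_mono) (auto simp: indicator_def G_def \<gamma>_def)
      finally show "ennreal (v (\<psi> x)) \<le> ennreal (L * dist x z) * (\<integral>\<^sup>+s\<in>{0..1}. G (z + s *\<^sub>R (x - z)) \<partial>lborel)"
        by (simp add: \<gamma>_def)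
    qed
    define H where "H y = (if y \<in> V then ennreal (v (\<psi> y)) else 0) * ennreal (infdist y D' powr (- p))" for y
    have Hm: "H \<in> borel_measurable borel"
      unfolding H_def using measurable_on_if[OF \<psi>V V(1), of "\<lambda>x. ennreal (v x)"] vm D'm by measurable
    have "weighted_int D (- p) v W \<le> (\<integral>\<^sup>+x\<in>W. (ennreal (L powr p) * H (\<phi> x)) \<partial>lborel)"
    proof (intro nn_integral_mono)
      fix x
      have "ennreal (v x * infdist x D powr (- p)) \<le> ennreal (L powr p) * H (\<phi> x)" if x: "x \<in> W"
      proof -
        have xx: "x \<in> U" "\<phi> x \<in> V" "\<psi> (\<phi> x) = x" "x \<in> \<Omega>"
          using x WU sub \<psi>\<phi> by (auto simp: W_def)
        have "infdist (\<phi> x) D' > 0"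
          using near1[OF xx(2)] dpos[OF xx(4)] L0 by (simp add: xx) (metis infdist_nonneg less_le mult_zero_right not_le)
        then have "infdist x D powr (- p) \<le> L powr p * infdist (\<phi> x) D' powr (- p)"
          using near2[OF x] L0 p by (intro powr_lipschitz_swap) auto
        then have "v x * infdist x D powr (- p) \<le> L powr p * (v x * infdist (\<phi> x) D' powr (- p))"
          using v0[of x] mult_left_mono by (fastforce simp: mult.left_commute)
        then have "ennreal (v x * infdist x D powr (- p)) \<le> ennreal (L powr p * (v x * infdist (\<phi> x) D' powr (- p)))"
          by (rule ennreal_leI)
        also have "\<dots> = ennreal (L powr p) * H (\<phi> x)"
          using v0[of x] xx by (simp add: H_def ennreal_mult)
        finally show ?thesis .
      qed
      then show "ennreal (v x * infdist x D powr (- p)) * indicator W x \<le> ennreal (L powr p) * H (\<phi> x) * indicator W x"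
        by (auto simp: indicator_def)
    qed
    also have "\<dots> \<le> ennreal M * (\<integral>\<^sup>+y\<in>W'. (ennreal (L powr p) * H y) \<partial>lborel)"
      unfolding M_def
    proof (rule order_trans[OF nn_integral_expanding_le[where T = \<phi> and S = W and L = L and V = W' and h = "\<lambda>y. ennreal (L powr p) * H y"]])
      show "continuous_on W \<phi>" using lipschitz_on_continuous_on[OF \<phi>] WU by (rule continuous_on_subset)
      have imW: "\<phi> ` W \<subseteq> W'" using WU sub \<psi>\<phi> by (auto simp: W'_def W_def)
      then show "bounded (\<phi> ` W)" "\<phi> ` W \<subseteq> W'" using V(2) by (auto simp: W'_def intro: bounded_subset)
      show "dist x y \<le> L * dist (\<phi> x) (\<phi> y)" if "x \<in> W" "y \<in> W" for x y
        using \<psi>d[of "\<phi> x" "\<phi> y"] that imW \<psi>\<phi> WU by (auto simp: W'_def image_subset_iff subset_iff)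
    qed (use L0 bWm W'm Hm in auto)
    also have "(\<integral>\<^sup>+y\<in>W'. (ennreal (L powr p) * H y) \<partial>lborel) = ennreal (L powr p) * ?I"
    proof -
      have "(\<integral>\<^sup>+y\<in>W'. (ennreal (L powr p) * H y) \<partial>lborel) = (\<integral>\<^sup>+y. ennreal (L powr p) * (H y * indicator W' y) \<partial>lborel)"
        by (simp add: mult.assoc)
      also have "\<dots> = ennreal (L powr p) * (\<integral>\<^sup>+y. H y * indicator W' y \<partial>lborel)"
        by (rule nn_integral_cmult) (use Hm W'm in \<open>auto intro!: borel_indicator_intros\<close>)
      also have "(\<integral>\<^sup>+y. H y * indicator W' y \<partial>lborel) = ?I"
        using v0 by (intro nn_integral_cong) (auto simp: indicator_def H_def W'_def ennreal_mult)
      finally show ?thesis .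
    qed
    finally have s1: "weighted_int D (- p) v W \<le> ennreal M * (ennreal (L powr p) * ?I)" .
    have s2: "?I
        \<le> ennreal K * ?J"
      using core by (simp add: K_def m_def)
    have "?J
        \<le> (\<integral>\<^sup>+y\<in>V'. ennreal (L powr (p - 1) * (g (\<psi> y) * infdist (\<psi> y) D powr (1 - p))) \<partial>lborel)"
    proof (intro nn_integral_mono)
      fix y
      have "ennreal (g (\<psi> y)) * ennreal (infdist y D' powr (1 - p)) \<le> ennreal (L powr (p - 1) * (g (\<psi> y) * infdist (\<psi> y) D powr (1 - p)))"
        if y: "y \<in> V'"
      proof -
        have yy: "y \<in> V" "\<psi> y \<in> \<Omega>" using y by (auto simp: V'_def)
        have "infdist y D' powr (- (p - 1)) \<le> L powr (p - 1) * infdist (\<psi> y) D powr (- (p - 1))"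
          using near1[OF yy(1)] dpos[OF yy(2)] L0 p by (intro powr_lipschitz_swap) auto
        then have "g (\<psi> y) * infdist y D' powr (1 - p) \<le> L powr (p - 1) * (g (\<psi> y) * infdist (\<psi> y) D powr (1 - p))"
          using g0[of "\<psi> y"] mult_left_mono by (fastforce simp: mult.left_commute)
        then have "ennreal (g (\<psi> y) * infdist y D' powr (1 - p)) \<le> ennreal (L powr (p - 1) * (g (\<psi> y) * infdist (\<psi> y) D powr (1 - p)))"
          by (rule ennreal_leI)
        then show ?thesis using g0 by (simp add: ennreal_mult)
      qed
      then show "G y * ennreal (infdist y D' powr (1 - p)) * indicator V y
        \<le> ennreal (L powr (p - 1) * (g (\<psi> y) * infdist (\<psi> y) D powr (1 - p))) * indicator V' y"
        by (auto simp: indicator_def G_def V'_def)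
    qed
    also have "\<dots> \<le> ennreal M * (\<integral>\<^sup>+x\<in>\<Omega>. ennreal (L powr (p - 1) * (g x * infdist x D powr (1 - p))) \<partial>lborel)"
      unfolding M_def
    proof (rule order_trans[OF nn_integral_expanding_le[where T = \<psi> and S = V' and L = L and V = \<Omega> and h = "\<lambda>x. ennreal (L powr (p - 1) * (g x * infdist x D powr (1 - p)))"]])
      show "continuous_on V' \<psi>" using \<psi>V by (rule continuous_on_subset) (auto simp: V'_def)
      show "bounded (\<psi> ` V')" "\<psi> ` V' \<subseteq> \<Omega>" using \<Omega>(2) by (auto simp: V'_def intro: bounded_subset)
      show "dist x y \<le> L * dist (\<psi> x) (\<psi> y)" if "x \<in> V'" "y \<in> V'" for x y
        using \<phi>d[of "\<psi> x" "\<psi> y"] that \<phi>\<psi> by (auto simp: V'_def)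
    qed (use L0 V'm gm Dm \<Omega>(1) in \<open>auto\<close>)
    also have "(\<integral>\<^sup>+x\<in>\<Omega>. ennreal (L powr (p - 1) * (g x * infdist x D powr (1 - p))) \<partial>lborel)
        = ennreal (L powr (p - 1)) * weighted_int D (1 - p) g \<Omega>"
    proof -
      have "(\<integral>\<^sup>+x\<in>\<Omega>. ennreal (L powr (p - 1) * (g x * infdist x D powr (1 - p))) \<partial>lborel)
         = (\<integral>\<^sup>+x. ennreal (L powr (p - 1)) * (ennreal (g x * infdist x D powr (1 - p)) * indicator \<Omega> x) \<partial>lborel)"
        using g0 by (simp add: ennreal_mult mult.assoc)
      also have "\<dots> = ennreal (L powr (p - 1)) * weighted_int D (1 - p) g \<Omega>"
        by (rule nn_integral_cmult) (use gm Dm \<Omega>(1) in \<open>auto intro!: borel_indicator_intros\<close>)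
      finally show ?thesis .
    qed
    finally have s3: "?J \<le> ennreal M * (ennreal (L powr (p - 1)) * weighted_int D (1 - p) g \<Omega>)" .
    have "?I \<le> ennreal K * (ennreal M * (ennreal (L powr (p - 1)) * weighted_int D (1 - p) g \<Omega>))"
      by (rule order_trans[OF s2 mult_left_mono[OF s3]]) simp
    then have "weighted_int D (- p) v W
        \<le> ennreal M * (ennreal (L powr p) * (ennreal K * (ennreal M * (ennreal (L powr (p - 1)) * weighted_int D (1 - p) g \<Omega>))))"
      by (intro order_trans[OF s1] mult_left_mono) simp_all
    also have "\<dots> = ennreal (L powr p * M * K * L powr (p - 1) * M) * weighted_int D (1 - p) g \<Omega>"
      using M0 K0 by (simp add: ennreal_mult mult_ac)
    finally show ?thesis .
  qed
  show ?thesis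
  proof (intro exI[of _ \<epsilon>] conjI)
    show "hardy_on p \<Omega> D (\<Omega> \<inter> ball z0 \<epsilon>)"
      unfolding hardy_on_def W_def[symmetric]
      by (rule exI[of _ "L powr p * M * K * L powr (p - 1) * M"]) (use main M0 K0 in auto)
  qed (rule \<epsilon>)
qed

section \<open>Unions and spreading of the estimate\<close>

lemma hardy_on_subset:
  assumes "hardy_on p \<Omega> D W" "W' \<subseteq> W"
  shows "hardy_on p \<Omega> D W'"
proof -
  from hardy_onE[OF assms(1)] obtain K where K: "K \<ge> 0" "\<forall>v g. hardy_pair D v g \<longrightarrow> weighted_int D (- p) v W
       \<le> ennreal K * weighted_int D (1 - p) g \<Omega>" .
  have mono: "(\<integral>\<^sup>+x\<in>W'. f x \<partial>lborel) \<le> (\<integral>\<^sup>+x\<in>W. f x \<partial>lborel)" for f :: "'a \<Rightarrow> ennreal"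
    using assms(2) by (intro nn_integral_mono) (auto simp: indicator_def)
  show ?thesis
    unfolding hardy_on_def using K(1) by (intro exI[of _ K]) (blast intro: order_trans[OF mono K(2)[rule_format]])
qed

lemma hardy_on_UN:
  assumes "finite I" "\<And>i. i \<in> I \<Longrightarrow> hardy_on p \<Omega> D (W i)" "\<And>i. i \<in> I \<Longrightarrow> W i \<in> sets borel"
  shows "hardy_on p \<Omega> D (\<Union>i\<in>I. W i)"
  using assms
proof (induction I rule: finite_induct)
  case empty
  show ?case unfolding hardy_on_def by (intro exI[of _ 0]) auto
next
  case (insert i I)
  have "hardy_on p \<Omega> D (W i \<union> (\<Union>i\<in>I. W i))"
    using insert by (intro hardy_on_Un sets.finite_UN) auto
  then show ?case by simp
qed

text \<open>On the image of K the distance to D is at least r, and throughout \<Omega> it is at most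
  some R, so its powers can be removed on the left and inserted on the right at the price of
  constants. What remains is the Poincare inequality on the convex set K, fed by the part of K that
  \<psi> maps into N.\<close>

lemma hardy_on_propagate:
  fixes \<Omega> D K N :: "'a::euclidean_space set" and \<phi> \<psi> :: "'a \<Rightarrow> 'a"
  assumes p: "p > 1" and D: "closed D" "D \<noteq> {}" and \<Omega>: "open \<Omega>" "bounded \<Omega>" "D \<inter> \<Omega> = {}"
    and K: "convex K" "open K" "bounded K" and L: "L > 0"
    and \<psi>: "L-lipschitz_on K \<psi>" and \<phi>: "L-lipschitz_on (\<psi> ` K) \<phi>"
    and \<phi>\<psi>: "\<And>y. y \<in> K \<Longrightarrow> \<phi> (\<psi> y) = y"
    and V: "\<psi> ` K \<subseteq> \<Omega>" "\<psi> ` K \<in> sets borel"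
    and r: "r > 0" "\<And>x. x \<in> \<psi> ` K \<Longrightarrow> r \<le> infdist x D"
    and N: "open N" "N \<subseteq> \<Omega>" "N \<inter> \<psi> ` K \<noteq> {}" "hardy_on p \<Omega> D N"
  shows "hardy_on p \<Omega> D (\<psi> ` K)"
proof -
  define V where "V = \<psi> ` K"
  have Vm: "V \<in> sets borel" "V \<subseteq> \<Omega>" using V by (auto simp: V_def)
  from hardy_onE[OF N(4)] obtain KN where KN: "KN \<ge> 0" "\<forall>v g. hardy_pair D v g \<longrightarrow> weighted_int D (- p) v N
       \<le> ennreal KN * weighted_int D (1 - p) g \<Omega>" .
  have dpos: "infdist x D > 0" if "x \<in> \<Omega>" for x
    using that \<Omega>(3) infdist_pos_not_in_closed[OF D, of x] by auto
  obtain R where R: "R > 0" "\<And>x. x \<in> \<Omega> \<Longrightarrow> infdist x D \<le> R"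
  proof -
    obtain z where z: "z \<in> D" using D by auto
    obtain R where "\<And>x. x \<in> \<Omega> \<Longrightarrow> dist z x \<le> R" using \<Omega>(2) bounded_any_center[of \<Omega> z] by auto
    then have "infdist x D \<le> \<bar>R\<bar> + 1" if "x \<in> \<Omega>" for x
      using that infdist_le[OF z, of x] by (fastforce simp: dist_commute)
    then show ?thesis by (intro that[of "\<bar>R\<bar> + 1"]) auto
  qed
  obtain \<Delta> where \<Delta>: "\<Delta> > 0" "\<And>x y. x \<in> K \<Longrightarrow> y \<in> K \<Longrightarrow> dist x y \<le> \<Delta>"
  proof -
    have "dist x y \<le> \<bar>diameter K\<bar> + 1" if "x \<in> K" "y \<in> K" for x y
      using diameter_bounded_bound[OF K(3) that] by linarith
    then show ?thesis by (intro that[of "\<bar>diameter K\<bar> + 1"]) auto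
  qed
  have c\<psi>: "continuous_on K \<psi>" using \<psi> by (rule lipschitz_on_continuous_on)
  have Km: "K \<in> sets borel" using K(2) by simp
  \<comment> \<open>Open and nonempty, hence of positive volume. The quotient of the volumes of K
    and B enters the constant, which may depend on N but not on the pair v, g.\<close>
  define B where "B = {y\<in>K. \<psi> y \<in> N}"
  have B: "open B" "B \<noteq> {}" "B \<subseteq> K"
    using continuous_open_preimage[OF c\<psi> K(2) N(1)] N(3) by (auto simp: B_def Int_def vimage_def)
  define b where "b = measure lborel B"
  define k where "k = measure lborel K"
  have fB: "emeasure lborel B < \<infinity>" and fK: "emeasure lborel K < \<infinity>"
    using emeasure_bounded_finite[OF K(3)] emeasure_bounded_finite[OF bounded_subset[OF K(3) B(3)]] by simp_all
  have eB: "emeasure lborel B = ennreal b" and eK: "emeasure lborel K = ennreal k"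
    using fB fK by (auto simp: b_def k_def emeasure_eq_ennreal_measure less_top)
  have b: "b > 0"
  proof -
    obtain y e where "e > 0" "ball y e \<subseteq> B" using B open_contains_ball by (metis ex_in_conv)
    have "0 < emeasure lborel (ball y e)"
      using \<open>e > 0\<close> by (simp add: emeasure_ball)
    also have "\<dots> \<le> emeasure lborel B"
      by (rule emeasure_mono) (use \<open>ball y e \<subseteq> B\<close> B(1) in auto)
    finally show ?thesis using eB by simp
  qed
  have k: "k \<ge> 0" by (simp add: k_def)
  define M where "M = (2 * L * DIM('a)) ^ DIM('a)"
  have M: "M \<ge> 0" using L by (simp add: M_def)
  have Dm: "(\<lambda>y. infdist y D) \<in> borel_measurable borel"
    by (auto intro!: borel_measurable_continuous_onI continuous_intros)
  let ?c = "(k / b) * (M * (R powr p * KN) + L * \<Delta> * 2 ^ DIM('a) * (M * R powr (p - 1)))"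
  define Kt where "Kt = r powr (- p) * (M * (?c))"
  have Kt: "Kt \<ge> 0" using b k M KN L \<Delta> by (simp add: Kt_def)
  have "weighted_int D (- p) v V
      \<le> ennreal Kt * weighted_int D (1 - p) g \<Omega>"
    if vg: "hardy_pair D v g" for v g
  proof -
    define J where "J = weighted_int D (1 - p) g \<Omega>"
    have sb: "slope_bound v g" using vg by (simp add: hardy_pair_def)
    have v0: "v x \<ge> 0" and g0: "g x \<ge> 0" for x using sb by (auto simp: slope_bound_def)
    have vm: "v \<in> borel_measurable borel" and gm: "g \<in> borel_measurable borel"
      using sb slope_bound_continuous[OF sb] by (auto simp: slope_bound_def intro!: borel_measurable_continuous_onI)
    define w where "w y = (if y \<in> K then ennreal (v (\<psi> y)) else 0)" for y
    define G where "G y = (if y \<in> K then ennreal (g (\<psi> y)) else 0)" for y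
    have wm: "w \<in> borel_measurable borel" and Gm: "G \<in> borel_measurable borel"
      unfolding w_def G_def
      using measurable_on_if[OF c\<psi> Km, of "\<lambda>x. ennreal (v x)"] measurable_on_if[OF c\<psi> Km, of "\<lambda>x. ennreal (g x)"] vm gm
      by auto
    have s1: "weighted_int D (- p) v V \<le> ennreal (r powr (- p)) * (\<integral>\<^sup>+x\<in>V. w (\<phi> x) \<partial>lborel)"
    proof -
      have "weighted_int D (- p) v V
          \<le> (\<integral>\<^sup>+x. ennreal (r powr (- p)) * (ennreal (v x) * indicator V x) \<partial>lborel)"
      proof (rule nn_integral_mono)
        fix x
        have "ennreal (v x * infdist x D powr (- p)) \<le> ennreal (r powr (- p)) * ennreal (v x)" if "x \<in> V"
        proof -
          have "infdist x D powr (- p) \<le> r powr (- p)"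
            using r(2)[of x] that r(1) p by (intro powr_mono2') (auto simp: V_def)
          then have "v x * infdist x D powr (- p) \<le> r powr (- p) * v x"
            using v0[of x] by (simp add: mult_left_mono mult.commute)
          then show ?thesis using v0 by (simp add: ennreal_mult[symmetric] ennreal_leI)
        qed
        then show "ennreal (v x * infdist x D powr (- p)) * indicator V x \<le> ennreal (r powr (- p)) * (ennreal (v x) * indicator V x)"
          by (auto simp: indicator_def)
      qed
      also have "\<dots> = ennreal (r powr (- p)) * (\<integral>\<^sup>+x\<in>V. ennreal (v x) \<partial>lborel)"
        by (rule nn_integral_cmult) (use vm Vm in \<open>auto intro!: borel_indicator_intros\<close>)
      also have "(\<integral>\<^sup>+x\<in>V. ennreal (v x) \<partial>lborel) = (\<integral>\<^sup>+x\<in>V. w (\<phi> x) \<partial>lborel)"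
        by (intro nn_integral_cong) (auto simp: indicator_def w_def V_def \<phi>\<psi>)
      finally show ?thesis .
    qed
    have s2: "(\<integral>\<^sup>+x\<in>V. w (\<phi> x) \<partial>lborel) \<le> ennreal M * (\<integral>\<^sup>+y\<in>K. w y \<partial>lborel)"
      unfolding M_def
    proof (rule nn_integral_expanding_le[OF _ Vm(1) _ L _ wm Km])
      show "continuous_on V \<phi>" unfolding V_def using \<phi> by (rule lipschitz_on_continuous_on)
      show "\<phi> ` V \<subseteq> K" using \<phi>\<psi> by (auto simp: V_def)
      then show "bounded (\<phi> ` V)" using K(3) by (rule bounded_subset[rotated])
      show "dist x y \<le> L * dist (\<phi> x) (\<phi> y)" if "x \<in> V" "y \<in> V" for x y
        using that lipschitz_onD[OF \<psi>] \<phi>\<psi> by (auto simp: V_def)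
    qed
    have s3: "ennreal b * (\<integral>\<^sup>+y\<in>K. w y \<partial>lborel)
      \<le> ennreal k * ((\<integral>\<^sup>+y\<in>B. w y \<partial>lborel) + ennreal (L * \<Delta>) * 2 ^ DIM('a) * (\<integral>\<^sup>+y\<in>K. G y \<partial>lborel))"
      unfolding eB[symmetric] eK[symmetric]
    proof (rule convex_poincare[OF K(1) Km _ B(3) wm Gm])
      fix x y assume xy: "x \<in> K" "y \<in> K"
      define \<gamma> where "\<gamma> t = \<psi> (y + t *\<^sub>R (x - y))" for t
      have mem: "y + t *\<^sub>R (x - y) \<in> K" if "t \<in> {0..1}" for t
      proof -
        have "y + t *\<^sub>R (x - y) = (1 - t) *\<^sub>R y + t *\<^sub>R x" by (simp add: algebra_simps)
        also have "\<dots> \<in> K" using K(1) xy that by (intro convexD) auto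
        finally show ?thesis .
      qed
      have lip: "(L * \<Delta>)-lipschitz_on {0..1} \<gamma>"
      proof (rule lipschitz_onI)
        fix s t :: real assume st: "s \<in> {0..1}" "t \<in> {0..1}"
        have "dist (\<gamma> s) (\<gamma> t) \<le> L * dist (y + s *\<^sub>R (x - y)) (y + t *\<^sub>R (x - y))"
          unfolding \<gamma>_def using lipschitz_onD[OF \<psi> mem[OF st(1)] mem[OF st(2)]] .
        also have "dist (y + s *\<^sub>R (x - y)) (y + t *\<^sub>R (x - y)) = dist s t * dist x y"
          by (simp add: dist_norm scaleR_diff_left[symmetric])
        also have "\<dots> \<le> dist s t * \<Delta>" using \<Delta>(2)[OF xy] by (intro mult_left_mono) auto
        finally show "dist (\<gamma> s) (\<gamma> t) \<le> L * \<Delta> * dist s t" using L by (simp add: mult_ac)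
      qed (use L \<Delta> in auto)
      have "w x = ennreal (v (\<gamma> 1))" "w y = ennreal (v (\<gamma> 0))" using xy by (auto simp: w_def \<gamma>_def)
      moreover have "ennreal (v (\<gamma> 1)) \<le> ennreal (v (\<gamma> 0)) + ennreal \<bar>v (\<gamma> 1) - v (\<gamma> 0)\<bar>"
        using v0 by (simp add: ennreal_plus[symmetric] del: ennreal_plus)
      moreover have "ennreal \<bar>v (\<gamma> 1) - v (\<gamma> 0)\<bar> \<le> ennreal (L * \<Delta>) * (\<integral>\<^sup>+t\<in>{0..1}. ennreal (g (\<gamma> t)) \<partial>lborel)"
        by (rule slope_bound_along_curve[OF sb lip]) simp
      moreover have "(\<integral>\<^sup>+t\<in>{0..1}. ennreal (g (\<gamma> t)) \<partial>lborel) = (\<integral>\<^sup>+s\<in>{0..1}. G (y + s *\<^sub>R (x - y)) \<partial>lborel)"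
        using mem by (intro nn_integral_cong) (auto simp: indicator_def G_def \<gamma>_def)
      ultimately show "w x \<le> w y + ennreal (L * \<Delta>) * (\<integral>\<^sup>+s\<in>{0..1}. G (y + s *\<^sub>R (x - y)) \<partial>lborel)"
        by (metis add_left_mono order_trans)
    qed (use B in auto)
    have exp\<psi>: "dist x y \<le> L * dist (\<psi> x) (\<psi> y)" if "x \<in> K" "y \<in> K" for x y
      using lipschitz_onD[OF \<phi>, of "\<psi> x" "\<psi> y"] that \<phi>\<psi> by auto
    have bd: "bounded (\<psi> ` S)" if "S \<subseteq> K" for S
      using \<Omega>(2) V(1) that by (auto intro!: bounded_subset[of \<Omega>])
    have s4: "(\<integral>\<^sup>+y\<in>B. w y \<partial>lborel) \<le> ennreal M * (ennreal (R powr p * KN) * J)"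
    proof -
      have "(\<integral>\<^sup>+y\<in>B. w y \<partial>lborel) = (\<integral>\<^sup>+y\<in>B. ennreal (v (\<psi> y)) \<partial>lborel)"
        using B(3) by (intro nn_integral_cong) (auto simp: indicator_def w_def)
      also have "\<dots> \<le> ennreal M * (\<integral>\<^sup>+x\<in>N. ennreal (v x) \<partial>lborel)"
        unfolding M_def
        by (rule nn_integral_expanding_le[where T = \<psi> and h = "\<lambda>x. ennreal (v x)"])
           (use B c\<psi> bd L exp\<psi> vm N in \<open>auto simp: B_def intro: continuous_on_subset\<close>)
      \<comment> \<open>N may come arbitrarily close to D, but the weight is only larger there: R
        powr p times the weight is at least 1 throughout \<Omega>.\<close>
      also have "\<dots> \<le> ennreal M * (\<integral>\<^sup>+x. ennreal (R powr p) * (ennreal (v x * infdist x D powr (- p)) * indicator N x) \<partial>lborel)"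
      proof (intro mult_left_mono nn_integral_mono)
        fix x
        have "ennreal (v x) \<le> ennreal (R powr p) * ennreal (v x * infdist x D powr (- p))" if "x \<in> N"
        proof -
          have "x \<in> \<Omega>" using that N(2) by auto
          then have "infdist x D powr p \<le> R powr p"
            using R p dpos[of x] by (intro powr_mono2) auto
          then have "1 \<le> R powr p * infdist x D powr (- p)"
            using dpos[OF \<open>x \<in> \<Omega>\<close>] by (simp add: powr_minus field_simps)
          then have "v x * 1 \<le> v x * (R powr p * infdist x D powr (- p))"
            using v0[of x] by (rule mult_left_mono)
          then have "ennreal (v x) \<le> ennreal (R powr p * (v x * infdist x D powr (- p)))"
            by (intro ennreal_leI) (simp add: mult_ac)
          then show ?thesis using v0[of x] by (simp add: ennreal_mult)
        qed
        then show "ennreal (v x) * indicator N x \<le> ennreal (R powr p) * (ennreal (v x * infdist x D powr (- p)) * indicator N x)"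
          by (auto simp: indicator_def)
      qed simp
      also have "(\<integral>\<^sup>+x. ennreal (R powr p) * (ennreal (v x * infdist x D powr (- p)) * indicator N x) \<partial>lborel)
          = ennreal (R powr p) * weighted_int D (- p) v N"
        by (rule nn_integral_cmult) (use vm Dm N in \<open>auto intro!: borel_indicator_intros\<close>)
      also have "ennreal M * (ennreal (R powr p) * weighted_int D (- p) v N)
          \<le> ennreal M * (ennreal (R powr p) * (ennreal KN * J))"
        unfolding J_def using KN(2)[rule_format, OF vg] by (intro mult_left_mono) auto
      finally show ?thesis using KN by (simp add: ennreal_mult mult.assoc)
    qed
    have s5: "(\<integral>\<^sup>+y\<in>K. G y \<partial>lborel) \<le> ennreal M * (ennreal (R powr (p - 1)) * J)"
    proof -
      have "(\<integral>\<^sup>+y\<in>K. G y \<partial>lborel) = (\<integral>\<^sup>+y\<in>K. ennreal (g (\<psi> y)) \<partial>lborel)"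
        by (intro nn_integral_cong) (auto simp: indicator_def G_def)
      also have "\<dots> \<le> ennreal M * (\<integral>\<^sup>+x\<in>\<Omega>. ennreal (g x) \<partial>lborel)"
        unfolding M_def
        by (rule nn_integral_expanding_le[where T = \<psi> and h = "\<lambda>x. ennreal (g x)"])
           (use c\<psi> bd L exp\<psi> gm \<Omega> V Km in auto)
      also have "\<dots> \<le> ennreal M * (\<integral>\<^sup>+x. ennreal (R powr (p - 1)) * (ennreal (g x * infdist x D powr (1 - p)) * indicator \<Omega> x) \<partial>lborel)"
      proof (intro mult_left_mono nn_integral_mono)
        fix x
        have "ennreal (g x) \<le> ennreal (R powr (p - 1)) * ennreal (g x * infdist x D powr (1 - p))" if "x \<in> \<Omega>"
        proof -
          have "infdist x D powr (p - 1) \<le> R powr (p - 1)"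
            using R that p dpos[of x] by (intro powr_mono2) auto
          then have "infdist x D powr (p - 1) * infdist x D powr (1 - p) \<le> R powr (p - 1) * infdist x D powr (1 - p)"
            by (rule mult_right_mono) simp
          moreover have "infdist x D powr (p - 1) * infdist x D powr (1 - p) = 1"
            using dpos[OF that] by (simp add: powr_add[symmetric])
          ultimately have "1 \<le> R powr (p - 1) * infdist x D powr (1 - p)" by simp
          then have "g x * 1 \<le> g x * (R powr (p - 1) * infdist x D powr (1 - p))"
            using g0[of x] by (rule mult_left_mono)
          then have "ennreal (g x) \<le> ennreal (R powr (p - 1) * (g x * infdist x D powr (1 - p)))"
            by (intro ennreal_leI) (simp add: mult_ac)
          then show ?thesis using g0[of x] by (simp add: ennreal_mult)
        qed
        then show "ennreal (g x) * indicator \<Omega> x \<le> ennreal (R powr (p - 1)) * (ennreal (g x * infdist x D powr (1 - p)) * indicator \<Omega> x)"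
          by (auto simp: indicator_def)
      qed simp
      also have "(\<integral>\<^sup>+x. ennreal (R powr (p - 1)) * (ennreal (g x * infdist x D powr (1 - p)) * indicator \<Omega> x) \<partial>lborel)
          = ennreal (R powr (p - 1)) * J"
        unfolding J_def
        by (rule nn_integral_cmult) (use gm Dm \<Omega> in \<open>auto intro!: borel_indicator_intros\<close>)
      finally show ?thesis .
    qed
    define X where "X = (\<integral>\<^sup>+y\<in>K. w y \<partial>lborel)"
    let ?S = "ennreal (1 / b) * (ennreal k * (ennreal M * (ennreal (R powr p * KN) * J) + ennreal (L * \<Delta>) * 2 ^ DIM('a) * (ennreal M * (ennreal (R powr (p - 1)) * J))))"
    have "X = ennreal (1 / b) * (ennreal b * X)"
      using b by (simp add: mult.assoc[symmetric] ennreal_mult[symmetric])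
    also have "\<dots> \<le> ennreal (1 / b) * (ennreal k * ((\<integral>\<^sup>+y\<in>B. w y \<partial>lborel) + ennreal (L * \<Delta>) * 2 ^ DIM('a) * (\<integral>\<^sup>+y\<in>K. G y \<partial>lborel)))"
      unfolding X_def by (intro mult_left_mono s3) simp
    also have "\<dots> \<le> ?S"
      by (intro mult_left_mono add_mono s4 s5) simp_all
    also have "\<dots> = ennreal (?c) * J"
    proof -
      define c1 where "c1 = M * (R powr p * KN)"
      define c2 where "c2 = L * \<Delta> * 2 ^ DIM('a) * (M * R powr (p - 1))"
      have c: "c1 \<ge> 0" "c2 \<ge> 0" using M KN L \<Delta> by (auto simp: c1_def c2_def)
      have "ennreal M * (ennreal (R powr p * KN) * J) = ennreal c1 * J"
        using M KN by (simp add: c1_def ennreal_mult mult.assoc)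
      moreover have "(2::ennreal) ^ DIM('a) = ennreal (2 ^ DIM('a))" by (simp add: ennreal_power[symmetric])
      then have "ennreal (L * \<Delta>) * 2 ^ DIM('a) * (ennreal M * (ennreal (R powr (p - 1)) * J)) = ennreal c2 * J"
        using M L \<Delta> by (simp only: c2_def) (simp add: ennreal_mult mult_ac)
      ultimately have "?S
        = ennreal (1 / b) * (ennreal k * (ennreal (c1 + c2) * J))"
        using c by (simp add: distrib_right)
      also have "\<dots> = ennreal (1 / b * (k * (c1 + c2))) * J"
        using b k c by (simp only: ennreal_mult mult.assoc zero_le_divide_1_iff less_imp_le mult_nonneg_nonneg add_nonneg_nonneg)
      also have "1 / b * (k * (c1 + c2)) = (k / b) * (c1 + c2)" by simp
      finally show ?thesis by (simp only: c1_def c2_def)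
    qed
    finally have X: "X \<le> ennreal (?c) * J" .
    have "weighted_int D (- p) v V \<le> ennreal (r powr (- p)) * (ennreal M * X)"
      by (rule order_trans[OF s1]) (use s2 in \<open>auto simp: X_def intro: mult_left_mono\<close>)
    also have "\<dots> \<le> ennreal (r powr (- p)) * (ennreal M * (ennreal (?c) * J))"
      by (intro mult_left_mono X) simp_all
    also have "\<dots> = ennreal Kt * J"
      unfolding Kt_def using M b k KN L \<Delta> by (subst ennreal_mult, simp, simp, subst ennreal_mult) (simp_all add: mult.assoc)
    finally show ?thesis by (simp add: J_def)
  qed
  with Kt show ?thesis unfolding hardy_on_def V_def by blast
qed


section \<open>Globalisation\<close>

lemma chart_points:
  assumes ch: "boundary_chart l \<Omega> x U \<phi>"
  obtains \<psi> L where "open U" "x \<in> U" "L \<ge> 1" "homeomorphism U open_cube \<phi> \<psi>"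
    "L-lipschitz_on U \<phi>" "L-lipschitz_on open_cube \<psi>" "\<phi> x = 0"
    "\<forall>z\<in>U. z \<in> \<Omega> \<longleftrightarrow> \<phi> z $ l < 0" "\<forall>z\<in>U. z \<in> frontier \<Omega> \<longleftrightarrow> \<phi> z $ l = 0"
proof -
  obtain \<psi> L1 L2 where h: "homeomorphism U open_cube \<phi> \<psi>" and L: "L1-lipschitz_on U \<phi>" "L2-lipschitz_on open_cube \<psi>"
    using ch unfolding boundary_chart_def by blast
  define L where "L = max 1 (max L1 L2)"
  have im: "\<phi> ` (U \<inter> \<Omega>) = {y \<in> open_cube. y $ l < 0}" "\<phi> ` (U \<inter> frontier \<Omega>) = {y \<in> open_cube. y $ l = 0}"
    using ch by (auto simp: boundary_chart_def)
  have inv: "\<psi> (\<phi> z) = z" "\<phi> z \<in> open_cube" if "z \<in> U" for z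
    using h that by (auto simp: homeomorphism_def)
  have inj: "inj_on \<phi> U" using inv(1) by (rule inj_on_inverseI)
  have tr: "z \<in> S \<longleftrightarrow> \<phi> z \<in> \<phi> ` (U \<inter> S)" if "z \<in> U" for z S
    using inj_on_image_mem_iff[OF inj that, of "U \<inter> S"] that by auto
  show ?thesis
  proof (rule that[OF _ _ _ h, of L])
    show "L-lipschitz_on U \<phi>" "L-lipschitz_on open_cube \<psi>"
      using L by (auto simp: L_def intro: lipschitz_on_le)
    have "(z \<in> \<Omega> \<longleftrightarrow> \<phi> z $ l < 0) \<and> (z \<in> frontier \<Omega> \<longleftrightarrow> \<phi> z $ l = 0)" if "z \<in> U" for z
      using tr[OF that, of \<Omega>] tr[OF that, of "frontier \<Omega>"] inv[OF that] im by auto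
    then show "\<forall>z\<in>U. z \<in> \<Omega> \<longleftrightarrow> \<phi> z $ l < 0" "\<forall>z\<in>U. z \<in> frontier \<Omega> \<longleftrightarrow> \<phi> z $ l = 0" by auto
  qed (use ch in \<open>auto simp: L_def boundary_chart_def\<close>)
qed

lemma open_coordinate_cube: "open {y :: real ^ 'n. \<forall>i. - \<epsilon> < y $ i \<and> y $ i < \<epsilon>}"
proof -
  have "{y :: real ^ 'n. \<forall>i. - \<epsilon> < y $ i \<and> y $ i < \<epsilon>} = (\<Inter>i\<in>UNIV. {y. y $ i > - \<epsilon>} \<inter> {y. y $ i < \<epsilon>})"
    by auto
  also have "open \<dots>"
    by (rule open_INT) (auto intro!: open_Int open_halfspace_component_gt_cart open_halfspace_component_lt_cart simp del: Int_Collect)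
  finally show ?thesis .
qed

lemma norm_coordinate_cube:
  fixes y :: "real ^ 'n" and \<epsilon> :: real
  assumes "\<And>i. - \<epsilon> < y $ i \<and> y $ i < \<epsilon>"
  shows "norm y \<le> CARD('n) * \<epsilon>"
proof -
  have "\<bar>y $ i\<bar> \<le> \<epsilon>" for i using assms[of i] by linarith
  then have "(\<Sum>i\<in>UNIV. \<bar>y $ i\<bar>) \<le> (\<Sum>i\<in>(UNIV::'n set). \<epsilon>)" by (intro sum_mono)
  with norm_le_l1_cart[of y] show ?thesis by simp
qed

lemma small_half_cube:
  fixes l :: "'n::finite" and \<epsilon> :: real
  defines "K \<equiv> {y :: real ^ 'n. (\<forall>i. - \<epsilon> < y $ i \<and> y $ i < \<epsilon>) \<and> y $ l < 0}"
  shows "convex K" "open K" "bounded K"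
proof -
  have eq: "K = (\<Inter>i\<in>UNIV. {y. - \<epsilon> < y $ i} \<inter> {y. y $ i < \<epsilon>}) \<inter> {y. y $ l < 0}"
    by (auto simp: K_def)
  have "K = {y. \<forall>i. - \<epsilon> < y $ i \<and> y $ i < \<epsilon>} \<inter> {y. y $ l < 0}" by (auto simp: K_def)
  then show "open K" by (simp only: open_Int[OF open_coordinate_cube open_halfspace_component_lt_cart])
  have "convex {y :: real ^ 'n. a < y $ i}" "convex {y :: real ^ 'n. y $ i < a}" for a i
    using convex_halfspace_gt[of a "axis i 1 :: real ^ 'n"] convex_halfspace_lt[of "axis i 1 :: real ^ 'n" a]
    by (simp_all add: inner_axis inner_axis' inner_real_def)
  then show "convex K" unfolding eq by (intro convex_INT convex_Int) auto
  have "norm y \<le> CARD('n) * \<epsilon>" if "y \<in> K" for y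
    using that by (intro norm_coordinate_cube) (auto simp: K_def)
  then show "bounded K" by (auto simp: bounded_iff)
qed

text \<open>If x is outside the closure of \<open>frontier \<Omega> - D\<close>, a small ball meets
  the boundary in D alone and the identity serves as chart. Otherwise there is a boundary chart at
  x; it sends D into the flat face, and a segment from the open half cube to that face stays in the
  half cube until its end.\<close>

lemma hardy_near_dirichlet:
  fixes \<Omega> D :: "(real ^ 'n) set"
  assumes p: "p > 1" and adm: "admissible l \<Omega> D" and x: "x \<in> D"
  shows "\<exists>T. open T \<and> x \<in> T \<and> hardy_on p \<Omega> D (T \<inter> \<Omega>)"
proof -
  have \<Omega>: "open \<Omega>" "bounded \<Omega>" and DF: "D \<subseteq> frontier \<Omega>" and Dcl: "closed D" and AD: "ahlfors_david D"
    using adm x by (auto simp: admissible_def)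
  have D\<Omega>: "D \<inter> \<Omega> = {}" using DF \<Omega>(1) by (auto simp: frontier_def interior_open)
  have "bounded D"
    using bounded_subset[OF bounded_closure[OF \<Omega>(2)]] DF by (auto simp: frontier_def)
  then have D: "compact D" using Dcl by (simp add: compact_eq_bounded_closed)
  have ex: "\<exists>\<epsilon>>0. hardy_on p \<Omega> D (\<Omega> \<inter> ball x \<epsilon>)"
  proof (cases "x \<in> closure (frontier \<Omega> - D)")
    case False
    then obtain R where R: "R > 0" "ball x R \<inter> closure (frontier \<Omega> - D) = {}"
      using open_contains_ball[of "- closure (frontier \<Omega> - D)"] by (force simp: open_Compl)
    have sub: "frontier \<Omega> \<inter> ball x R \<subseteq> D"
      using R(2) closure_subset[of "frontier \<Omega> - D"] by blast
    show ?thesis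
    proof (rule local_hardy[OF p AD D \<Omega> D\<Omega>, where U = "ball x R" and V = "ball x R" and \<phi> = "\<lambda>x. x" and \<psi> = "\<lambda>x. x" and L = 1])
      show "1-lipschitz_on (ball x R) (\<lambda>x. x)" "1-lipschitz_on (ball x R \<union> (\<lambda>x. x) ` (D \<inter> ball x R)) (\<lambda>x. x)"
        by (auto intro!: lipschitz_onI)
      fix y z :: "real^'n" and s :: real
      assume "y \<in> ball x R" "z \<in> (\<lambda>x. x) ` (D \<inter> ball x R)" "0 < s" "s \<le> 1"
      then have "(1 - s) *\<^sub>R z + s *\<^sub>R y \<in> ball x R"
        by (intro convexD[OF convex_ball]) auto
      then show "z + s *\<^sub>R (y - z) \<in> ball x R" by (simp add: algebra_simps)
    qed (use x R sub in auto)
  next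
    case True
    then obtain U \<phi> where "boundary_chart l \<Omega> x U \<phi>"
      using adm unfolding admissible_def by blast
    then obtain \<psi> L where ch: "open U" "x \<in> U" "L \<ge> 1" "homeomorphism U open_cube \<phi> \<psi>"
      "L-lipschitz_on U \<phi>" "L-lipschitz_on open_cube \<psi>" "\<phi> x = 0"
      "\<forall>z\<in>U. z \<in> \<Omega> \<longleftrightarrow> \<phi> z $ l < 0" "\<forall>z\<in>U. z \<in> frontier \<Omega> \<longleftrightarrow> \<phi> z $ l = 0"
      by (rule chart_points)
    have inv: "\<psi> (\<phi> z) = z" "\<phi> z \<in> open_cube" if "z \<in> U" for z
      using ch(4) that by (auto simp: homeomorphism_def)
    have inv': "\<phi> (\<psi> y) = y" "\<psi> y \<in> U" if "y \<in> open_cube" for y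
      using ch(4) that by (auto simp: homeomorphism_def)
    define V where "V = {y :: real^'n. (\<forall>i. - 1 < y $ i \<and> y $ i < 1) \<and> y $ l < 0}"
    have Vc: "V \<subseteq> open_cube" by (auto simp: V_def open_cube_def)
    show ?thesis
    proof (rule local_hardy[OF p AD D \<Omega> D\<Omega>, where U = U and V = V and \<phi> = \<phi> and \<psi> = \<psi> and L = L])
      show "V \<in> sets borel" "bounded V"
        using small_half_cube(2,3)[of 1 l] by (auto simp: V_def)
      show "L-lipschitz_on (V \<union> \<phi> ` (D \<inter> U)) \<psi>"
        using Vc inv by (intro lipschitz_on_subset[OF ch(6)]) auto
      show "\<phi> z \<in> V" if "z \<in> U" "z \<in> \<Omega>" for z
        using inv[OF that(1)] ch(8)[rule_format, OF that(1)] that by (auto simp: V_def open_cube_def)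
      show "z + s *\<^sub>R (y - z) \<in> V" if y: "y \<in> V" and z: "z \<in> \<phi> ` (D \<inter> U)" and s: "0 < s" "s \<le> 1" for y z s
      proof -
        have zc: "z \<in> open_cube" "z $ l = 0" using z inv ch(9) DF by auto
        have comp: "(z + s *\<^sub>R (y - z)) $ i = (1 - s) * z $ i + s * y $ i" for i
          by (simp add: algebra_simps)
        have "- 1 < (1 - s) * z $ i + s * y $ i \<and> (1 - s) * z $ i + s * y $ i < 1" for i
        proof -
          have b: "- 1 < z $ i" "z $ i < 1" "- 1 < y $ i" "y $ i < 1" using zc y by (auto simp: V_def open_cube_def)
          have "(1 - s) *\<^sub>R z $ i + s *\<^sub>R y $ i \<in> {- 1<..<1}"
            using b s by (intro convexD[OF convex_real_interval(8)]) auto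
          then show ?thesis by simp
        qed
        moreover have "(1 - s) * z $ l + s * y $ l < 0"
          using zc y s by (simp add: V_def mult_pos_neg)
        ultimately show ?thesis unfolding V_def mem_Collect_eq comp by auto
      qed
      \<comment> \<open>Vacuous: in the chart, boundary points have l-th coordinate 0 and points of
        V a negative one.\<close>
      show "\<psi> y \<in> D" if "y \<in> V" "\<psi> y \<in> frontier \<Omega>" for y
        using that inv'[of y] ch(9)[rule_format, of "\<psi> y"] Vc by (auto simp: V_def)
    qed (use ch inv inv' Vc x in auto)
  qed
  then obtain \<epsilon> where "\<epsilon> > 0" "hardy_on p \<Omega> D (\<Omega> \<inter> ball x \<epsilon>)" by auto
  then show ?thesis by (intro exI[of _ "ball x \<epsilon>"]) (auto simp: Int_commute)
qed

text \<open>This makes the set of good points closed in the closure of \<Omega>. Off D there is a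
  gap between x and D, and a small neighbourhood of x meets \<Omega> in a ball or in the chart image
  of a half cube, both bi-Lipschitz to convex sets. The estimate enters through the set T that
  \<open>lim\<close> provides.\<close>

lemma hardy_limit_point:
  fixes \<Omega> D :: "(real ^ 'n) set"
  assumes p: "p > 1" and adm: "admissible l \<Omega> D" and D: "D \<noteq> {}" and x: "x \<in> closure \<Omega>" "x \<notin> D"
    and lim: "\<And>S. open S \<Longrightarrow> x \<in> S \<Longrightarrow> \<exists>T. open T \<and> hardy_on p \<Omega> D (T \<inter> \<Omega>) \<and> S \<inter> T \<inter> \<Omega> \<noteq> {}"
  shows "\<exists>T. open T \<and> x \<in> T \<and> hardy_on p \<Omega> D (T \<inter> \<Omega>)"
proof -
  have \<Omega>: "open \<Omega>" "bounded \<Omega>" and DF: "D \<subseteq> frontier \<Omega>" and Dcl: "closed D"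
    using adm by (auto simp: admissible_def)
  have D\<Omega>: "D \<inter> \<Omega> = {}" using DF \<Omega>(1) by (auto simp: frontier_def interior_open)
  define r where "r = infdist x D / 2"
  have r: "r > 0"
    using infdist_pos_not_in_closed[OF Dcl D x(2)] by (simp add: r_def)
  have far: "r \<le> infdist y D" if "dist x y < r" for y
    using infdist_triangle[of x D y] that by (simp add: r_def)
  show ?thesis
  proof (cases "x \<in> \<Omega>")
    case True
    then obtain R0 where R0: "R0 > 0" "ball x R0 \<subseteq> \<Omega>" using \<Omega>(1) open_contains_ball by metis
    define R where "R = min R0 r"
    have R: "R > 0" "ball x R \<subseteq> \<Omega>" "R \<le> r" using R0 r by (auto simp: R_def)
    obtain T where T: "open T" "hardy_on p \<Omega> D (T \<inter> \<Omega>)" "ball x R \<inter> T \<inter> \<Omega> \<noteq> {}"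
      using lim[of "ball x R"] R by auto
    have "hardy_on p \<Omega> D ((\<lambda>y. y) ` ball x R)"
    proof (rule hardy_on_propagate[OF p Dcl D \<Omega> D\<Omega> convex_ball open_ball bounded_ball, where L = 1 and \<phi> = "\<lambda>y. y" and r = r and N = "T \<inter> \<Omega>"])
      show "1-lipschitz_on (ball x R) (\<lambda>y. y)" "1-lipschitz_on ((\<lambda>y. y) ` ball x R) (\<lambda>y. y)"
        by (auto intro!: lipschitz_onI)
      show "r \<le> infdist y D" if "y \<in> (\<lambda>y. y) ` ball x R" for y using far[of y] that R by auto
    qed (use T R r \<Omega> in auto)
    then show ?thesis using R by (intro exI[of _ "ball x R"]) (auto simp: Int_absorb2)
  next
    case False
    then have "x \<in> frontier \<Omega> - D" using x \<Omega>(1) by (simp add: frontier_def interior_open)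
    then have "x \<in> closure (frontier \<Omega> - D)" by (rule subsetD[OF closure_subset])
    then obtain U \<phi> where "boundary_chart l \<Omega> x U \<phi>"
      using adm unfolding admissible_def by blast
    then obtain \<psi> L where ch: "open U" "x \<in> U" "L \<ge> 1" "homeomorphism U open_cube \<phi> \<psi>"
      "L-lipschitz_on U \<phi>" "L-lipschitz_on open_cube \<psi>" "\<phi> x = 0"
      "\<forall>z\<in>U. z \<in> \<Omega> \<longleftrightarrow> \<phi> z $ l < 0" "\<forall>z\<in>U. z \<in> frontier \<Omega> \<longleftrightarrow> \<phi> z $ l = 0"
      by (rule chart_points)
    have inv: "\<psi> (\<phi> z) = z" "\<phi> z \<in> open_cube" if "z \<in> U" for z
      using ch(4) that by (auto simp: homeomorphism_def)
    have inv': "\<phi> (\<psi> y) = y" "\<psi> y \<in> U" if "y \<in> open_cube" for y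
      using ch(4) that by (auto simp: homeomorphism_def)
    have \<psi>0: "\<psi> 0 = x" using inv(1)[OF ch(2)] ch(7) by simp
    \<comment> \<open>Points of the cube of half-width \<epsilon> have norm at most d \<epsilon>,
      and \<psi> is L-Lipschitz with \<psi> 0 = x, so the image stays within r / 2 of x.\<close>
    define \<epsilon> where "\<epsilon> = min 1 (r / (2 * L * CARD('n)))"
    have \<epsilon>: "\<epsilon> > 0" "\<epsilon> \<le> 1" using r ch(3) by (auto simp: \<epsilon>_def)
    have \<epsilon>r: "L * (CARD('n) * \<epsilon>) < r"
    proof -
      have "L * (CARD('n) * \<epsilon>) \<le> L * (CARD('n) * (r / (2 * L * CARD('n))))"
        using ch(3) by (intro mult_left_mono) (auto simp: \<epsilon>_def)
      also have "\<dots> = r / 2" using ch(3) by simp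
      finally show ?thesis using r by simp
    qed
    define Q where "Q = {y :: real^'n. \<forall>i. - \<epsilon> < y $ i \<and> y $ i < \<epsilon>}"
    define K where "K = {y :: real^'n. (\<forall>i. - \<epsilon> < y $ i \<and> y $ i < \<epsilon>) \<and> y $ l < 0}"
    have K: "convex K" "open K" "bounded K" using small_half_cube[of \<epsilon> l] by (auto simp: K_def)
    have Qc: "Q \<subseteq> open_cube" using \<epsilon> by (auto simp: Q_def open_cube_def) (meson less_le_trans le_less_trans neg_le_iff_le order_less_le_trans order_le_less_trans)+
    have KQ: "K \<subseteq> Q" by (auto simp: K_def Q_def)
    have Qopen: "open Q" unfolding Q_def by (rule open_coordinate_cube)
    define T0 where "T0 = {z\<in>U. \<phi> z \<in> Q}"
    have T0: "open T0" "x \<in> T0"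
    proof -
      have "open (U \<inter> \<phi> -` Q)"
        using continuous_open_preimage[OF lipschitz_on_continuous_on[OF ch(5)] ch(1) Qopen] .
      then show "open T0" by (simp add: T0_def Int_def vimage_def)
      show "x \<in> T0" using ch(2,7) \<epsilon> by (simp add: T0_def Q_def)
    qed
    have T0K: "T0 \<inter> \<Omega> = \<psi> ` K"
    proof
      show "T0 \<inter> \<Omega> \<subseteq> \<psi> ` K"
      proof
        fix z assume z: "z \<in> T0 \<inter> \<Omega>"
        then have "\<phi> z \<in> K" using ch(8)[rule_format, of z] by (auto simp: T0_def K_def Q_def)
        then have "\<psi> (\<phi> z) \<in> \<psi> ` K" by (rule imageI)
        then show "z \<in> \<psi> ` K" using inv(1)[of z] z by (simp add: T0_def)
      qed
      show "\<psi> ` K \<subseteq> T0 \<inter> \<Omega>"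
      proof (rule image_subsetI)
        fix y assume y: "y \<in> K"
        then have "\<phi> (\<psi> y) = y" "\<psi> y \<in> U" using inv'[of y] KQ Qc by auto
        then show "\<psi> y \<in> T0 \<inter> \<Omega>" using ch(8)[rule_format, of "\<psi> y"] y KQ by (auto simp: T0_def K_def)
      qed
    qed
    obtain T where T: "open T" "hardy_on p \<Omega> D (T \<inter> \<Omega>)" "T0 \<inter> T \<inter> \<Omega> \<noteq> {}"
      using lim[OF T0] by auto
    have "hardy_on p \<Omega> D (\<psi> ` K)"
    proof (rule hardy_on_propagate[OF p Dcl D \<Omega> D\<Omega> K, where L = L and \<phi> = \<phi> and r = r and N = "T \<inter> \<Omega>"])
      show "L-lipschitz_on K \<psi>" by (rule lipschitz_on_subset[OF ch(6) order_trans[OF KQ Qc]])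
      show "L-lipschitz_on (\<psi> ` K) \<phi>" using T0K by (intro lipschitz_on_subset[OF ch(5)]) (auto simp: T0_def)
      show "\<phi> (\<psi> y) = y" if "y \<in> K" for y using inv'[of y] that KQ Qc by auto
      show "\<psi> ` K \<subseteq> \<Omega>" "\<psi> ` K \<in> sets borel" using T0K T0(1) \<Omega>(1) by (auto simp flip: T0K)
      show "T \<inter> \<Omega> \<inter> \<psi> ` K \<noteq> {}" using T(3) T0K by auto
      show "r \<le> infdist y D" if "y \<in> \<psi> ` K" for y
      proof -
        from that obtain u where u: "u \<in> K" "y = \<psi> u" by auto
        have nu: "norm u \<le> CARD('n) * \<epsilon>"
          using u(1) by (intro norm_coordinate_cube) (auto simp: K_def)
        have "dist x y = dist (\<psi> 0) (\<psi> u)" using u \<psi>0 by simp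
        also have "\<dots> \<le> L * dist 0 u"
          using u KQ Qc by (intro lipschitz_onD[OF ch(6)]) (auto simp: open_cube_def)
        also have "\<dots> \<le> L * (CARD('n) * \<epsilon>)" using nu ch(3) by (intro mult_left_mono) auto
        finally show ?thesis using \<epsilon>r far[of y] by simp
      qed
    qed (use T ch \<Omega> r in auto)
    then show ?thesis using T0 T0K by auto
  qed
qed

text \<open>The good points are those with a neighbourhood on which the estimate holds. They form a
  clopen subset of the connected closure of \<Omega>, and D provides a first one; by compactness
  finitely many of the neighbourhoods suffice, which keeps the constant finite.\<close>

lemma hardy_on_domain:
  fixes \<Omega> D :: "(real ^ 'n) set"
  assumes p: "p > 1" and adm: "admissible l \<Omega> D" and D: "D \<noteq> {}"
  shows "hardy_on p \<Omega> D \<Omega>"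
proof -
  have \<Omega>: "open \<Omega>" "bounded \<Omega>" "connected \<Omega>" and DF: "D \<subseteq> frontier \<Omega>"
    using adm by (auto simp: admissible_def)
  define good where "good x \<longleftrightarrow> (\<exists>T. open T \<and> x \<in> T \<and> hardy_on p \<Omega> D (T \<inter> \<Omega>))" for x
  define S where "S = {x. good x}"
  have S_open: "open S"
    unfolding open_subopen[of S] by (auto simp: S_def good_def)
  have closedin: "closedin (top_of_set (closure \<Omega>)) (closure \<Omega> \<inter> S)"
  proof -
    have "closure \<Omega> \<inter> S = closure \<Omega> \<inter> closure (closure \<Omega> \<inter> S)"
    proof
      show "closure \<Omega> \<inter> closure (closure \<Omega> \<inter> S) \<subseteq> closure \<Omega> \<inter> S"
      proof
        fix x assume x: "x \<in> closure \<Omega> \<inter> closure (closure \<Omega> \<inter> S)"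
        have "good x"
        proof (cases "x \<in> D")
          case True
          then show ?thesis unfolding good_def by (rule hardy_near_dirichlet[OF p adm])
        next
          case False
          show ?thesis unfolding good_def
          proof (rule hardy_limit_point[OF p adm D])
            fix A assume A: "open A" "x \<in> A"
            then obtain y where y: "y \<in> closure \<Omega>" "y \<in> S" "y \<in> A"
              using x closure_iff_nhds_not_empty[of x "closure \<Omega> \<inter> S"] by blast
            then obtain T where T: "open T" "y \<in> T" "hardy_on p \<Omega> D (T \<inter> \<Omega>)" by (auto simp: S_def good_def)
            \<comment> \<open>The good point y may itself lie on the boundary, but each of its
              neighbourhoods meets \<Omega>, and the estimate on T can be used there.\<close>
            have "open (A \<inter> T)" "y \<in> A \<inter> T" using A T y by auto
            then have "\<Omega> \<inter> (A \<inter> T) \<noteq> {}" using y(1) closure_iff_nhds_not_empty[of y \<Omega>] by blast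
            with T show "\<exists>T. open T \<and> hardy_on p \<Omega> D (T \<inter> \<Omega>) \<and> A \<inter> T \<inter> \<Omega> \<noteq> {}" by blast
          qed (use x False in auto)
        qed
        with x show "x \<in> closure \<Omega> \<inter> S" by (simp add: S_def)
      qed
    qed (intro Int_greatest Int_lower1 closure_subset)
    also have "closedin (top_of_set (closure \<Omega>)) \<dots>"
      by (rule closedin_closed_Int[OF closed_closure])
    finally show ?thesis .
  qed
  obtain z where z: "z \<in> D" using D by auto
  have "z \<in> closure \<Omega> \<inter> S"
    using z DF hardy_near_dirichlet[OF p adm z] by (auto simp: S_def good_def frontier_def)
  moreover have "openin (top_of_set (closure \<Omega>)) (closure \<Omega> \<inter> S)" using S_open by (simp add: openin_open_Int)
  moreover have "connected (closure \<Omega>)" using \<Omega>(3) by (rule connected_imp_connected_closure)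
  ultimately have "closure \<Omega> \<inter> S = closure \<Omega>"
    using closedin unfolding connected_clopen by blast
  then have "\<forall>x\<in>closure \<Omega>. \<exists>T. open T \<and> x \<in> T \<and> hardy_on p \<Omega> D (T \<inter> \<Omega>)"
    by (auto simp: S_def good_def)
  then obtain T where T: "\<And>x. x \<in> closure \<Omega> \<Longrightarrow> open (T x) \<and> x \<in> T x \<and> hardy_on p \<Omega> D (T x \<inter> \<Omega>)"
    by metis
  have "compact (closure \<Omega>)" using \<Omega>(2) by (simp add: compact_closure)
  then obtain F where F: "F \<subseteq> closure \<Omega>" "finite F" "closure \<Omega> \<subseteq> (\<Union>x\<in>F. T x)"
    by (rule compactE_image[of "closure \<Omega>" "closure \<Omega>" T]) (use T in auto)
  have "hardy_on p \<Omega> D (\<Union>x\<in>F. T x \<inter> \<Omega>)"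
    using F T \<Omega>(1) by (intro hardy_on_UN) (auto intro!: borel_open open_Int)
  then show ?thesis
    by (rule hardy_on_subset) (use F(3) closure_subset[of \<Omega>] in blast)
qed


section \<open>Sobolev functions\<close>

lemma abs_powr_diff_le:
  fixes a b p :: real
  assumes "p > 1" "a \<ge> 0" "b \<ge> 0"
  shows "\<bar>a powr p - b powr p\<bar> \<le> p * max a b powr (p - 1) * \<bar>a - b\<bar>"
proof -
  have main: "b powr p - a powr p \<le> p * b powr (p - 1) * (b - a)" if ab: "0 \<le> a" "a < b" for a b :: real
  proof -
    have "continuous_on {a..b} (\<lambda>t. t powr p)"
      using ab assms(1) by (intro continuous_on_powr' continuous_intros) auto
    moreover have d: "((\<lambda>t. t powr p) has_real_derivative p * t powr (p - 1)) (at t)" if "a < t" for t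
      using that ab by (auto intro!: derivative_eq_intros)
    ultimately obtain l z where z: "a < z" "z < b" "DERIV (\<lambda>t. t powr p) z :> l" "b powr p - a powr p = (b - a) * l"
      using MVT[OF ab(2), of "\<lambda>t. t powr p"] by (meson real_differentiable_def)
    have "l = p * z powr (p - 1)" using DERIV_unique[OF z(3) d[OF z(1)]] .
    moreover have "z powr (p - 1) \<le> b powr (p - 1)" using z ab assms(1) by (intro powr_mono2) auto
    ultimately have "l \<le> p * b powr (p - 1)" using assms(1) by simp
    then have "(b - a) * l \<le> (b - a) * (p * b powr (p - 1))" using ab by (intro mult_left_mono) auto
    then show ?thesis using z(4) by (simp add: mult_ac)
  qed
  consider "a < b" | "b < a" | "a = b" by linarith
  then show ?thesis
  proof cases
    case 1
    then have "a powr p \<le> b powr p" using assms by (intro powr_mono2) auto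
    then show ?thesis using main[of a b] 1 assms by (simp add: max_def)
  next
    case 2
    then have "b powr p \<le> a powr p" using assms by (intro powr_mono2) auto
    then show ?thesis using main[of b a] 2 assms by (simp add: max_def)
  qed simp
qed

text \<open>Cauchy-Schwarz over the coordinates. It works for vector values because the norm of
  \<open>grad u x\<close> is the Euclidean norm of the family of norms of the partial
  derivatives.\<close>

lemma norm_frechet_derivative_le_grad:
  fixes u :: "real ^ 'n \<Rightarrow> 'b::real_normed_vector"
  assumes "u differentiable at x"
  shows "norm (frechet_derivative u (at x) h) \<le> norm h * norm (grad u x)"
proof -
  let ?D = "frechet_derivative u (at x)"
  have lin: "linear ?D" using assms by (rule linear_frechet_derivative)
  have "?D h = ?D (\<Sum>i\<in>UNIV. h $ i *\<^sub>R axis i 1)"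
    using basis_expansion[of h] by (simp add: scalar_mult_eq_scaleR)
  also have "\<dots> = (\<Sum>i\<in>UNIV. h $ i *\<^sub>R partial_deriv i u x)"
    by (simp add: linear_sum[OF lin] linear_scale[OF lin] partial_deriv_def)
  finally have "norm (?D h) \<le> (\<Sum>i\<in>UNIV. norm (h $ i *\<^sub>R partial_deriv i u x))"
    using norm_sum[of "\<lambda>i. h $ i *\<^sub>R partial_deriv i u x" UNIV] by (simp only:)
  also have "\<dots> = (\<Sum>i\<in>UNIV. \<bar>h $ i\<bar> * \<bar>norm (partial_deriv i u x)\<bar>)" by simp
  also have "\<dots> \<le> L2_set (\<lambda>i. h $ i) UNIV * L2_set (\<lambda>i. norm (partial_deriv i u x)) UNIV"
    by (rule L2_set_mult_ineq)
  also have "\<dots> = norm h * norm (grad u x)"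
    by (simp add: norm_vec_def grad_def L2_set_def)
  finally show ?thesis .
qed

lemma test_functionD:
  fixes u :: "real ^ 'n \<Rightarrow> 'b::real_normed_vector"
  assumes "u \<in> test_functions D"
  shows "u differentiable at x" "continuous_on UNIV u" "continuous_on UNIV (grad u)"
proof -
  have "continuously_differentiable (Suc 0) u" using assms unfolding test_functions_def by blast
  then have diff: "u differentiable at x" and cpd: "continuous_on UNIV (partial_deriv i u)" for x i
    by auto
  show "u differentiable at x" by (rule diff)
  show "continuous_on UNIV u"
    using diff by (auto intro!: continuous_at_imp_continuous_on differentiable_imp_continuous_within)
  show "continuous_on UNIV (grad u)"
    unfolding grad_def[abs_def] by (intro continuous_on_vec_lambda cpd)
qed

text \<open>The vanishing zone is the gap between the compact support and the closed set D. The
  slope bound is the mean value estimate for the power p, in which the larger of the norms at y and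
  x tends to the norm at x as y approaches x.\<close>

lemma test_function_hardy_pair:
  fixes u :: "real ^ 'n \<Rightarrow> 'b::real_normed_vector"
  assumes p: "p > 1" and D: "closed D" "D \<noteq> {}" and u: "u \<in> test_functions D"
  shows "hardy_pair D (\<lambda>x. norm (u x) powr p) (\<lambda>x. p * norm (u x) powr (p - 1) * norm (grad u x))"
proof -
  note diff = test_functionD(1)[OF u] and cu = test_functionD(2)[OF u] and cgrad = test_functionD(3)[OF u]
  have S: "compact (support u)" "support u \<inter> D = {}"
    using u by (auto simp: test_functions_def)
  have zero: "u x = 0" if "x \<notin> support u" for x
    using that closure_subset[of "{x. u x \<noteq> 0}"] by (auto simp: support_def)
  obtain \<eta> where \<eta>: "\<eta> > 0" "\<And>x y. x \<in> support u \<Longrightarrow> y \<in> D \<Longrightarrow> \<eta> \<le> dist x y"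
    using separate_compact_closed[OF S(1) D(1) S(2)] by auto
  have near: "u x = 0" if "infdist x D < \<eta>" for x
  proof (rule zero, rule notI)
    assume "x \<in> support u"
    moreover obtain y where "y \<in> D" "infdist x D = dist x y" using infdist_attains_inf[OF D] by metis
    ultimately show False using \<eta>(2)[of x y] that by simp
  qed
  have "slope_bound (\<lambda>x. norm (u x) powr p) (\<lambda>x. p * norm (u x) powr (p - 1) * norm (grad u x))"
    unfolding slope_bound_def
  proof (intro conjI allI impI)
    show "continuous_on UNIV (\<lambda>x. p * norm (u x) powr (p - 1) * norm (grad u x))"
      using p by (intro continuous_intros continuous_on_powr' cu cgrad) auto
    show "0 \<le> norm (u x) powr p" "0 \<le> p * norm (u x) powr (p - 1) * norm (grad u x)" for x
      using p by auto
    fix x and e :: real assume e: "e > 0"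
    define B where "B = p * norm (u x) powr (p - 1)"
    have B: "B \<ge> 0" using p by (simp add: B_def)
    \<comment> \<open>The summand 1 keeps the quotient meaningful where u x = 0 and hence B =
      0.\<close>
    define k where "k = B + 1"
    define e1 where "e1 = (e / 2) / k"
    have k: "k > 0" using B by (simp add: k_def)
    have e1: "e1 > 0" using e k by (simp add: e1_def)
    have "B * e1 \<le> k * e1" using e1 by (simp add: k_def mult_right_mono)
    also have "\<dots> = e / 2" using k by (simp add: e1_def)
    finally have Be1: "B * e1 < e" using e by simp
    let ?m = "\<lambda>y. p * max (norm (u y)) (norm (u x)) powr (p - 1)"
    have "((\<lambda>y. ?m y * (norm (grad u x) + e1)) \<longlongrightarrow> ?m x * (norm (grad u x) + e1)) (at x)"
    proof -
      have "continuous_on UNIV ?m"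
        using p by (intro continuous_intros continuous_on_powr' cu) (auto simp: max_def)
      then have "(?m \<longlongrightarrow> ?m x) (at x)" unfolding continuous_on by (rule bspec) simp
      then show ?thesis by (rule tendsto_mult_right)
    qed
    moreover have "?m x * (norm (grad u x) + e1) < B * norm (grad u x) + e"
      using Be1 by (simp add: B_def algebra_simps)
    ultimately have ev1: "\<forall>\<^sub>F y in at x. ?m y * (norm (grad u x) + e1) < B * norm (grad u x) + e"
      by (rule order_tendstoD)
    have "(u has_derivative frechet_derivative u (at x)) (at x)" using diff frechet_derivative_works by blast
    then obtain d where d: "d > 0" "\<And>y. norm (y - x) < d \<Longrightarrow>
        norm (u y - u x - frechet_derivative u (at x) (y - x)) \<le> e1 * norm (y - x)"
      using e1 unfolding has_derivative_at_alt by blast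
    have bound: "\<bar>norm (u y) powr p - norm (u x) powr p\<bar> \<le> ?m y * (norm (grad u x) + e1) * dist y x"
      if y: "dist y x < d" for y
    proof -
      have "norm (u y - u x) \<le> norm (frechet_derivative u (at x) (y - x)) + e1 * norm (y - x)"
        using d(2)[of y] y norm_triangle_sub[of "u y - u x" "frechet_derivative u (at x) (y - x)"]
        by (simp add: dist_norm)
      also have "\<dots> \<le> norm (y - x) * norm (grad u x) + e1 * norm (y - x)"
        using norm_frechet_derivative_le_grad[OF diff] by simp
      also have "\<dots> = (norm (grad u x) + e1) * dist y x" by (simp add: dist_norm algebra_simps)
      finally have "norm (u y - u x) \<le> (norm (grad u x) + e1) * dist y x" .
      then have le: "\<bar>norm (u y) - norm (u x)\<bar> \<le> (norm (grad u x) + e1) * dist y x"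
        using norm_triangle_ineq3[of "u y" "u x"] by linarith
      have "\<bar>norm (u y) powr p - norm (u x) powr p\<bar> \<le> ?m y * \<bar>norm (u y) - norm (u x)\<bar>"
        by (rule abs_powr_diff_le[OF p]) auto
      also have "\<dots> \<le> ?m y * ((norm (grad u x) + e1) * dist y x)"
        using le p by (intro mult_left_mono) auto
      finally show ?thesis by (simp add: mult.assoc)
    qed
    have "\<forall>\<^sub>F y in at x. dist y x < d" using d(1) by (auto simp: eventually_at)
    with ev1 have "\<forall>\<^sub>F y in at x. \<bar>norm (u y) powr p - norm (u x) powr p\<bar>
        \<le> (p * norm (u x) powr (p - 1) * norm (grad u x) + e) * dist y x"
    proof eventually_elim
      case (elim y)
      have "?m y * (norm (grad u x) + e1) * dist y x \<le> (B * norm (grad u x) + e) * dist y x"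
        using elim by (intro mult_right_mono) auto
      with bound[OF elim(2)] show ?case unfolding B_def by linarith
    qed
    then show "\<forall>\<^sub>F y in nhds x. \<bar>norm (u y) powr p - norm (u x) powr p\<bar>
        \<le> (p * norm (u x) powr (p - 1) * norm (grad u x) + e) * dist y x"
      by (simp add: eventually_nhds_conv_at)
  qed
  \<comment> \<open>The gradient term vanishes through its factor: \<open>0 powr (p - 1)\<close> is
    0.\<close>
  moreover have "\<exists>\<eta>>0. \<forall>x. infdist x D < \<eta> \<longrightarrow> norm (u x) powr p = 0 \<and> p * norm (u x) powr (p - 1) * norm (grad u x) = 0"
    using \<eta>(1) near by (intro exI[of _ \<eta>]) auto
  ultimately show ?thesis by (simp add: hardy_pair_def)
qed

text \<open>If Y <= e X the first term alone dominates; otherwise X <= Y / e and the second does.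
  The small factor e sits on the power of X, which is the term to be absorbed.\<close>

lemma powr_young:
  fixes X Y e p :: real
  assumes "X \<ge> 0" "Y \<ge> 0" "e > 0" "p > 1"
  shows "X powr (p - 1) * Y \<le> e * X powr p + e powr (1 - p) * Y powr p"
proof (cases "Y \<le> e * X")
  case True
  have "X powr (p - 1) * Y \<le> X powr (p - 1) * (e * X)" using True by (intro mult_left_mono) auto
  also have "\<dots> = e * X powr p"
    using assms powr_mult_base[of X "p - 1"] by (simp add: mult_ac)
  finally show ?thesis by (simp add: add_increasing2)
next
  case False
  then have "X \<le> Y / e" using assms by (simp add: field_simps)
  then have "X powr (p - 1) * Y \<le> (Y / e) powr (p - 1) * Y"
    using assms by (intro mult_right_mono powr_mono2) auto
  also have "\<dots> = e powr (1 - p) * (Y * Y powr (p - 1))"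
    using assms powr_minus_divide[of e "p - 1"] by (simp add: powr_divide)
  also have "Y * Y powr (p - 1) = Y powr p" using assms powr_mult_base[of Y "p - 1"] by simp
  finally show ?thesis using assms by (simp add: add_increasing)
qed

text \<open>With X the quotient of |u| by the distance to D and Y = |grad u|, the two sides of the
  weighted estimate for |u|^p have the integrands X^p and p X^(p-1) Y: the weights are exactly those
  for which the distance enters through X alone.\<close>

lemma hardy_test_functions:
  fixes \<Omega> D :: "(real ^ 'n) set"
  assumes p: "p > 1" and D: "closed D" "D \<noteq> {}" and \<Omega>: "open \<Omega>" "bounded \<Omega>" "D \<inter> \<Omega> = {}"
    and H: "hardy_on p \<Omega> D \<Omega>"
  obtains C where "C \<ge> 0" "\<forall>u :: real ^ 'n \<Rightarrow> 'b::real_normed_vector. u \<in> test_functions D \<longrightarrow>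
    (\<integral>\<^sup>+x\<in>\<Omega>. ennreal ((norm (u x) / infdist x D) powr p) \<partial>lborel)
      \<le> ennreal C * (\<integral>\<^sup>+x\<in>\<Omega>. ennreal (norm (grad u x) powr p) \<partial>lborel)"
proof -
  from hardy_onE[OF H] obtain K where K: "K \<ge> 0" "\<forall>v g. hardy_pair D v g \<longrightarrow> weighted_int D (- p) v \<Omega>
       \<le> ennreal K * weighted_int D (1 - p) g \<Omega>" .
  have dpos: "infdist x D > 0" if "x \<in> \<Omega>" for x
    using that \<Omega>(3) infdist_pos_not_in_closed[OF D, of x] by auto
  define k where "k = (K + 1) * p"
  have k: "k > 0" using K p by (simp add: k_def)
  \<comment> \<open>Makes K p e at most 1/2, so that at most half of the left-hand side returns; the
    K + 1 inside k allows K = 0.\<close>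
  define e where "e = (1 / 2) / k"
  have e: "e > 0" using k by (simp add: e_def)
  have "K * p * e \<le> k * e" using e p by (intro mult_right_mono) (auto simp: k_def algebra_simps)
  also have "\<dots> = 1 / 2" using k by (simp add: e_def)
  finally have Kpe: "K * p * e \<le> 1 / 2" .
  define B where "B = K * p * e powr (1 - p)"
  have B: "B \<ge> 0" using K p by (simp add: B_def)
  have Dm: "(\<lambda>y. infdist y D) \<in> borel_measurable borel"
    by (auto intro!: borel_measurable_continuous_onI continuous_intros)
  have "(\<integral>\<^sup>+x\<in>\<Omega>. ennreal ((norm (u x) / infdist x D) powr p) \<partial>lborel)
      \<le> ennreal (2 * B) * (\<integral>\<^sup>+x\<in>\<Omega>. ennreal (norm (grad u x) powr p) \<partial>lborel)"
    if u: "u \<in> test_functions D" for u :: "real ^ 'n \<Rightarrow> 'b"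
  proof -
    define X where "X x = norm (u x) / infdist x D" for x
    define Y where "Y x = norm (grad u x)" for x
    have X0: "X x \<ge> 0" and Y0: "Y x \<ge> 0" for x by (auto simp: X_def Y_def infdist_nonneg)
    define IX where "IX = (\<integral>\<^sup>+x\<in>\<Omega>. ennreal (X x powr p) \<partial>lborel)"
    define IY where "IY = (\<integral>\<^sup>+x\<in>\<Omega>. ennreal (Y x powr p) \<partial>lborel)"
    note diff = test_functionD(1)[OF u] and cu = test_functionD(2)[OF u] and cgrad = test_functionD(3)[OF u]
    have Xm: "X \<in> borel_measurable borel"
    proof -
      have "(\<lambda>x. norm (u x)) \<in> borel_measurable borel" by (intro borel_measurable_continuous_onI continuous_intros cu)
      then show ?thesis unfolding X_def[abs_def] using Dm by measurable
    qed
    have Ym: "Y \<in> borel_measurable borel"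
      unfolding Y_def[abs_def] by (intro borel_measurable_continuous_onI continuous_intros cgrad)
    have pair: "hardy_pair D (\<lambda>x. norm (u x) powr p) (\<lambda>x. p * norm (u x) powr (p - 1) * norm (grad u x))"
      by (rule test_function_hardy_pair[OF p D u])
    have "IX = (\<integral>\<^sup>+x\<in>\<Omega>. ennreal (norm (u x) powr p * infdist x D powr (- p)) \<partial>lborel)"
      unfolding IX_def
    proof (intro nn_integral_cong)
      fix x
      show "ennreal (X x powr p) * indicator \<Omega> x = ennreal (norm (u x) powr p * infdist x D powr (- p)) * indicator \<Omega> x"
        using dpos[of x] by (cases "x \<in> \<Omega>") (simp_all add: X_def powr_divide powr_minus_divide)
    qed
    also have "\<dots> \<le> ennreal K * (\<integral>\<^sup>+x\<in>\<Omega>. ennreal (p * norm (u x) powr (p - 1) * norm (grad u x) * infdist x D powr (1 - p)) \<partial>lborel)"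
      by (rule K(2)[rule_format, OF pair])
    also have "\<dots> \<le> ennreal K * (\<integral>\<^sup>+x. ennreal (p * e) * (ennreal (X x powr p) * indicator \<Omega> x)
        + ennreal (p * e powr (1 - p)) * (ennreal (Y x powr p) * indicator \<Omega> x) \<partial>lborel)"
    proof (intro mult_left_mono nn_integral_mono)
      fix x
      have "ennreal (p * norm (u x) powr (p - 1) * norm (grad u x) * infdist x D powr (1 - p))
          \<le> ennreal (p * e) * ennreal (X x powr p) + ennreal (p * e powr (1 - p)) * ennreal (Y x powr p)" if "x \<in> \<Omega>"
      proof -
        have "norm (u x) powr (p - 1) * infdist x D powr (1 - p) = X x powr (p - 1)"
          using dpos[OF that] powr_minus_divide[of "infdist x D" "p - 1"] by (simp add: X_def powr_divide)
        then have "p * norm (u x) powr (p - 1) * norm (grad u x) * infdist x D powr (1 - p) = p * (X x powr (p - 1) * Y x)"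
          by (simp add: Y_def mult_ac)
        also have "\<dots> \<le> p * (e * X x powr p + e powr (1 - p) * Y x powr p)"
          using p e by (intro mult_left_mono powr_young X0 Y0) auto
        also have "\<dots> = p * e * X x powr p + p * e powr (1 - p) * Y x powr p" by (simp add: algebra_simps)
        finally have "ennreal (p * norm (u x) powr (p - 1) * norm (grad u x) * infdist x D powr (1 - p))
            \<le> ennreal (p * e * X x powr p + p * e powr (1 - p) * Y x powr p)" by (rule ennreal_leI)
        also have "\<dots> = ennreal (p * e * X x powr p) + ennreal (p * e powr (1 - p) * Y x powr p)"
          using p e by (intro ennreal_plus) auto
        also have "\<dots> = ennreal (p * e) * ennreal (X x powr p) + ennreal (p * e powr (1 - p)) * ennreal (Y x powr p)"
          by (simp only: ennreal_mult'' powr_ge_zero)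
        finally show ?thesis .
      qed
      then show "ennreal (p * norm (u x) powr (p - 1) * norm (grad u x) * infdist x D powr (1 - p)) * indicator \<Omega> x
        \<le> ennreal (p * e) * (ennreal (X x powr p) * indicator \<Omega> x)
        + ennreal (p * e powr (1 - p)) * (ennreal (Y x powr p) * indicator \<Omega> x)"
        by (cases "x \<in> \<Omega>") simp_all
    qed simp
    also have "(\<integral>\<^sup>+x. ennreal (p * e) * (ennreal (X x powr p) * indicator \<Omega> x)
        + ennreal (p * e powr (1 - p)) * (ennreal (Y x powr p) * indicator \<Omega> x) \<partial>lborel)
        = ennreal (p * e) * IX + ennreal (p * e powr (1 - p)) * IY"
    proof -
      have [measurable]: "X \<in> borel_measurable borel" "Y \<in> borel_measurable borel" "\<Omega> \<in> sets borel" using Xm Ym \<Omega> by auto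
      show ?thesis unfolding IX_def IY_def
        by (subst nn_integral_add) (measurable, simp add: nn_integral_cmult)
    qed
    also have "ennreal K * (ennreal (p * e) * IX + ennreal (p * e powr (1 - p)) * IY)
       = ennreal (K * p * e) * IX + ennreal B * IY"
      using K p e by (simp add: B_def distrib_left ennreal_mult mult.assoc)
    also have "\<dots> \<le> ennreal (1 / 2) * IX + ennreal B * IY"
      using Kpe by (intro add_mono mult_right_mono ennreal_leI) auto
    finally have main: "IX \<le> ennreal (1 / 2) * IX + ennreal B * IY" .
    \<comment> \<open>Half of IX can be subtracted only if IX is finite: u is bounded on \<Omega>
      and vanishes near D, so the quotient is bounded on a set of finite volume.\<close>
    have "IX < top"
    proof -
      obtain \<eta> where \<eta>: "\<eta> > 0" "\<And>x. infdist x D < \<eta> \<Longrightarrow> norm (u x) powr p = 0"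
        using pair by (auto simp: hardy_pair_def)
      have "compact (closure \<Omega>)" using \<Omega>(2) by (simp add: compact_closure)
      then have "bounded (u ` closure \<Omega>)"
        using cu by (intro compact_imp_bounded compact_continuous_image) (auto intro: continuous_on_subset)
      then obtain b where b: "\<And>x. x \<in> closure \<Omega> \<Longrightarrow> norm (u x) \<le> b"
        unfolding bounded_iff by auto
      have "X x powr p \<le> (\<bar>b\<bar> / \<eta>) powr p" if "x \<in> \<Omega>" for x
      proof (cases "infdist x D < \<eta>")
        case True
        then show ?thesis using \<eta>(2)[OF True] p by (simp add: X_def)
      next
        case False
        have "norm (u x) \<le> b" using b that closure_subset by blast
        then have "X x \<le> \<bar>b\<bar> / \<eta>" unfolding X_def using False \<eta>(1) by (intro frac_le) auto
        then show ?thesis using p X0[of x] by (intro powr_mono2) auto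
      qed
      then have "IX \<le> (\<integral>\<^sup>+x. ennreal ((\<bar>b\<bar> / \<eta>) powr p) * indicator \<Omega> x \<partial>lborel)"
        unfolding IX_def by (intro nn_integral_mono) (auto simp: indicator_def ennreal_leI)
      also have "\<dots> = ennreal ((\<bar>b\<bar> / \<eta>) powr p) * emeasure lborel \<Omega>"
        using \<Omega>(1) by (intro nn_integral_cmult_indicator) auto
      also have "\<dots> < top"
        using emeasure_bounded_finite[OF \<Omega>(2)] by (simp add: ennreal_mult_less_top)
      finally show ?thesis .
    qed
    then obtain a where a: "IX = ennreal a" "a \<ge> 0" by (cases IX rule: ennreal_cases) auto
    show ?thesis
    proof (cases "ennreal B * IY = top")
      case True
      have "ennreal (2 * B) * IY = 2 * (ennreal B * IY)" using B by (simp add: ennreal_mult mult.assoc)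
      also have "\<dots> = top" using True by simp
      finally show ?thesis unfolding IY_def Y_def by simp
    next
      case False
      then obtain b where b: "ennreal B * IY = ennreal b" "b \<ge> 0" by (cases "ennreal B * IY" rule: ennreal_cases) auto
      have "ennreal (1 / 2) * IX + ennreal B * IY = ennreal (1 / 2 * a) + ennreal b"
        unfolding a(1) b(1) using a(2) by (subst ennreal_mult) simp_all
      also have "\<dots> = ennreal (1 / 2 * a + b)" using a(2) b(2) by (intro ennreal_plus[symmetric]) auto
      finally have "ennreal a \<le> ennreal (1 / 2 * a + b)" using main unfolding a(1) by (simp only:)
      then have "a \<le> 1 / 2 * a + b" using a(2) b(2) by (subst (asm) ennreal_le_iff) auto
      then have "a \<le> 2 * b" by simp
      then have "IX \<le> ennreal (2 * b)" using a by (simp add: ennreal_leI)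
      also have "\<dots> = 2 * (ennreal B * IY)" using b by (simp add: ennreal_mult)
      also have "\<dots> = ennreal (2 * B) * IY" using B by (simp add: ennreal_mult mult.assoc)
      finally show ?thesis by (simp add: IX_def IY_def X_def Y_def)
    qed
  qed
  then show ?thesis using B by (intro that[of "2 * B"]) auto
qed

section \<open>Passage to the completion\<close>

lemma powr_add_le:
  fixes a b q :: real
  assumes "a \<ge> 0" "b \<ge> 0" "q \<ge> 0"
  shows "(a + b) powr q \<le> 2 powr q * (a powr q + b powr q)"
proof -
  have "(a + b) powr q \<le> (2 * max a b) powr q" using assms by (intro powr_mono2) auto
  also have "\<dots> = 2 powr q * max a b powr q" using assms by (simp add: powr_mult)
  also have "\<dots> \<le> 2 powr q * (a powr q + b powr q)" by (intro mult_left_mono) (auto simp: max_def)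
  finally show ?thesis .
qed


theorem theorem6p1:
  fixes \<Omega> D :: "(real ^ 'n) set" and l :: 'n
  assumes "CARD('n) \<ge> 2"
    and "admissible l \<Omega> D"
    and "D \<noteq> {}"
  shows "\<forall>p>1. \<exists>c\<ge>0.
    \<forall>(f :: real ^ 'n \<Rightarrow> 'b::{real_normed_field, euclidean_space}, df) \<in> W1_D p \<Omega> D.
      (\<integral>\<^sup>+x. ennreal ((norm (f x) / infdist x D) powr p) \<partial>lebesgue_on \<Omega>)
        \<le> ennreal c * (\<integral>\<^sup>+x. ennreal (norm (df x) powr p) \<partial>lebesgue_on \<Omega>)"
proof (intro allI impI)
  fix p :: real assume p: "p > 1"
  have \<Omega>: "open \<Omega>" "bounded \<Omega>" and DF: "D \<subseteq> frontier \<Omega>" and D: "closed D" "D \<noteq> {}"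
    using assms(2,3) by (auto simp: admissible_def)
  have D\<Omega>: "D \<inter> \<Omega> = {}" using DF \<Omega>(1) by (auto simp: frontier_def interior_open)
  have dpos: "infdist x D > 0" if "x \<in> \<Omega>" for x
    using that D\<Omega> infdist_pos_not_in_closed[OF D, of x] by auto
  obtain C where C: "C \<ge> 0" "\<forall>u :: real ^ 'n \<Rightarrow> 'b. u \<in> test_functions D \<longrightarrow>
    (\<integral>\<^sup>+x\<in>\<Omega>. ennreal ((norm (u x) / infdist x D) powr p) \<partial>lborel)
      \<le> ennreal C * (\<integral>\<^sup>+x\<in>\<Omega>. ennreal (norm (grad u x) powr p) \<partial>lborel)"
    by (rule hardy_test_functions[OF p D \<Omega> D\<Omega> hardy_on_domain[OF p assms(2,3)]])
  let ?M = "lebesgue_on \<Omega>"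
  have int_eq: "(\<integral>\<^sup>+x. h x \<partial>?M) = (\<integral>\<^sup>+x\<in>\<Omega>. h x \<partial>lborel)" for h :: "real ^ 'n \<Rightarrow> ennreal"
    using \<Omega>(1) by (subst nn_integral_restrict_space) (auto simp: nn_integral_completion)
  \<comment> \<open>One factor 2 powr p comes from splitting f into \<psi> j and an error, the other
    from splitting the gradient of \<psi> j into df and an error.\<close>
  define c where "c = 2 powr p * (C * 2 powr p)"
  have c: "c \<ge> 0" using C by (simp add: c_def)
  have "(\<integral>\<^sup>+x. ennreal ((norm (f x) / infdist x D) powr p) \<partial>?M) \<le> ennreal c * (\<integral>\<^sup>+x. ennreal (norm (df x) powr p) \<partial>?M)"
    if W: "(f, df) \<in> W1_D p \<Omega> D" for f :: "real ^ 'n \<Rightarrow> 'b" and df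
  proof -
    let ?h = "\<lambda>x. ennreal ((norm (f x) / infdist x D) powr p)"
    have fm: "f \<in> borel_measurable ?M" and dfm: "df \<in> borel_measurable ?M"
      using W by (auto simp: W1_D_def)
    obtain \<psi> where \<psi>: "\<And>j. \<psi> j \<in> test_functions D"
      and lim: "(\<lambda>j. \<integral>\<^sup>+x. ennreal (norm (grad (\<psi> j) x - df x) powr p + norm (\<psi> j x - f x) powr p) \<partial>?M) \<longlonglongrightarrow> 0"
      using W by (auto simp: W1_D_def)
    define err where "err j = (\<integral>\<^sup>+x. ennreal (norm (grad (\<psi> j) x - df x) powr p + norm (\<psi> j x - f x) powr p) \<partial>?M)" for j
    define I where "I = (\<integral>\<^sup>+x. ennreal (norm (df x) powr p) \<partial>?M)"
    have meas_cont: "h \<in> borel_measurable ?M" if "continuous_on UNIV h" for h :: "real ^ 'n \<Rightarrow> 'c::real_normed_vector"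
    proof -
      have "h \<in> borel_measurable lborel" using that by (simp add: borel_measurable_continuous_onI)
      then have "h \<in> borel_measurable lebesgue" by (rule measurable_completion)
      then show ?thesis by (rule measurable_restrict_space1)
    qed
    have \<psi>m: "\<psi> j \<in> borel_measurable ?M" and grm: "grad (\<psi> j) \<in> borel_measurable ?M" for j
      using test_functionD(2,3)[OF \<psi>[of j]] by (auto intro: meas_cont)
    have dm: "(\<lambda>x. infdist x D) \<in> borel_measurable ?M"
      by (intro meas_cont continuous_intros)
    have err1: "(\<integral>\<^sup>+x. ennreal (norm (grad (\<psi> j) x - df x) powr p) \<partial>?M) \<le> err j"
      and err2: "(\<integral>\<^sup>+x. ennreal (norm (\<psi> j x - f x) powr p) \<partial>?M) \<le> err j" for j
      unfolding err_def by (auto intro!: nn_integral_mono ennreal_leI)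
    have gradbound: "(\<integral>\<^sup>+x. ennreal (norm (grad (\<psi> j) x) powr p) \<partial>?M) \<le> ennreal (2 powr p) * (I + err j)" for j
    proof -
      have "(\<integral>\<^sup>+x. ennreal (norm (grad (\<psi> j) x) powr p) \<partial>?M)
          \<le> (\<integral>\<^sup>+x. ennreal (2 powr p) * (ennreal (norm (df x) powr p) + ennreal (norm (grad (\<psi> j) x - df x) powr p)) \<partial>?M)"
      proof (rule nn_integral_mono)
        fix x
        have "norm (grad (\<psi> j) x) powr p \<le> (norm (df x) + norm (grad (\<psi> j) x - df x)) powr p"
          using p norm_triangle_sub[of "grad (\<psi> j) x" "df x"] by (intro powr_mono2) auto
        also have "\<dots> \<le> 2 powr p * (norm (df x) powr p + norm (grad (\<psi> j) x - df x) powr p)"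
          using p by (intro powr_add_le) auto
        finally show "ennreal (norm (grad (\<psi> j) x) powr p)
            \<le> ennreal (2 powr p) * (ennreal (norm (df x) powr p) + ennreal (norm (grad (\<psi> j) x - df x) powr p))"
          by (simp add: ennreal_mult''[symmetric] ennreal_plus[symmetric] ennreal_leI del: ennreal_plus)
      qed
      also have "\<dots> = ennreal (2 powr p) * (I + (\<integral>\<^sup>+x. ennreal (norm (grad (\<psi> j) x - df x) powr p) \<partial>?M))"
      proof -
        define P Q where "P x = ennreal (norm (df x) powr p)" and "Q x = ennreal (norm (grad (\<psi> j) x - df x) powr p)" for x
        have "P \<in> borel_measurable ?M" unfolding P_def using dfm by measurable
        moreover have "Q \<in> borel_measurable ?M"
          unfolding Q_def using borel_measurable_diff[OF grm[of j] dfm] by measurable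
        ultimately have "(\<integral>\<^sup>+x. ennreal (2 powr p) * (P x + Q x) \<partial>?M) = ennreal (2 powr p) * ((\<integral>\<^sup>+x. P x \<partial>?M) + (\<integral>\<^sup>+x. Q x \<partial>?M))"
          by (simp add: nn_integral_cmult nn_integral_add)
        then show ?thesis by (simp only: I_def P_def Q_def)
      qed
      also have "\<dots> \<le> ennreal (2 powr p) * (I + err j)"
        by (intro mult_left_mono add_left_mono err1) simp
      finally show ?thesis .
    qed
    \<comment> \<open>The inverse distance is unbounded on \<Omega>, so convergence in L^p does not
      pass directly to the quotients. On A n it is below n + 1, so the error gets a fixed finite
      factor and tends to 0 with j. The sets A n exhaust \<Omega>, and monotone convergence then
      removes n.\<close>
    define A where "A n = {x. 1 / real (Suc n) < infdist x D}" for n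
    have step: "(\<integral>\<^sup>+x. ?h x * indicator (A n) x \<partial>?M) \<le> ennreal c * I" for n
    proof -
      define N where "N = real (Suc n) powr p"
      have N: "N \<ge> 0" by (simp add: N_def)
      have "(\<integral>\<^sup>+x. ?h x * indicator (A n) x \<partial>?M)
          \<le> ennreal c * (I + err j) + ennreal (2 powr p * N) * err j" for j
      proof -
        have "(\<integral>\<^sup>+x. ?h x * indicator (A n) x \<partial>?M)
            \<le> (\<integral>\<^sup>+x. ennreal (2 powr p) * ennreal ((norm (\<psi> j x) / infdist x D) powr p) + ennreal (2 powr p * N) * ennreal (norm (\<psi> j x - f x) powr p) \<partial>?M)"
        proof (rule nn_integral_mono)
          fix x
          show "?h x * indicator (A n) x
             \<le> ennreal (2 powr p) * ennreal ((norm (\<psi> j x) / infdist x D) powr p) + ennreal (2 powr p * N) * ennreal (norm (\<psi> j x - f x) powr p)"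
          proof (cases "x \<in> A n")
            case True
            then have d: "1 / real (Suc n) < infdist x D" by (simp add: A_def)
            then have d0: "infdist x D > 0" by (rule less_trans[rotated]) simp
            have "norm (f x) / infdist x D \<le> norm (\<psi> j x) / infdist x D + norm (\<psi> j x - f x) / infdist x D"
              using norm_triangle_sub[of "f x" "\<psi> j x"] d0 by (simp add: add_divide_distrib[symmetric] divide_right_mono norm_minus_commute)
            moreover have "norm (\<psi> j x - f x) / infdist x D \<le> real (Suc n) * norm (\<psi> j x - f x)"
            proof -
              have "1 / infdist x D \<le> real (Suc n)" using d d0 by (simp add: field_simps)
              then show ?thesis using mult_right_mono[of "1 / infdist x D" "real (Suc n)" "norm (\<psi> j x - f x)"] by simp
            qed
            ultimately have "norm (f x) / infdist x D \<le> norm (\<psi> j x) / infdist x D + real (Suc n) * norm (\<psi> j x - f x)"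
              by linarith
            then have "(norm (f x) / infdist x D) powr p \<le> (norm (\<psi> j x) / infdist x D + real (Suc n) * norm (\<psi> j x - f x)) powr p"
              using p d0 by (intro powr_mono2) auto
            also have "\<dots> \<le> 2 powr p * ((norm (\<psi> j x) / infdist x D) powr p + (real (Suc n) * norm (\<psi> j x - f x)) powr p)"
              using p d0 by (intro powr_add_le) auto
            also have "\<dots> = 2 powr p * (norm (\<psi> j x) / infdist x D) powr p + 2 powr p * N * norm (\<psi> j x - f x) powr p"
              unfolding N_def by (subst powr_mult) (auto simp: algebra_simps)
            finally have "?h x
                \<le> ennreal (2 powr p * (norm (\<psi> j x) / infdist x D) powr p + 2 powr p * N * norm (\<psi> j x - f x) powr p)"
              by (rule ennreal_leI)
            also have "\<dots> = ennreal (2 powr p * (norm (\<psi> j x) / infdist x D) powr p) + ennreal (2 powr p * N * norm (\<psi> j x - f x) powr p)"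
              using N by (intro ennreal_plus) auto
            finally show ?thesis using True by (simp only: ennreal_mult'' powr_ge_zero indicator_simps mult_1_right)
          qed simp
        qed
        also have "\<dots> = ennreal (2 powr p) * (\<integral>\<^sup>+x. ennreal ((norm (\<psi> j x) / infdist x D) powr p) \<partial>?M)
            + ennreal (2 powr p * N) * (\<integral>\<^sup>+x. ennreal (norm (\<psi> j x - f x) powr p) \<partial>?M)"
        proof -
          define P Q where "P x = ennreal ((norm (\<psi> j x) / infdist x D) powr p)" and "Q x = ennreal (norm (\<psi> j x - f x) powr p)" for x
          have "P \<in> borel_measurable ?M" unfolding P_def using \<psi>m[of j] dm by measurable
          moreover have "Q \<in> borel_measurable ?M"
            unfolding Q_def using borel_measurable_diff[OF \<psi>m[of j] fm] by measurable
          ultimately have "(\<integral>\<^sup>+x. ennreal (2 powr p) * P x + ennreal (2 powr p * N) * Q x \<partial>?M)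
              = ennreal (2 powr p) * (\<integral>\<^sup>+x. P x \<partial>?M) + ennreal (2 powr p * N) * (\<integral>\<^sup>+x. Q x \<partial>?M)"
            by (simp add: nn_integral_cmult nn_integral_add)
          then show ?thesis by (simp only: P_def Q_def)
        qed
        also have "\<dots> \<le> ennreal (2 powr p) * (ennreal C * (ennreal (2 powr p) * (I + err j))) + ennreal (2 powr p * N) * err j"
        proof (intro add_mono mult_left_mono err2)
          show "(\<integral>\<^sup>+x. ennreal ((norm (\<psi> j x) / infdist x D) powr p) \<partial>?M) \<le> ennreal C * (ennreal (2 powr p) * (I + err j))"
            using C(2)[rule_format, OF \<psi>[of j]] mult_left_mono[OF gradbound[of j], of "ennreal C"]
            unfolding int_eq[symmetric] by (auto intro: order_trans)
        qed simp_all
        also have "ennreal (2 powr p) * (ennreal C * (ennreal (2 powr p) * (I + err j))) = ennreal c * (I + err j)"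
          using C(1) by (simp add: c_def ennreal_mult mult.assoc)
        finally show ?thesis .
      qed
      moreover have "(\<lambda>j. ennreal c * (I + err j) + ennreal (2 powr p * N) * err j) \<longlonglongrightarrow> ennreal c * (I + 0) + ennreal (2 powr p * N) * 0"
        using lim unfolding err_def[symmetric, abs_def] by (intro tendsto_add ennreal_tendsto_cmult tendsto_const) auto
      ultimately show ?thesis
        by (intro LIMSEQ_le_const[of "\<lambda>j. ennreal c * (I + err j) + ennreal (2 powr p * N) * err j"]) auto
    qed
    have "(\<integral>\<^sup>+x. ?h x \<partial>?M)
        \<le> (\<integral>\<^sup>+x. (SUP n. ?h x * indicator (A n) x) \<partial>?M)"
    proof (rule nn_integral_mono)
      fix x assume "x \<in> space ?M"
      then have "x \<in> \<Omega>" by (simp add: space_restrict_space)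
      from reals_Archimedean[OF dpos[OF this]] obtain n where "1 / real (Suc n) < infdist x D" by (auto simp: inverse_eq_divide)
      then have "x \<in> A n" by (simp add: A_def)
      then show "?h x \<le> (SUP n. ?h x * indicator (A n) x)"
        by (intro SUP_upper2[of n]) auto
    qed
    also have "\<dots> = (SUP n. \<integral>\<^sup>+x. ?h x * indicator (A n) x \<partial>?M)"
    proof (rule nn_integral_monotone_convergence_SUP)
      have "A i \<subseteq> A j" if "i \<le> j" for i j
      proof
        fix x assume "x \<in> A i"
        moreover have "1 / real (Suc j) \<le> 1 / real (Suc i)" using that by (intro divide_left_mono) auto
        ultimately show "x \<in> A j" unfolding A_def mem_Collect_eq by linarith
      qed
      then show "incseq (\<lambda>n x. ?h x * indicator (A n) x)"
        by (fastforce simp: incseq_def le_fun_def indicator_def)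
      fix n
      note [measurable] = fm dm
      show "(\<lambda>x. ?h x * indicator (A n) x) \<in> borel_measurable ?M"
        unfolding A_def indicator_def by measurable
    qed
    also have "\<dots> \<le> ennreal c * I" by (rule SUP_least) (rule step)
    finally show ?thesis by (simp add: I_def)
  qed
  with c show "\<exists>c\<ge>0. \<forall>(f :: real ^ 'n \<Rightarrow> 'b, df) \<in> W1_D p \<Omega> D.
      (\<integral>\<^sup>+x. ennreal ((norm (f x) / infdist x D) powr p) \<partial>lebesgue_on \<Omega>)
        \<le> ennreal c * (\<integral>\<^sup>+x. ennreal (norm (df x) powr p) \<partial>lebesgue_on \<Omega>)"
    by (intro exI[of _ c]) auto
qed

end
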